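(* Let $\frac12\le s<1$, $\Lambda\in\mathbb{N}$, and let $X^0\in\mathcal{R}^\Lambda$. There exists $\bar\varepsilon=\bar\varepsilon(s,X^0)>0$ such that, for every $0<\varepsilon<\bar\varepsilon$, denoting by $X_\varepsilon=X_\varepsilon(t)$ the unique solution to $$\dot X(t)=-\nabla\mathcal{E}^s_\varepsilon(X(t)),\qquad X(0)=X^0,$$ we have that $X_\varepsilon(t)\in\mathcal{R}^\Lambda$ for every $t\ge0$. Moreover, denoting by $X^\infty$ the unique (up to a permutation of indices) element of $\mathcal{C}^\Lambda$ such that $\mathrm{bar}(X^\infty)=\mathrm{bar}(X^0)$, we have (for $t\ge0$) $$\mathrm{dist}(X_\varepsilon(t),X^\infty)\le\mathrm{dist}(X^0,X^\infty)\,e^{-\gamma(s)\Lambda^{-2s}t},$$ where $\gamma(s)$ is the positive constant, depending only on $s$, in the Hessian lower bound $\langle\nabla^2\mathcal{E}^s_\varepsilon(Y)h,h\rangle\ge\gamma(s)\Lambda^{-2s}|h|^2$, valid for every $\varepsilon>0$, every $Y\in\mathcal{R}^\Lambda$ with $\delta(Y)\ge4\varepsilon$, and every $h\in\mathbb{R}^\Lambda$ with $\sum_{\lambda=1}^\Lambda h_\lambda=0$.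
   Context: Let $\mathcal{X}^\Lambda:=[0,\Lambda)^\Lambda$; entries of $X=(x_1,\dots,x_\Lambda)\in\mathcal{X}^\Lambda$ need not be distinct. Let $\mathcal{S}(X):=\{x_1,\dots,x_\Lambda\}$, let $\mathcal{R}^\Lambda$ be the set of $X\in\mathcal{X}^\Lambda$ with pairwise distinct entries, and let $\mathcal{C}^\Lambda:=\{X\in\mathcal{R}^\Lambda:\ \mathcal{S}(X)=\{\tau,1+\tau,\dots,\Lambda-1+\tau\}\text{ for some }\tau\in[0,1)\}$. Let $|t|_{\rm per}:=\min_{z\in\mathbb{Z}}|t+\Lambda z|$ and $\delta(X):=\min_{\lambda\neq\lambda'}|x_\lambda-x_{\lambda'}|_{\rm per}$, i.e. the minimal distance between particles of the $\Lambda$-periodic configuration generated by $X$ (equal to $1$ if $\Lambda=1$). For $X\in\mathcal{X}^\Lambda$, $X^{\rm ord}=(x_1^{\rm ord},\dots,x_\Lambda^{\rm ord})$ is the non-decreasing reordering of the entries of $X$. For $X,Y\in\mathcal{X}^\Lambda$, $$\mathrm{dist}(X,Y):=\Big(\sum_{\lambda=1}^\Lambda|x^{\rm ord}_\lambda-y^{\rm ord}_\lambda|_{\rm per}^2\Big)^{1/2}.$$ The barycenter is $\mathrm{bar}(X):=(X\cdot e)/\mathbb{Z}$, i.e. $X\cdot e$ taken modulo $\mathbb{Z}$, where $e:=\Lambda^{-1/2}\sum_{\lambda=1}^\Lambda e_\lambda$ and $\{e_\lambda\}$ is the canonical basis of $\mathbb{R}^\Lambda$. Let $\mu^X:=\sum_{\lambda=1}^{\Lambda}\sum_{k\in\mathbb{Z}}\delta_{x_\lambda+\Lambda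 k}$, and let $u^X\in BV_{\rm loc}(\mathbb{R})$ be the function, unique up to additive constants and $\Lambda$-periodic, whose distributional derivative is $(u^X)'=\mathrm{d}x-\mu^X$. Let $\rho$ be a fixed standard mollifier supported in $(-1,1)$ (smooth, nonnegative, even, with integral $1$), $\rho_\varepsilon(x):=\frac1\varepsilon\rho(\frac x\varepsilon)$, and $u^X_\varepsilon:=\rho_\varepsilon*u^X$. For $\varepsilon>0$, $$\mathcal{E}^s_\varepsilon(X):=\frac12\int_0^\Lambda \mathrm{d}x\int_{\mathbb{R}}\frac{|u^X_\varepsilon(x)-u^X_\varepsilon(y)|^2}{|x-y|^{1+2s}}\,\mathrm{d}y .$$ Gradient and Hessian are taken with respect to $(x_1,\dots,x_\Lambda)$, positions being read modulo $\Lambda$, and the differential equation is understood for the $\Lambda$-periodic extension of the configuration: each particle of the periodic configuration moves continuously on $\mathbb{R}$. The Cauchy problem has a unique $C^1$ solution on $[0,+\infty)$ for every initial datum in $\mathcal{X}^\Lambda$.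
   Formalization: The barycenter X·e is taken modulo √Λ, not modulo ℤ (otherwise X^∞ is not unique for Λ≥2), and dist is the minimum of the stated formula over cyclic shifts of the ordered labels (otherwise the decay fails, e.g. Λ=2, X⁰=(1.1,1.9)). *)

theory Defs
  imports "HOL-Analysis.Analysis" "HOL-Library.Real_Mod"
begin

text \<open>
  A configuration of \<open>\<Lambda>\<close> particles is a function on the indices \<open>{..<\<Lambda>}\<close>, i.e. the particle
  \<open>x\<^sub>\<lambda>\<close> with \<open>1 \<le> \<lambda> \<le> \<Lambda>\<close> is \<open>X (\<lambda> - 1)\<close>.  Functions of a configuration never look at indices
  outside \<open>{..<\<Lambda>}\<close>, and (except where a set of configurations in \<open>[0,\<Lambda>)\<close> is meant) positions are
  arbitrary reals, read modulo \<open>\<Lambda>\<close>.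
\<close>

section \<open>Configurations\<close>

definition X_conf :: "nat \<Rightarrow> (nat \<Rightarrow> real) set" where
  "X_conf \<Lambda> = {..<\<Lambda>} \<rightarrow>\<^sub>E {0..<real \<Lambda>}"

definition R_conf :: "nat \<Rightarrow> (nat \<Rightarrow> real) set" where
  "R_conf \<Lambda> = {X \<in> X_conf \<Lambda>. inj_on X {..<\<Lambda>}}"

definition C_conf :: "nat \<Rightarrow> (nat \<Rightarrow> real) set" where
  "C_conf \<Lambda> = {X \<in> R_conf \<Lambda>. \<exists>\<tau>\<in>{0..<1}. X ` {..<\<Lambda>} = (\<lambda>k. real k + \<tau>) ` {..<\<Lambda>}}"

text \<open>The representative in \<open>X_conf \<Lambda>\<close> of a configuration on the real line.\<close>

definition reduce :: "nat \<Rightarrow> (nat \<Rightarrow> real) \<Rightarrow> nat \<Rightarrow> real" where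
  "reduce \<Lambda> X = (\<lambda>i\<in>{..<\<Lambda>}. X i rmod real \<Lambda>)"

text \<open>The infimum is attained, so this is the minimum over the integers.\<close>

definition per_abs :: "nat \<Rightarrow> real \<Rightarrow> real" where
  "per_abs \<Lambda> t = (INF z :: int. \<bar>t + real \<Lambda> * of_int z\<bar>)"

definition min_dist :: "nat \<Rightarrow> (nat \<Rightarrow> real) \<Rightarrow> real" where
  "min_dist \<Lambda> X =
     (if \<Lambda> = 1 then 1
      else Min {per_abs \<Lambda> (X i - X j) | i j. i < \<Lambda> \<and> j < \<Lambda> \<and> i \<noteq> j})"

definition ordered :: "nat \<Rightarrow> (nat \<Rightarrow> real) \<Rightarrow> nat \<Rightarrow> real" where
  "ordered \<Lambda> X i = sort (map X [0..<\<Lambda>]) ! i"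

text \<open>
  Reading positions modulo \<open>\<Lambda>\<close> fixes the increasing labelling of a configuration only up to a
  cyclic shift: a particle moving continuously through \<open>0\<close> turns the first label into the last one.
  The distance compares the two increasing labellings and hence takes the best shift \<open>k\<close>.  The
  formula with \<open>k = 0\<close> alone is discontinuous along such motions: for \<open>\<Lambda> = 2\<close> it gives the
  configurations \<open>(1, 2 - \<eta>)\<close> and \<open>(0, 1)\<close> a distance close to \<open>sqrt 2\<close>, although the first one
  tends to the second one modulo \<open>2\<close> as \<open>\<eta>\<close> decreases to \<open>0\<close>.
\<close>

definition conf_dist :: "nat \<Rightarrow> (nat \<Rightarrow> real) \<Rightarrow> (nat \<Rightarrow> real) \<Rightarrow> real" where
  "conf_dist \<Lambda> X Y =
     (MIN k\<in>{..<\<Lambda>}.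
        sqrt (\<Sum>i<\<Lambda>. (per_abs \<Lambda> (ordered \<Lambda> X i - ordered \<Lambda> Y ((i + k) mod \<Lambda>)))\<^sup>2))"

text \<open>
  The component \<open>X \<bullet> e\<close> along the unit vector \<open>e = \<Lambda>\<^sup>-\<^sup>1\<^sup>/\<^sup>2 (1, \<dots>, 1)\<close>.  Moving one particle by
  \<open>\<Lambda>\<close> changes it by \<open>sqrt \<Lambda>\<close>, so this is the modulus for which it is well defined; equivalently,
  the mean position \<open>(\<Sum>i<\<Lambda>. X i) / \<Lambda>\<close> is taken modulo \<open>1\<close>.
\<close>

definition barycenter :: "nat \<Rightarrow> (nat \<Rightarrow> real) \<Rightarrow> real" where
  "barycenter \<Lambda> X = (\<Sum>i<\<Lambda>. X i * (1 / sqrt (real \<Lambda>))) rmod sqrt (real \<Lambda>)"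


section \<open>The potential of a configuration\<close>

definition smooth :: "(real \<Rightarrow> real) \<Rightarrow> bool" where
  "smooth f \<longleftrightarrow> (\<forall>n x. (deriv ^^ n) f differentiable (at x))"

definition test_function :: "(real \<Rightarrow> real) \<Rightarrow> bool" where
  "test_function \<phi> \<longleftrightarrow> smooth \<phi> \<and> (\<exists>r. \<forall>x. \<bar>x\<bar> > r \<longrightarrow> \<phi> x = 0)"

text \<open>The sum of the Dirac masses at all points \<open>X i + \<Lambda> k\<close>, counted with multiplicity.\<close>

definition particle_measure :: "nat \<Rightarrow> (nat \<Rightarrow> real) \<Rightarrow> real measure" where
  "particle_measure \<Lambda> X =
     distr (count_space ({..<\<Lambda>} \<times> (UNIV :: int set))) borel
       (\<lambda>(i, k). X i + real \<Lambda> * of_int k)"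

text \<open>
  \<open>u\<close> is locally integrable with distributional derivative \<open>dx - \<mu>\<^sup>X\<close>.  The derivative being a Radon
  measure, such a \<open>u\<close> is of locally bounded variation; it is determined, up to null sets, up to an
  additive constant.
\<close>

definition is_potential :: "nat \<Rightarrow> (nat \<Rightarrow> real) \<Rightarrow> (real \<Rightarrow> real) \<Rightarrow> bool" where
  "is_potential \<Lambda> X u \<longleftrightarrow>
     (\<forall>a b. set_integrable lborel {a..b} u) \<and>
     (\<forall>\<phi>. test_function \<phi> \<longrightarrow>
        - (LINT x|lborel. u x * deriv \<phi> x) =
          (LINT x|lborel. \<phi> x) - (LINT x|particle_measure \<Lambda> X. \<phi> x))"

definition potential :: "nat \<Rightarrow> (nat \<Rightarrow> real) \<Rightarrow> real \<Rightarrow> real" where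
  "potential \<Lambda> X = (SOME u. is_potential \<Lambda> X u)"

definition standard_mollifier :: "(real \<Rightarrow> real) \<Rightarrow> bool" where
  "standard_mollifier \<rho> \<longleftrightarrow>
     smooth \<rho> \<and> (\<forall>x. 0 \<le> \<rho> x) \<and> (\<forall>x. \<rho> (- x) = \<rho> x) \<and>
     (\<forall>x. x \<notin> {-1<..<1} \<longrightarrow> \<rho> x = 0) \<and> (LINT x|lborel. \<rho> x) = 1"

definition rescaled :: "(real \<Rightarrow> real) \<Rightarrow> real \<Rightarrow> real \<Rightarrow> real" where
  "rescaled \<rho> \<epsilon> x = 1 / \<epsilon> * \<rho> (x / \<epsilon>)"

definition mollified_potential ::
    "(real \<Rightarrow> real) \<Rightarrow> real \<Rightarrow> nat \<Rightarrow> (nat \<Rightarrow> real) \<Rightarrow> real \<Rightarrow> real" where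
  "mollified_potential \<rho> \<epsilon> \<Lambda> X x = (LINT y|lborel. rescaled \<rho> \<epsilon> (x - y) * potential \<Lambda> X y)"


section \<open>Energy, gradient flow and Hessian bound\<close>

text \<open>
  The additive constant left open in \<^const>\<open>potential\<close> cancels.  The integrand at \<open>y = x\<close> is \<open>0\<close>.
\<close>

definition energy ::
    "(real \<Rightarrow> real) \<Rightarrow> real \<Rightarrow> real \<Rightarrow> nat \<Rightarrow> (nat \<Rightarrow> real) \<Rightarrow> real" where
  "energy \<rho> s \<epsilon> \<Lambda> X =
     1 / 2 * (LINT x:{0..real \<Lambda>}|lborel. LINT y|lborel.
       \<bar>mollified_potential \<rho> \<epsilon> \<Lambda> X x - mollified_potential \<rho> \<epsilon> \<Lambda> X y\<bar>\<^sup>2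
         / \<bar>x - y\<bar> powr (1 + 2 * s))"

definition partial :: "nat \<Rightarrow> ((nat \<Rightarrow> real) \<Rightarrow> real) \<Rightarrow> (nat \<Rightarrow> real) \<Rightarrow> real" where
  "partial i F X = deriv (\<lambda>t. F (X(i := t))) (X i)"

text \<open>
  The particles move on the real line, without reduction modulo \<open>\<Lambda>\<close>, so that trajectories are
  continuous; the energy is \<open>\<Lambda>\<close>-periodic in each position.
\<close>

definition gradient_flow ::
    "(real \<Rightarrow> real) \<Rightarrow> real \<Rightarrow> real \<Rightarrow> nat \<Rightarrow> (nat \<Rightarrow> real) \<Rightarrow> (real \<Rightarrow> nat \<Rightarrow> real) \<Rightarrow> bool" where
  "gradient_flow \<rho> s \<epsilon> \<Lambda> X0 X \<longleftrightarrow>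
     (\<forall>i<\<Lambda>. X 0 i = X0 i) \<and>
     (\<forall>t\<ge>0. \<forall>i<\<Lambda>.
        ((\<lambda>t. X t i) has_real_derivative - partial i (energy \<rho> s \<epsilon> \<Lambda>) (X t)) (at t within {0..}))"

definition hessian_form ::
    "nat \<Rightarrow> ((nat \<Rightarrow> real) \<Rightarrow> real) \<Rightarrow> (nat \<Rightarrow> real) \<Rightarrow> (nat \<Rightarrow> real) \<Rightarrow> real" where
  "hessian_form \<Lambda> F Y h = (\<Sum>i<\<Lambda>. \<Sum>j<\<Lambda>. partial i (partial j F) Y * h i * h j)"

text \<open>The constant \<open>\<gamma>\<close> is uniform in \<open>\<Lambda>\<close>, \<open>\<epsilon>\<close> and the configuration.\<close>

definition hessian_lower_bound :: "(real \<Rightarrow> real) \<Rightarrow> real \<Rightarrow> real \<Rightarrow> bool" where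
  "hessian_lower_bound \<rho> s \<gamma> \<longleftrightarrow>
     (\<forall>\<Lambda>\<ge>1. \<forall>\<epsilon>>0. \<forall>Y\<in>R_conf \<Lambda>. min_dist \<Lambda> Y \<ge> 4 * \<epsilon> \<longrightarrow>
        (\<forall>h. (\<Sum>i<\<Lambda>. h i) = 0 \<longrightarrow>
           hessian_form \<Lambda> (energy \<rho> s \<epsilon> \<Lambda>) Y h
             \<ge> \<gamma> * real \<Lambda> powr (- 2 * s) * (\<Sum>i<\<Lambda>. (h i)\<^sup>2)))"

end

theory Submission
  imports Defs
begin

text \<open>
  The potential of a configuration is a sum of translates of a \<open>\<Lambda>\<close>-periodic sawtooth, so the energy is
  a sum of pair interactions \<open>G (x\<^sub>i - x\<^sub>j)\<close>, where \<open>G\<close> is the fractional Laplacian of the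
  autocorrelation \<open>c\<close> of the mollified sawtooth.  One has \<open>c'' \<le> 1 / \<Lambda>\<close>, with equality at all points of
  periodic distance at least \<open>2 \<epsilon>\<close> from \<open>0\<close>, and \<open>1 / \<Lambda> - c''\<close> has mass \<open>1\<close> on a period.  Hence at such points
  \<open>G''\<close> is at least the minimum \<open>\<Lambda> powr - (1 + 2 s)\<close> of the kernel on a period, which gives the
  Hessian bound with \<open>\<gamma> = 1\<close>.

  Along the flow the convexity of \<open>G\<close> keeps the smallest gap from decreasing, so the particles keep
  their cyclic order and stay where \<open>G'\<close> is strongly monotone.  Testing the equation against the
  displacement from the lattice configuration with the same mean then yields exponential decay.
  That this displacement realises the distance at time \<open>0\<close> is a statement about optimal matchings on the
  circle: individual windings of the particles never beat a common shift.
\<close>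

section \<open>Smooth functions\<close>

text \<open>No lower bound for \<open>G''\<close> is derived within distance
  \<open>2 * \<epsilon>\<close> of the multiples of \<Lambda>, so contraction cannot be claimed
  before the gaps are under control. Hence an invariant region has to precede every decay estimate,
  and the threshold \<open>\<epsilon>bar\<close> comes from the initial gaps, not from the
  mollifier. The value \<gamma> = 1 has two factors. Each pair contributes
  \<open>\<kappa> = \<Lambda> powr - (1 + 2 * s)\<close>, and for h of mean zero half the sum of
  \<open>(h i - h j)\<^sup>2\<close> over all ordered pairs is \<Lambda> times the squared norm of
  h. Their product is \<open>\<Lambda> powr (- 2 * s)\<close>. The two ends of the final estimate
  differ in difficulty. At time t the distance is bounded above, for which exhibiting one cyclic
  shift is enough. At time 0 it is bounded below, against every shift and every choice of windings;
  there the integrality of the windings is decisive. \<open>potential\<close> is an arbitrary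
  choice, so only differences of its mollification are ever evaluated.\<close>

lemma DERIV_of_quadratic_bound:
  fixes f :: "real \<Rightarrow> real"
  assumes "\<And>h. \<bar>h\<bar> \<le> 1 \<Longrightarrow> \<bar>f (x + h) - f x - h * d\<bar> \<le> K * h\<^sup>2"
  shows "(f has_real_derivative d) (at x)"
proof -
  have "((\<lambda>h. (f (x + h) - f x) / h - d) \<longlongrightarrow> 0) (at 0)"
  proof (rule Lim_null_comparison)
    show "\<forall>\<^sub>F h in at 0. norm ((f (x + h) - f x) / h - d) \<le> K * \<bar>h\<bar>"
      unfolding eventually_at
    proof (intro exI [of _ 1] conjI ballI impI)
      fix h :: real assume h: "h \<noteq> 0 \<and> dist h 0 < 1"
      have "h * ((f (x + h) - f x) / h - d) = f (x + h) - f x - h * d"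
        using h by (simp add: field_simps)
      then have "\<bar>h\<bar> * norm ((f (x + h) - f x) / h - d) = \<bar>f (x + h) - f x - h * d\<bar>"
        by (metis abs_mult real_norm_def)
      also have "\<dots> \<le> K * h\<^sup>2"
        using assms h by (simp add: dist_norm)
      also have "\<dots> = \<bar>h\<bar> * (K * \<bar>h\<bar>)"
        by (simp add: power2_eq_square)
      finally show "norm ((f (x + h) - f x) / h - d) \<le> K * \<bar>h\<bar>"
        using h by simp
    qed simp
    show "((\<lambda>h. K * \<bar>h\<bar>) \<longlongrightarrow> 0) (at 0)"
      using tendsto_mult_right_zero [OF tendsto_rabs_zero [OF tendsto_ident_at]] by blast
  qed
  then show ?thesis
    unfolding DERIV_def by (simp add: LIM_zero_iff)
qed

text \<open>Removing the linear part leaves a function whose derivative \<open>f' y - f' x\<close>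
  is at most \<open>B * \<bar>h\<bar>\<close> on the segment; the mean value bound supplies the
  second factor.\<close>

lemma taylor_quadratic_bound:
  fixes f :: "real \<Rightarrow> real"
  assumes f: "\<And>x. (f has_real_derivative f' x) (at x)"
    and f': "\<And>x. (f' has_real_derivative f'' x) (at x)"
    and B: "\<And>x. \<bar>f'' x\<bar> \<le> B"
  shows "\<bar>f (x + h) - f x - h * f' x\<bar> \<le> B * h\<^sup>2"
proof -
  have lip: "\<bar>f' y - f' x\<bar> \<le> B * \<bar>y - x\<bar>" for y
    using field_differentiable_bound [of UNIV f' f'' B y x, OF _ f'] B by simp
  define g where "g y = f y - y * f' x" for y
  have g: "(g has_real_derivative f' y - f' x) (at y)" for y
    unfolding g_def by (rule derivative_eq_intros f refl | simp)+
  have "norm (g (x + h) - g x) \<le> (B * \<bar>h\<bar>) * norm ((x + h) - x)"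
  proof (rule field_differentiable_bound [of "closed_segment x (x + h)" g "\<lambda>y. f' y - f' x"])
    fix y assume y: "y \<in> closed_segment x (x + h)"
    show "(g has_real_derivative f' y - f' x) (at y within closed_segment x (x + h))"
      using g by (rule has_field_derivative_at_within)
    have "\<bar>y - x\<bar> \<le> \<bar>h\<bar>"
      using segment_bound(1) [OF y] by simp
    moreover have "0 \<le> B"
      using B [of 0] by simp
    ultimately show "norm (f' y - f' x) \<le> B * \<bar>h\<bar>"
      using lip [of y] mult_left_mono [of "\<bar>y - x\<bar>" "\<bar>h\<bar>" B] by simp
  qed auto
  then show ?thesis
    by (simp add: g_def algebra_simps power2_eq_square flip: abs_mult)
qed

definition second_diff :: "(real \<Rightarrow> real) \<Rightarrow> real \<Rightarrow> real \<Rightarrow> real" where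
  "second_diff f z h = 2 * f z - f (z + h) - f (z - h)"

text \<open>The linear Taylor terms at h and -h cancel, which gives the quadratic bound for small h;
  boundedness of f takes over for large h. The factor \<open>min 1 (h\<^sup>2)\<close> is what makes
  the fractional kernel integrable at both ends.\<close>

lemma second_diff_bound:
  fixes f :: "real \<Rightarrow> real"
  assumes f: "\<And>x. (f has_real_derivative f' x) (at x)"
    and f': "\<And>x. (f' has_real_derivative f'' x) (at x)"
    and B: "\<And>x. \<bar>f x\<bar> \<le> B" "\<And>x. \<bar>f'' x\<bar> \<le> B"
  shows "\<bar>second_diff f z h\<bar> \<le> 4 * B * min 1 (h\<^sup>2)"
proof -
  have "0 \<le> B * h\<^sup>2"
    using B(1) [of 0] by simp
  moreover have "\<bar>second_diff f z h\<bar> \<le> 2 * B * h\<^sup>2"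
    using taylor_quadratic_bound [OF f f' B(2), of z h]
      taylor_quadratic_bound [OF f f' B(2), of z "- h"]
    by (simp add: second_diff_def)
  moreover have "\<bar>second_diff f z h\<bar> \<le> 4 * B"
    unfolding second_diff_def using B(1) [of z] B(1) [of "z + h"] B(1) [of "z - h"] by linarith
  ultimately show ?thesis
    by (cases "1 \<le> h\<^sup>2") (simp_all add: min_def)
qed

text \<open>A Taylor remainder bounded by an integrable function times \<open>h\<^sup>2\<close>
  stays quadratic after integration. This takes the place of dominated convergence at each
  differentiation under the integral sign.\<close>

lemma DERIV_integral_quadratic:
  fixes F :: "real \<Rightarrow> 'a \<Rightarrow> real"
  assumes F: "\<And>z. integrable M (F z)" and F1: "integrable M F1" and k: "integrable M k"
    and bound: "\<And>h y. y \<in> space M \<Longrightarrow> \<bar>h\<bar> \<le> 1 \<Longrightarrow> \<bar>F (x + h) y - F x y - h * F1 y\<bar> \<le> k y * h\<^sup>2"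
  shows "((\<lambda>z. \<integral>y. F z y \<partial>M) has_real_derivative (\<integral>y. F1 y \<partial>M)) (at x)"
proof (rule DERIV_of_quadratic_bound)
  fix h :: real assume h: "\<bar>h\<bar> \<le> 1"
  have "\<bar>(\<integral>y. F (x + h) y \<partial>M) - (\<integral>y. F x y \<partial>M) - h * (\<integral>y. F1 y \<partial>M)\<bar>
      = \<bar>\<integral>y. F (x + h) y - F x y - h * F1 y \<partial>M\<bar>"
    by (subst Bochner_Integration.integral_diff Bochner_Integration.integral_mult_right_zero;
        (intro Bochner_Integration.integrable_diff integrable_mult_right F F1)?)+ (rule refl)
  also have "\<dots> \<le> (\<integral>y. \<bar>F (x + h) y - F x y - h * F1 y\<bar> \<partial>M)"
    by (rule integral_abs_bound)
  also have "\<dots> \<le> (\<integral>y. k y * h\<^sup>2 \<partial>M)"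
    using F F1 k bound h by (intro integral_mono) auto
  finally show "\<bar>(\<integral>y. F (x + h) y \<partial>M) - (\<integral>y. F x y \<partial>M) - h * (\<integral>y. F1 y \<partial>M)\<bar>
      \<le> (\<integral>y. k y \<partial>M) * h\<^sup>2"
    by simp
qed

lemma smooth_DERIV:
  assumes "smooth f"
  shows "((deriv ^^ n) f has_real_derivative (deriv ^^ Suc n) f x) (at x)"
  using assms unfolding smooth_def by (simp add: DERIV_deriv_iff_real_differentiable)

text \<open>Naming all derivatives at once as a family F avoids computing iterated
  \<open>deriv\<close>. Convolutions and correlations fit, as their n-th derivative is the same
  operation applied to the n-th derivative of one factor.\<close>

lemma smoothI:
  fixes F :: "nat \<Rightarrow> real \<Rightarrow> real"
  assumes "\<And>n x. (F n has_real_derivative F (Suc n) x) (at x)"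
  shows "smooth (F 0)" "(deriv ^^ n) (F 0) = F n"
proof -
  show eq: "(deriv ^^ n) (F 0) = F n" for n
  proof (induction n)
    case (Suc n)
    then show ?case
      by (auto intro!: ext DERIV_imp_deriv [OF assms])
  qed simp
  show "smooth (F 0)"
    unfolding smooth_def eq using assms real_differentiable_def by blast
qed

lemma smooth_Suc: "smooth f \<longleftrightarrow> (\<forall>x. f differentiable at x) \<and> smooth (deriv f)"
proof -
  have "(deriv ^^ n) (deriv f) = (deriv ^^ Suc n) f" for n
    by (simp add: funpow_swap1)
  then show ?thesis
    unfolding smooth_def by (metis (no_types) funpow_0 not0_implies_Suc)
qed

definition bounded_smooth :: "(real \<Rightarrow> real) \<Rightarrow> bool" where
  "bounded_smooth f \<longleftrightarrow> smooth f \<and> (\<forall>n. \<exists>B. \<forall>x. \<bar>(deriv ^^ n) f x\<bar> \<le> B)"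

lemma bounded_smooth_deriv: "bounded_smooth f \<Longrightarrow> bounded_smooth (deriv f)"
  unfolding bounded_smooth_def
  by (metis comp_apply funpow_Suc_right smooth_Suc)

lemma bounded_smooth_DERIV: "bounded_smooth f \<Longrightarrow> (f has_real_derivative deriv f x) (at x)"
  using smooth_DERIV [of f 0] by (simp add: bounded_smooth_def)

lemma bounded_smooth_continuous_on: "bounded_smooth f \<Longrightarrow> continuous_on S f"
  by (meson bounded_smooth_DERIV DERIV_continuous_on has_field_derivative_at_within)

lemma bounded_smooth_bounded:
  assumes "bounded_smooth f" obtains B where "\<And>x. \<bar>f x\<bar> \<le> B"
  using assms unfolding bounded_smooth_def by (metis funpow_0)

lemma bounded_smoothI:
  fixes F :: "nat \<Rightarrow> real \<Rightarrow> real"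
  assumes "\<And>n x. (F n has_real_derivative F (Suc n) x) (at x)"
    and "\<And>n. \<exists>B. \<forall>x. \<bar>F n x\<bar> \<le> B"
  shows "bounded_smooth (F 0)"
  unfolding bounded_smooth_def using smoothI [where F = F, OF assms(1)] assms(2) by simp

lemma bounded_smooth_funpow: "bounded_smooth f \<Longrightarrow> bounded_smooth ((deriv ^^ n) f)"
  by (induction n) (auto intro: bounded_smooth_deriv)

lemma smooth_affine:
  assumes "smooth f"
  shows "smooth (\<lambda>y. c * f (a * y + b))"
proof -
  let ?F = "\<lambda>n y. c * a ^ n * (deriv ^^ n) f (a * y + b)"
  have "(?F n has_real_derivative ?F (Suc n) y) (at y)" for n y
    by (rule derivative_eq_intros DERIV_chain' [OF _ smooth_DERIV [OF assms]] | simp)+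
  from smoothI(1) [of ?F, OF this] show ?thesis
    by simp
qed

lemma smooth_diff:
  assumes "smooth f" "smooth g"
  shows "smooth (\<lambda>y. f y - g y)"
proof -
  let ?F = "\<lambda>n y. (deriv ^^ n) f y - (deriv ^^ n) g y"
  have "(?F n has_real_derivative ?F (Suc n) y) (at y)" for n y
    by (intro DERIV_diff smooth_DERIV assms)
  from smoothI(1) [of ?F, OF this] show ?thesis by simp
qed

section \<open>Compactly supported test functions\<close>

lemma test_function_affine:
  assumes "test_function f" "a \<noteq> 0"
  shows "test_function (\<lambda>y. c * f (a * y + b))"
proof -
  from assms obtain r where r: "\<And>x. \<bar>x\<bar> > r \<Longrightarrow> f x = 0"
    unfolding test_function_def by auto
  have "f (a * y + b) = 0" if "\<bar>y\<bar> > (\<bar>r\<bar> + \<bar>b\<bar>) / \<bar>a\<bar>" for y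
  proof (rule r)
    have "\<bar>r\<bar> + \<bar>b\<bar> < \<bar>a * y\<bar>"
      using that assms(2) by (simp add: field_simps abs_mult)
    then show "r < \<bar>a * y + b\<bar>" by linarith
  qed
  then show ?thesis
    using assms unfolding test_function_def by (auto intro!: smooth_affine)
qed

lemma test_function_diff:
  assumes "test_function f" "test_function g"
  shows "test_function (\<lambda>y. f y - g y)"
proof -
  from assms obtain r r' where "\<And>x. \<bar>x\<bar> > r \<Longrightarrow> f x = 0" "\<And>x. \<bar>x\<bar> > r' \<Longrightarrow> g x = 0"
    unfolding test_function_def by auto
  then have "\<forall>x. \<bar>x\<bar> > max r r' \<longrightarrow> f x - g x = 0" by simp
  then show ?thesis
    using assms unfolding test_function_def by (blast intro: smooth_diff)
qed

lemma deriv_vanishes_outside: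
  fixes f :: "real \<Rightarrow> real"
  assumes "\<And>x. \<bar>x\<bar> > r \<Longrightarrow> f x = 0" "\<bar>x\<bar> > r"
  shows "deriv f x = 0"
proof (rule DERIV_imp_deriv)
  have "open {x. r < \<bar>x\<bar>}" by (intro open_Collect_less continuous_intros)
  then show "(f has_real_derivative 0) (at x)"
    by (rule has_field_derivative_transform_within_open [OF DERIV_const [of 0]]) (simp_all add: assms)
qed

lemma test_function_deriv:
  assumes "test_function f"
  shows "test_function (deriv f)"
  using assms deriv_vanishes_outside [of _ f] smooth_Suc unfolding test_function_def by blast

lemma test_function_DERIV: "test_function f \<Longrightarrow> (f has_real_derivative deriv f x) (at x)"
  using smooth_DERIV [of f 0] by (simp add: test_function_def)

lemma test_function_continuous_on: "test_function f \<Longrightarrow> continuous_on S f"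
  by (meson test_function_DERIV DERIV_continuous_on has_field_derivative_at_within)

lemma test_function_bounded:
  assumes f: "test_function f"
  shows "\<exists>B. \<forall>x. \<bar>f x\<bar> \<le> B"
proof -
  from f obtain r where r: "\<And>x. \<bar>x\<bar> > r \<Longrightarrow> f x = 0"
    unfolding test_function_def by auto
  have "compact (f ` {-\<bar>r\<bar>..\<bar>r\<bar>})"
    by (intro compact_continuous_image test_function_continuous_on f) auto
  then obtain B where B: "\<forall>x\<in>{-\<bar>r\<bar>..\<bar>r\<bar>}. \<bar>f x\<bar> \<le> B"
    unfolding bounded_iff by (auto dest!: compact_imp_bounded simp: bounded_iff simp del: atLeastAtMost_iff)
  have "\<bar>f x\<bar> \<le> max B 0" for x
  proof (cases "\<bar>x\<bar> \<le> \<bar>r\<bar>")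
    case True
    then have "x \<in> {-\<bar>r\<bar>..\<bar>r\<bar>}" by (simp add: abs_le_iff)
    then show ?thesis using B by (meson max.coboundedI1)
  next
    case False
    then show ?thesis using r [of x] by simp
  qed
  then show ?thesis by blast
qed

lemma test_function_rescaled:
  assumes "standard_mollifier \<rho>" "0 < \<epsilon>"
  shows "test_function (rescaled \<rho> \<epsilon>)"
proof -
  have "\<bar>x\<bar> > 1 \<longrightarrow> \<rho> x = 0" for x
    using assms(1) unfolding standard_mollifier_def
    by (metis abs_less_iff greaterThanLessThan_iff minus_less_iff not_less_iff_gr_or_eq)
  then have "test_function \<rho>"
    using assms(1) unfolding standard_mollifier_def test_function_def by blast
  from test_function_affine [OF this, of "1 / \<epsilon>" "1 / \<epsilon>" 0] assms(2) show ?thesis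
    by (simp add: rescaled_def [abs_def])
qed

section \<open>The potential\<close>

lemma compact_support_FTC:
  fixes f f' :: "real \<Rightarrow> real"
  assumes f: "\<And>x. (f has_real_derivative f' x) (at x)" and f': "continuous_on UNIV f'"
    and r: "\<And>x. \<bar>x\<bar> > r \<Longrightarrow> f x = 0"
  shows "integrable lborel (\<lambda>x. indicator {p..} x * f' x)"
    and "(LINT x|lborel. indicator {p..} x * f' x) = - f p"
    and "integrable lborel f'"
    and "(LINT x|lborel. f' x) = 0"
proof -
  have 0: "f' x = 0" if "\<bar>x\<bar> > r" for x
    using deriv_vanishes_outside [of r f x] r that DERIV_imp_deriv [OF f] by simp
  have ftc: "integrable lborel (\<lambda>x. indicator {p..} x * f' x) \<and>
      (LINT x|lborel. indicator {p..} x * f' x) = - f p" for p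
  proof -
    \<comment> \<open>The right endpoint lies beyond both p and the support, so f vanishes there and
      the half-line integral is one over a compact interval.\<close>
    let ?q = "max p (\<bar>r\<bar> + 1)"
    have eq: "indicator {p..} x * f' x = f' x * indicator {p..?q} x" for x
      using 0 [of x] by (cases "\<bar>x\<bar> > r") (auto simp: indicator_def)
    have "f ?q = 0" using r [of ?q] by simp
    moreover have "integrable lborel (\<lambda>x. f' x * indicator {p..?q} x)"
      using borel_integrable_atLeastAtMost' [of p ?q f'] continuous_on_subset [OF f']
      by (simp add: set_integrable_def mult.commute)
    moreover have "(LINT x|lborel. f' x * indicator {p..?q} x) = f ?q - f p"
      using f f' by (intro integral_FTC_Icc_real) (auto simp: continuous_on_eq_continuous_at)
    ultimately show ?thesis unfolding eq by simp
  qed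
  then show "integrable lborel (\<lambda>x. indicator {p..} x * f' x)"
    and "(LINT x|lborel. indicator {p..} x * f' x) = - f p"
    by auto
  have eq: "indicator {- \<bar>r\<bar> - 1..} x * f' x = f' x" for x
    using 0 [of x] by (auto simp: indicator_def)
  have "f (- \<bar>r\<bar> - 1) = 0" using r [of "- \<bar>r\<bar> - 1"] by simp
  then show "integrable lborel f'" "(LINT x|lborel. f' x) = 0"
    using ftc [of "- \<bar>r\<bar> - 1"] unfolding eq by auto
qed

text \<open>On the support of f a sawtooth is a linear function plus a constant minus finitely many
  unit steps. These are the pairings of each such piece with the derivative of f.\<close>

lemma integral_deriv_test_function:
  assumes f: "test_function f"
  shows "(LINT x|lborel. deriv f x) = 0"
    and "integrable lborel (deriv f)"
    and "(LINT x|lborel. indicator {p..} x * deriv f x) = - f p"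
    and "integrable lborel (\<lambda>x. indicator {p..} x * deriv f x)"
    and "(LINT x|lborel. x * deriv f x) = - (LINT x|lborel. f x)"
proof -
  obtain r where r: "\<And>x. \<bar>x\<bar> > r \<Longrightarrow> f x = 0"
    using f unfolding test_function_def by auto
  note cont = test_function_continuous_on [OF f] test_function_continuous_on [OF test_function_deriv [OF f]]
  note ftc = compact_support_FTC [of f "deriv f" r, OF test_function_DERIV [OF f] cont(2) r]
  show "(LINT x|lborel. deriv f x) = 0" "integrable lborel (deriv f)"
    "(LINT x|lborel. indicator {p..} x * deriv f x) = - f p"
    "integrable lborel (\<lambda>x. indicator {p..} x * deriv f x)"
    using ftc by auto
  have "((\<lambda>x. x * f x) has_real_derivative f x + x * deriv f x) (at x)" for x
    by (rule derivative_eq_intros test_function_DERIV [OF f] refl | simp)+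
  moreover have "continuous_on UNIV (\<lambda>x. f x + x * deriv f x)"
    by (intro continuous_intros cont)
  moreover have "\<bar>x\<bar> > r \<Longrightarrow> x * f x = 0" for x
    using r by simp
  ultimately have "(LINT x|lborel. f x + x * deriv f x) = 0" "integrable lborel (\<lambda>x. f x + x * deriv f x)"
    using compact_support_FTC [of "\<lambda>x. x * f x" "\<lambda>x. f x + x * deriv f x" r] by blast+
  moreover have "integrable lborel f"
  proof -
    have eq: "f x = indicator {-r..r} x * f x" for x
      using r [of x] by (cases "\<bar>x\<bar> \<le> r") (auto simp: indicator_def abs_le_iff)
    show ?thesis
      using borel_integrable_atLeastAtMost' [OF cont(1), of "-r" r]
      by (subst eq [abs_def]) (simp add: set_integrable_def)
  qed
  ultimately show "(LINT x|lborel. x * deriv f x) = - (LINT x|lborel. f x)"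
    using Bochner_Integration.integral_diff [of lborel "\<lambda>x. f x + x * deriv f x" f] by simp
qed

lemma integrable_test_function_times:
  fixes u :: "real \<Rightarrow> real"
  assumes f: "test_function f" and u: "\<And>a b. set_integrable lborel {a..b} u"
  shows "integrable lborel (\<lambda>x. f x * u x)"
proof -
  from f obtain r where r: "\<And>x. \<bar>x\<bar> > r \<Longrightarrow> f x = 0"
    unfolding test_function_def by auto
  obtain B where B: "\<And>x. \<bar>f x\<bar> \<le> B"
    using test_function_bounded [OF f] by blast
  have [measurable]: "f \<in> borel_measurable borel"
    by (intro borel_measurable_continuous_onI test_function_continuous_on f)
  have int: "integrable lborel (\<lambda>x. indicator {-r..r} x * u x)"
    using u [of "- r" r] by (simp add: set_integrable_def)
  have "integrable lborel (\<lambda>x. f x * (indicator {-r..r} x * u x))"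
  proof (rule Bochner_Integration.integrable_bound)
    show "integrable lborel (\<lambda>x. B * (indicator {-r..r} x * u x))"
      using int by simp
    show "(\<lambda>x. f x * (indicator {-r..r} x * u x)) \<in> borel_measurable lborel"
      by (intro borel_measurable_times borel_measurable_integrable [OF int]) simp
    show "AE x in lborel. norm (f x * (indicator {-r..r} x * u x))
        \<le> norm (B * (indicator {-r..r} x * u x))"
    proof (rule AE_I2)
      fix x
      have "\<bar>f x\<bar> \<le> \<bar>B\<bar>"
        using B [of x] by linarith
      then show "norm (f x * (indicator {-r..r} x * u x)) \<le> norm (B * (indicator {-r..r} x * u x))"
        by (simp only: real_norm_def abs_mult [of "f x"] abs_mult [of B] mult_right_mono abs_ge_zero)
    qed
  qed
  moreover have "f x * (indicator {-r..r} x * u x) = f x * u x" for x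
    using r [of x] by (cases "\<bar>x\<bar> \<le> r") (auto simp: indicator_def abs_le_iff)
  ultimately show ?thesis by simp
qed

lemma set_integrable_frac:
  "set_integrable lborel {a..b} (\<lambda>x::real. frac ((x - c) / L))"
proof -
  have "integrable lborel (\<lambda>x::real. indicator {a..b} x * frac ((x - c) / L))"
  proof (rule Bochner_Integration.integrable_bound)
    show "integrable lborel (indicator {a..b} :: real \<Rightarrow> real)"
      by (rule integrable_real_indicator) (auto simp: emeasure_lborel_Icc_eq)
    have [measurable]: "(\<lambda>x::real. frac ((x - c) / L)) \<in> borel_measurable borel"
      unfolding frac_def by measurable
    show "(\<lambda>x::real. indicator {a..b} x * frac ((x - c) / L)) \<in> borel_measurable lborel"
      by measurable
    show "AE x in lborel. norm (indicat_real {a..b} x * frac ((x - c) / L)) \<le> norm (indicat_real {a..b} x)"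
      using frac_lt_1 [THEN less_imp_le] by (auto simp: indicator_def)
  qed
  then show ?thesis
    by (simp add: set_integrable_def)
qed

lemma finite_nonzero_lattice:
  fixes f :: "real \<Rightarrow> real"
  assumes f: "\<And>x. \<bar>x\<bar> > r \<Longrightarrow> f x = 0" and L: "L > 0"
  shows "finite {k::int. f (a + L * of_int k) \<noteq> 0}"
proof (rule finite_subset)
  show "{k::int. f (a + L * of_int k) \<noteq> 0} \<subseteq> {\<lfloor>(- r - a) / L\<rfloor>..\<lceil>(r - a) / L\<rceil>}"
  proof safe
    fix k :: int assume "f (a + L * of_int k) \<noteq> 0"
    then have "\<bar>a + L * of_int k\<bar> \<le> r" using f by force
    then have "(- r - a) / L \<le> of_int k" "of_int k \<le> (r - a) / L"
      using L by (auto simp: field_simps abs_le_iff)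
    then show "k \<in> {\<lfloor>(- r - a) / L\<rfloor>..\<lceil>(r - a) / L\<rceil>}"
      by (auto simp: floor_le_iff le_ceiling_iff)
  qed
qed simp

text \<open>The floor counts the unit steps at the integers passed so far. The count over
  \<open>{-M<..M}\<close> starts just above -M, whence the offset \<open>- of_int M\<close>.\<close>

lemma floor_eq_sum_indicator:
  fixes t :: real
  assumes "\<bar>t\<bar> \<le> real_of_int M"
  shows "real_of_int \<lfloor>t\<rfloor> = - of_int M + (\<Sum>k\<in>{-M<..M}. indicator {of_int k..} t)"
proof -
  have "(\<Sum>k\<in>{-M<..M}. indicat_real {of_int k..} t) = (\<Sum>k\<in>{-M<..M}. if k \<le> \<lfloor>t\<rfloor> then 1 else 0)"
    by (intro sum.cong) (auto simp: indicator_def le_floor_iff)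
  also have "\<dots> = real (card ({-M<..M} \<inter> {k. k \<le> \<lfloor>t\<rfloor>}))"
    by (simp add: sum.If_cases)
  also have "{-M<..M} \<inter> {k. k \<le> \<lfloor>t\<rfloor>} = {-M<..\<lfloor>t\<rfloor>}"
  proof -
    have "\<lfloor>t\<rfloor> \<le> M" using assms by (simp add: floor_le_iff)
    then show ?thesis by auto
  qed
  also have "real (card {-M<..\<lfloor>t\<rfloor>}) = of_int \<lfloor>t\<rfloor> + of_int M"
  proof -
    have "- M \<le> \<lfloor>t\<rfloor>" using assms by (simp add: le_floor_iff)
    then show ?thesis by simp
  qed
  finally show ?thesis by simp
qed

text \<open>As a distribution the sawtooth has derivative 1 / L minus unit masses at the points a +
  L k: it climbs from 0 to 1 over each period and drops back there. Only the finitely many points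
  where f does not vanish are summed, so no infinite series occurs.\<close>

lemma integral_frac_deriv:
  assumes f: "test_function f" and L: "L > 0"
  shows "(LINT x|lborel. frac ((x - a) / L) * deriv f x) =
    (\<Sum>k | f (a + L * of_int k) \<noteq> 0. f (a + L * of_int k)) - (LINT x|lborel. f x) / L"
proof -
  obtain r where r: "\<And>x. \<bar>x\<bar> > r \<Longrightarrow> f x = 0"
    using f unfolding test_function_def by auto
  note f' = test_function_deriv [OF f]
  \<comment> \<open>The extra 1 makes \<open>\<bar>(x - a) / L\<bar> < M\<close> strict on the
    support, so that every lattice point there has index in the half-open range
    \<open>{-M<..M}\<close>.\<close>
  define M where "M = \<lceil>(\<bar>r\<bar> + \<bar>a\<bar>) / L\<rceil> + 1"
  have M: "(\<bar>r\<bar> + \<bar>a\<bar>) / L < of_int M"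
    unfolding M_def by linarith
  have fl: "\<bar>(x - a) / L\<bar> < of_int M" if "\<bar>x\<bar> \<le> r" for x
  proof -
    have "\<bar>(x - a) / L\<bar> = \<bar>x - a\<bar> / L" using L by (simp add: abs_divide)
    also have "\<dots> \<le> (\<bar>r\<bar> + \<bar>a\<bar>) / L" using L that by (intro divide_right_mono) auto
    finally show ?thesis using M by linarith
  qed
  have deriv_0: "deriv f x = 0" if "\<not> \<bar>x\<bar> \<le> r" for x
    using deriv_vanishes_outside [of r f x] r that by simp
  have eq: "frac ((x - a) / L) * deriv f x = (1 / L) * (x * deriv f x) + (of_int M - a / L) * deriv f x
      - (\<Sum>k\<in>{-M<..M}. indicator {a + L * of_int k..} x * deriv f x)" for x
  proof (cases "\<bar>x\<bar> \<le> r")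
    case True
    have "indicator {of_int k..} ((x - a) / L) = (indicator {a + L * of_int k..} x :: real)" for k
      using L by (auto simp: indicator_def field_simps)
    then have "frac ((x - a) / L) = (x - a) / L + of_int M - (\<Sum>k\<in>{-M<..M}. indicator {a + L * of_int k..} x)"
      unfolding frac_def floor_eq_sum_indicator [OF less_imp_le [OF fl [OF True]]] by simp
    then have "frac ((x - a) / L) * deriv f x = ((x - a) / L + of_int M) * deriv f x
        - (\<Sum>k\<in>{-M<..M}. indicator {a + L * of_int k..} x * deriv f x)"
      by (simp only: left_diff_distrib sum_distrib_right)
    then show ?thesis
      by (simp add: ring_distribs diff_divide_distrib)
  qed (simp add: deriv_0)
  have int1: "integrable lborel (\<lambda>x. x * deriv f x)"
    using integrable_test_function_times [OF f', of "\<lambda>x. x"]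
    by (simp add: mult.commute borel_integrable_atLeastAtMost' continuous_on_id)
  note int2 = integral_deriv_test_function(2) [OF f]
  have int3: "integrable lborel (\<lambda>x. \<Sum>k\<in>{-M<..M}. indicator {a + L * of_int k..} x * deriv f x)"
    by (intro Bochner_Integration.integrable_sum integral_deriv_test_function(4) [OF f])
  have "(LINT x|lborel. frac ((x - a) / L) * deriv f x) =
    (1 / L) * (LINT x|lborel. x * deriv f x) + (of_int M - a / L) * (LINT x|lborel. deriv f x)
    - (\<Sum>k\<in>{-M<..M}. LINT x|lborel. indicator {a + L * of_int k..} x * deriv f x)"
    unfolding eq
    by (subst Bochner_Integration.integral_sum [symmetric], rule integral_deriv_test_function(4) [OF f],
        subst Bochner_Integration.integral_diff)
      (use int1 int2 int3 in simp_all)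
  also have "\<dots> = (\<Sum>k\<in>{-M<..M}. f (a + L * of_int k)) - (LINT x|lborel. f x) / L"
    unfolding integral_deriv_test_function [OF f] by (simp add: sum_negf)
  also have "(\<Sum>k\<in>{-M<..M}. f (a + L * of_int k)) = (\<Sum>k | f (a + L * of_int k) \<noteq> 0. f (a + L * of_int k))"
  proof (rule sum.mono_neutral_right)
    show "{k. f (a + L * of_int k) \<noteq> 0} \<subseteq> {- M<..M}"
    proof safe
      fix k :: int assume "f (a + L * of_int k) \<noteq> 0"
      then have "\<bar>a + L * of_int k\<bar> \<le> r" using r by force
      from fl [OF this] have "\<bar>real_of_int k\<bar> < of_int M" using L by simp
      then show "k \<in> {- M<..M}" by auto
    qed
  qed auto
  finally show ?thesis .
qed

text \<open>Coinciding particles remain distinct index pairs in the counting measure, so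
  multiplicities are kept; f meets only finitely many pairs.\<close>

lemma integral_particle_measure:
  assumes f: "test_function f" and \<Lambda>: "\<Lambda> \<ge> 1"
  shows "(LINT x|particle_measure \<Lambda> X. f x) =
    (\<Sum>i<\<Lambda>. \<Sum>k::int | f (X i + real \<Lambda> * of_int k) \<noteq> 0. f (X i + real \<Lambda> * of_int k))"
proof -
  obtain r where r: "\<And>x. \<bar>x\<bar> > r \<Longrightarrow> f x = 0"
    using f unfolding test_function_def by auto
  have fin: "finite {k::int. f (X i + real \<Lambda> * of_int k) \<noteq> 0}" for i
    using finite_nonzero_lattice [of r f "real \<Lambda>" "X i"] r \<Lambda> by simp
  let ?g = "\<lambda>(i, k::int). X i + real \<Lambda> * of_int k"
  have [measurable]: "f \<in> borel_measurable borel"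
    by (intro borel_measurable_continuous_onI test_function_continuous_on f)
  have S: "{a \<in> {..<\<Lambda>} \<times> UNIV. f (?g a) \<noteq> 0} = (SIGMA i:{..<\<Lambda>}. {k::int. f (X i + real \<Lambda> * of_int k) \<noteq> 0})"
    by auto
  have "(LINT x|particle_measure \<Lambda> X. f x) = (LINT a|count_space ({..<\<Lambda>} \<times> (UNIV :: int set)). f (?g a))"
    unfolding particle_measure_def by (subst integral_distr) auto
  also have "\<dots> = (\<Sum>a\<in>{a \<in> {..<\<Lambda>} \<times> UNIV. f (?g a) \<noteq> 0}. f (?g a))"
    by (subst lebesgue_integral_count_space_finite_support) (auto simp: S intro!: finite_SigmaI fin simp del: mem_Sigma_iff)
  also have "\<dots> = (\<Sum>i<\<Lambda>. \<Sum>k::int | f (X i + real \<Lambda> * of_int k) \<noteq> 0. f (X i + real \<Lambda> * of_int k))"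
    unfolding S by (subst sum.Sigma) (auto intro: fin sum.cong)
  finally show ?thesis .
qed

text \<open>Each term has slope 1 / \<Lambda> and drops by 1 at the translates of its particle, so
  \<Lambda> of them together have derivative dx minus the particle measure.\<close>

definition sawtooth_potential :: "nat \<Rightarrow> (nat \<Rightarrow> real) \<Rightarrow> real \<Rightarrow> real" where
  "sawtooth_potential \<Lambda> X x = (\<Sum>i<\<Lambda>. frac ((x - X i) / real \<Lambda>))"

lemma is_potential_sawtooth:
  assumes \<Lambda>: "\<Lambda> \<ge> 1"
  shows "is_potential \<Lambda> X (sawtooth_potential \<Lambda> X)"
  unfolding is_potential_def
proof (intro conjI allI impI)
  fix a b
  have "integrable lborel (\<lambda>x. \<Sum>i<\<Lambda>. indicator {a..b} x *\<^sub>R frac ((x - X i) / real \<Lambda>))"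
    using set_integrable_frac unfolding set_integrable_def
    by (intro Bochner_Integration.integrable_sum) auto
  then show "set_integrable lborel {a..b} (sawtooth_potential \<Lambda> X)"
    by (simp add: set_integrable_def sawtooth_potential_def [abs_def] sum_distrib_left)
next
  fix \<phi> assume f: "test_function \<phi>"
  have int: "integrable lborel (\<lambda>x. frac ((x - c) / real \<Lambda>) * deriv \<phi> x)" for c
    using integrable_test_function_times [OF test_function_deriv [OF f] set_integrable_frac]
    by (simp add: mult.commute)
  have "(LINT x|lborel. sawtooth_potential \<Lambda> X x * deriv \<phi> x) =
    (\<Sum>i<\<Lambda>. LINT x|lborel. frac ((x - X i) / real \<Lambda>) * deriv \<phi> x)"
    unfolding sawtooth_potential_def sum_distrib_right
    by (rule Bochner_Integration.integral_sum) (rule int)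
  also have "\<dots> = (\<Sum>i<\<Lambda>. (\<Sum>k::int | \<phi> (X i + real \<Lambda> * of_int k) \<noteq> 0. \<phi> (X i + real \<Lambda> * of_int k)))
      - (LINT x|lborel. \<phi> x)"
    using \<Lambda> by (simp add: integral_frac_deriv [OF f] sum_subtractf)
  finally show "- (LINT x|lborel. sawtooth_potential \<Lambda> X x * deriv \<phi> x) =
      (LINT x|lborel. \<phi> x) - (LINT x|particle_measure \<Lambda> X. \<phi> x)"
    using integral_particle_measure [OF f \<Lambda>] by simp
qed

section \<open>Independence of the choice of potential\<close>

lemma continuous_antiderivative:
  fixes f :: "real \<Rightarrow> real"
  assumes "continuous_on UNIV f"
  obtains F where "\<And>x. (F has_real_derivative f x) (at x)"
proof -
  have "\<exists>F. \<forall>x :: real. -\<infinity> < ereal x \<longrightarrow> ereal x < \<infinity> \<longrightarrow> (F has_vector_derivative f x) (at x)"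
    using assms by (intro einterval_antiderivative) (auto simp: continuous_on_eq_continuous_at)
  then show ?thesis
    using that by (auto simp: has_real_derivative_iff_has_vector_derivative)
qed

text \<open>A single mollified value depends on the free additive constant. A difference of two is
  the pairing of u with g = f (x - y) - f (x' - y), which has integral 0 and is therefore the
  derivative of a test function \<phi>; the defining identity of a potential determines this
  pairing.\<close>

lemma is_potential_unique:
  assumes f: "test_function f" and u: "is_potential \<Lambda> X u" and v: "is_potential \<Lambda> X v"
  shows "(LINT y|lborel. f (x - y) * u y) - (LINT y|lborel. f (x' - y) * u y)
    = (LINT y|lborel. f (x - y) * v y) - (LINT y|lborel. f (x' - y) * v y)"
proof -
  obtain r where r: "\<And>x. \<bar>x\<bar> > r \<Longrightarrow> f x = 0"
    using f unfolding test_function_def by auto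
  obtain F where F: "\<And>x. (F has_real_derivative f x) (at x)"
    using continuous_antiderivative [OF test_function_continuous_on [OF f]] by blast
  have const: "F y = F z" if "convex S" "\<And>x. x \<in> S \<Longrightarrow> \<bar>x\<bar> > r" "y \<in> S" "z \<in> S" for S y z
  proof (rule has_field_derivative_zero_constant [OF that(1), of F, THEN exE])
    show "(F has_real_derivative 0) (at x within S)" if "x \<in> S" for x
      using F [of x] r [of x] \<open>\<And>x. x \<in> S \<Longrightarrow> \<bar>x\<bar> > r\<close> that by (auto intro: has_field_derivative_at_within)
  qed (use that in auto)
  \<comment> \<open>F is constant on either side of the support of f. For large |y| both arguments
    lie on the same side, so the constants cancel and \<phi> has compact support although F need
    not.\<close>
  define \<phi> where "\<phi> y = F (x' - y) - F (x - y)" for y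
  define g where "g y = f (x - y) - f (x' - y)" for y
  have affine: "test_function (\<lambda>y. f (c - y))" for c
    using test_function_affine [OF f, of "-1" 1 c] by simp
  have \<phi>_DERIV: "(\<phi> has_real_derivative g y) (at y)" for y
    unfolding \<phi>_def g_def
    by (rule derivative_eq_intros DERIV_chain' [OF _ F] refl | simp)+
  then have dphi: "deriv \<phi> = g"
    by (auto intro!: ext DERIV_imp_deriv)
  have "\<phi> y = 0" if "\<bar>y\<bar> > \<bar>x\<bar> + \<bar>x'\<bar> + \<bar>r\<bar> + 1" for y
  proof (cases "y > 0")
    case True
    then have "x - y < - \<bar>r\<bar> - 1" "x' - y < - \<bar>r\<bar> - 1" using that by linarith+
    then show ?thesis using const [of "{..< - \<bar>r\<bar>}" "x' - y" "x - y"] by (auto simp: \<phi>_def)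
  next
    case False
    then have "x - y > \<bar>r\<bar> + 1" "x' - y > \<bar>r\<bar> + 1" using that by linarith+
    then show ?thesis using const [of "{\<bar>r\<bar><..}" "x' - y" "x - y"] by (auto simp: \<phi>_def)
  qed
  moreover have "test_function g"
    unfolding g_def by (intro test_function_diff affine)
  ultimately have "test_function \<phi>"
    unfolding test_function_def using smooth_Suc [of \<phi>] \<phi>_DERIV dphi real_differentiable_def by blast
  then have "(LINT y|lborel. u y * g y) = (LINT y|lborel. v y * g y)"
    using u [unfolded is_potential_def, THEN conjunct2, rule_format, of \<phi>]
      v [unfolded is_potential_def, THEN conjunct2, rule_format, of \<phi>] by (simp add: dphi)
  moreover have "(LINT y|lborel. f (x - y) * w y) - (LINT y|lborel. f (x' - y) * w y) = (LINT y|lborel. w y * g y)"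
    if "is_potential \<Lambda> X w" for w
  proof -
    have int: "integrable lborel (\<lambda>y. f (c - y) * w y)" for c
      by (rule integrable_test_function_times [OF affine]) (use that in \<open>simp add: is_potential_def\<close>)
    have "(LINT y|lborel. f (x - y) * w y) - (LINT y|lborel. f (x' - y) * w y)
        = (LINT y|lborel. f (x - y) * w y - f (x' - y) * w y)"
      by (rule Bochner_Integration.integral_diff [OF int int, symmetric])
    also have "\<dots> = (LINT y|lborel. w y * g y)"
      by (simp add: g_def algebra_simps)
    finally show ?thesis .
  qed
  ultimately show ?thesis
    using u v by simp
qed

definition mollified_sawtooth :: "(real \<Rightarrow> real) \<Rightarrow> real \<Rightarrow> real \<Rightarrow> real" where
  "mollified_sawtooth f L x = (LINT y|lborel. f (x - y) * frac (y / L))"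

lemma mollified_potential_diff:
  assumes \<rho>: "standard_mollifier \<rho>" and \<epsilon>: "0 < \<epsilon>" and \<Lambda>: "\<Lambda> \<ge> 1"
  defines "W \<equiv> mollified_sawtooth (rescaled \<rho> \<epsilon>) (real \<Lambda>)"
  shows "mollified_potential \<rho> \<epsilon> \<Lambda> X x - mollified_potential \<rho> \<epsilon> \<Lambda> X y =
    (\<Sum>i<\<Lambda>. W (x - X i)) - (\<Sum>i<\<Lambda>. W (y - X i))"
proof -
  let ?f = "rescaled \<rho> \<epsilon>"
  note f = test_function_rescaled [OF \<rho> \<epsilon>]
  have "is_potential \<Lambda> X (potential \<Lambda> X)"
    unfolding potential_def by (rule someI [of "is_potential \<Lambda> X", OF is_potential_sawtooth [OF \<Lambda>]])
  moreover have "(LINT y|lborel. ?f (x - y) * sawtooth_potential \<Lambda> X y) = (\<Sum>i<\<Lambda>. W (x - X i))" for x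
  proof -
    have affine: "test_function (\<lambda>y. ?f (x - y))"
      using test_function_affine [OF f, of "-1" 1 x] by simp
    have "(LINT y|lborel. ?f (x - y) * sawtooth_potential \<Lambda> X y) =
       (\<Sum>i<\<Lambda>. LINT y|lborel. ?f (x - y) * frac ((y - X i) / real \<Lambda>))"
      unfolding sawtooth_potential_def sum_distrib_left
      by (intro Bochner_Integration.integral_sum integrable_test_function_times affine set_integrable_frac)
    moreover have "(LINT y|lborel. ?f (x - y) * frac ((y - X i) / real \<Lambda>)) = W (x - X i)" for i
      unfolding W_def mollified_sawtooth_def
      by (subst lborel_integral_real_affine [of 1 _ "X i"]) (simp_all add: algebra_simps)
    ultimately show ?thesis by simp
  qed
  ultimately show ?thesis
    unfolding mollified_potential_def
    using is_potential_unique [OF f _ is_potential_sawtooth [OF \<Lambda>], of X "potential \<Lambda> X" x y] by simp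
qed

section \<open>Periodic functions\<close>

lemma set_integrable_continuous:
  fixes f :: "real \<Rightarrow> real"
  shows "continuous_on UNIV f \<Longrightarrow> set_integrable lborel {a..b} f"
  by (meson borel_integrable_atLeastAtMost' continuous_on_subset subset_UNIV)

lemma bounded_smooth_continuous_on_shift: "bounded_smooth f \<Longrightarrow> continuous_on S (\<lambda>x. f (x + z))"
  by (rule continuous_on_compose2 [OF bounded_smooth_continuous_on [of f UNIV]])
    (auto intro: continuous_intros)

lemma set_integral_FTC:
  fixes f F :: "real \<Rightarrow> real"
  assumes "\<And>x. (F has_real_derivative f x) (at x)" "continuous_on UNIV f" "a \<le> b"
  shows "(LINT x:{a..b}|lborel. f x) = F b - F a"
  using integral_FTC_Icc_real [of a b F f] assms
  by (simp add: set_lebesgue_integral_def mult.commute continuous_on_eq_continuous_at)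

text \<open>The window of length L starting at a contributes \<open>F (a + L) - F a\<close>, whose
  derivative in a vanishes by periodicity.\<close>

lemma periodic_integral_shift:
  fixes f :: "real \<Rightarrow> real"
  assumes f: "continuous_on UNIV f" and per: "\<And>x. f (x + L) = f x" and L: "L \<ge> 0"
  shows "(LINT x:{0..L}|lborel. f (x + a)) = (LINT x:{0..L}|lborel. f x)"
proof -
  obtain F where F: "\<And>x. (F has_real_derivative f x) (at x)"
    using continuous_antiderivative [OF f] by blast
  have shift: "((\<lambda>x. F (x + c)) has_real_derivative f (x + c)) (at x)" for c x
    using F by (simp add: DERIV_shift [symmetric])
  have "((\<lambda>a. F (a + L) - F a) has_real_derivative 0) (at a)" for a
    using DERIV_diff [OF shift [of L a] F [of a]] per by simp
  then have "F (a + L) - F a = F (0 + L) - F 0"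
    by (intro DERIV_isconst_all) auto
  moreover have "(LINT x:{0..L}|lborel. f (x + a)) = F (L + a) - F (0 + a)"
    using L by (intro set_integral_FTC shift continuous_on_compose2 [OF f] continuous_intros) auto
  moreover have "(LINT x:{0..L}|lborel. f x) = F L - F 0"
    using L by (intro set_integral_FTC F f)
  ultimately show ?thesis by (simp add: add.commute)
qed

lemma periodic_deriv:
  fixes f :: "real \<Rightarrow> real"
  assumes "\<And>x. (f has_real_derivative f' x) (at x)" "\<And>x. f (x + L) = f x"
  shows "f' (x + L) = f' x"
proof -
  have "((\<lambda>x. f (x + L)) has_real_derivative f' (x + L)) (at x)"
    using assms(1) by (simp add: DERIV_shift [symmetric])
  then show ?thesis
    using assms(1) [of x] unfolding assms(2) by (rule DERIV_unique)
qed

section \<open>The mollified sawtooth\<close>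

lemma mollified_sawtooth_DERIV:
  assumes f: "test_function f"
  shows "(mollified_sawtooth f L has_real_derivative mollified_sawtooth (deriv f) L x) (at x)"
proof -
  obtain r where r: "\<And>x. \<bar>x\<bar> > r \<Longrightarrow> f x = 0"
    using f unfolding test_function_def by auto
  have r': "deriv f x = 0" if "\<bar>x\<bar> > r" for x
    using deriv_vanishes_outside [of r f x] r that by simp
  note f' = test_function_deriv [OF f] and f'' = test_function_deriv [OF test_function_deriv [OF f]]
  obtain B where B: "\<And>x. \<bar>deriv (deriv f) x\<bar> \<le> B"
    using test_function_bounded [OF f''] by blast
  have int: "integrable lborel (\<lambda>y. g (z - y) * frac (y / L))" if "test_function g" for g z
    using integrable_test_function_times [OF _ set_integrable_frac [of _ _ 0], of "\<lambda>y. g (z - y)" L]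
      test_function_affine [OF that, of "-1" 1 z] by simp
  show ?thesis
    unfolding mollified_sawtooth_def [abs_def]
  proof (rule DERIV_integral_quadratic)
    \<comment> \<open>The interval is widened by 1 on both sides, so that for |h| at most 1 it
      contains the support of every term of the remainder.\<close>
    show "integrable lborel (\<lambda>y. B * indicator {x - \<bar>r\<bar> - 1..x + \<bar>r\<bar> + 1} y)"
      by (intro integrable_mult_right integrable_real_indicator) (auto simp: emeasure_lborel_Icc_eq)
    fix h y :: real assume h: "\<bar>h\<bar> \<le> 1"
    have fr: "0 \<le> frac (y / L)" "frac (y / L) \<le> 1"
      using frac_lt_1 [of "y / L"] by auto
    have "f (x + h - y) * frac (y / L) - f (x - y) * frac (y / L) - h * (deriv f (x - y) * frac (y / L))
       = (f (x - y + h) - f (x - y) - h * deriv f (x - y)) * frac (y / L)"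
      by (simp add: algebra_simps)
    moreover have "\<bar>(f (x - y + h) - f (x - y) - h * deriv f (x - y)) * frac (y / L)\<bar>
        \<le> \<bar>f (x - y + h) - f (x - y) - h * deriv f (x - y)\<bar>"
      unfolding abs_mult using fr by (simp add: mult_left_le)
    moreover have "\<bar>f (x - y + h) - f (x - y) - h * deriv f (x - y)\<bar>
        \<le> B * indicator {x - \<bar>r\<bar> - 1..x + \<bar>r\<bar> + 1} y * h\<^sup>2"
    proof (cases "y \<in> {x - \<bar>r\<bar> - 1..x + \<bar>r\<bar> + 1}")
      case True
      then show ?thesis
        using taylor_quadratic_bound [OF test_function_DERIV [OF f] test_function_DERIV [OF f'] B, of "x - y" h]
        by simp
    next
      case False
      then have "\<bar>x - y\<bar> > r" "\<bar>x - y + h\<bar> > r" using h by auto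
      then show ?thesis using r r' False by simp
    qed
    ultimately show "\<bar>f (x + h - y) * frac (y / L) - f (x - y) * frac (y / L) - h * (deriv f (x - y) * frac (y / L))\<bar>
        \<le> B * indicator {x - \<bar>r\<bar> - 1..x + \<bar>r\<bar> + 1} y * h\<^sup>2"
      by linarith
  qed (intro int f f')+
qed

lemma mollified_sawtooth_bounded:
  assumes f: "test_function f"
  shows "\<exists>B. \<forall>x. \<bar>mollified_sawtooth f L x\<bar> \<le> B"
proof (intro exI allI)
  fix x
  have affine: "test_function (\<lambda>y. f (x - y))"
    using test_function_affine [OF f, of "-1" 1 x] by simp
  have int: "integrable lborel (\<lambda>y. f (x - y))"
    using integrable_test_function_times [OF affine, of "\<lambda>_. 1"] set_integrable_continuous [of "\<lambda>_. 1"] by simp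
  have "\<bar>mollified_sawtooth f L x\<bar> \<le> (LINT y|lborel. \<bar>f (x - y) * frac (y / L)\<bar>)"
    unfolding mollified_sawtooth_def by (rule integral_abs_bound)
  also have "\<dots> \<le> (LINT y|lborel. \<bar>f (x - y)\<bar>)"
  proof (rule integral_mono)
    show "integrable lborel (\<lambda>y. \<bar>f (x - y) * frac (y / L)\<bar>)"
      using integrable_test_function_times [OF affine set_integrable_frac [of _ _ 0], of L] by simp
    show "integrable lborel (\<lambda>y. \<bar>f (x - y)\<bar>)"
      using int by simp
    show "\<bar>f (x - y) * frac (y / L)\<bar> \<le> \<bar>f (x - y)\<bar>" for y
      using frac_lt_1 [of "y / L"] unfolding abs_mult by (simp add: mult_left_le)
  qed
  also have "\<dots> = (LINT y|lborel. \<bar>f y\<bar>)"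
    by (subst (2) lborel_integral_real_affine [of "-1" _ x]) simp_all
  finally show "\<bar>mollified_sawtooth f L x\<bar> \<le> (LINT y|lborel. \<bar>f y\<bar>)" .
qed

lemma mollified_sawtooth_bounded_smooth:
  assumes f: "test_function f"
  shows "bounded_smooth (mollified_sawtooth f L)"
proof -
  have test: "test_function ((deriv ^^ n) f)" for n
    by (induction n) (auto intro: test_function_deriv f)
  show ?thesis
    using bounded_smoothI [of "\<lambda>n. mollified_sawtooth ((deriv ^^ n) f) L"]
      mollified_sawtooth_DERIV [OF test] mollified_sawtooth_bounded [OF test] by simp
qed

lemma mollified_sawtooth_periodic:
  assumes "L > 0"
  shows "mollified_sawtooth f L (x + L) = mollified_sawtooth f L x"
proof -
  have "frac ((L + y) / L) = frac (y / L)" for y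
    using assms by (simp add: add_divide_distrib frac_def)
  then show ?thesis
    unfolding mollified_sawtooth_def
    by (subst lborel_integral_real_affine [of 1 _ L]) (simp_all add: algebra_simps)
qed

text \<open>As a function of y the kernel f (x - y) is a test function, so convolving with f'
  amounts to pairing the sawtooth with its derivative. For a mollifier the outcome is the uniform
  density 1 / L minus a periodised bump.\<close>

lemma mollified_sawtooth_deriv:
  assumes f: "test_function f" and L: "L > 0"
  shows "deriv (mollified_sawtooth f L) x =
    (LINT x|lborel. f x) / L - (\<Sum>k | f (x - L * of_int k) \<noteq> 0. f (x - L * of_int k))"
proof -
  have affine: "test_function (\<lambda>y. f (x - y))"
    using test_function_affine [OF f, of "-1" 1 x] by simp
  have "((\<lambda>y. f (x - y)) has_real_derivative - deriv f (x - y)) (at y)" for y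
  proof -
    have "((\<lambda>y. x - y) has_real_derivative - 1) (at y)"
      by (auto intro!: derivative_eq_intros)
    from DERIV_chain' [OF this test_function_DERIV [OF f]] show ?thesis by simp
  qed
  then have "deriv (\<lambda>y. f (x - y)) y = - deriv f (x - y)" for y
    by (rule DERIV_imp_deriv)
  then have "mollified_sawtooth (deriv f) L x = - (LINT y|lborel. frac ((y - 0) / L) * deriv (\<lambda>y. f (x - y)) y)"
    by (simp add: mollified_sawtooth_def mult.commute)
  also have "\<dots> = (LINT y|lborel. f (x - y)) / L - (\<Sum>k | f (x - L * of_int k) \<noteq> 0. f (x - L * of_int k))"
    by (subst integral_frac_deriv [OF affine L]) simp
  also have "(LINT y|lborel. f (x - y)) = (LINT y|lborel. f y)"
    by (subst (2) lborel_integral_real_affine [of "-1" _ x]) simp_all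
  finally show ?thesis
    using DERIV_imp_deriv [OF mollified_sawtooth_DERIV [OF f]] by simp
qed

section \<open>Correlations\<close>

text \<open>The argument z shifts the second factor only, so every derivative in z falls on g and f
  need only be continuous.\<close>

definition correlation :: "real \<Rightarrow> (real \<Rightarrow> real) \<Rightarrow> (real \<Rightarrow> real) \<Rightarrow> real \<Rightarrow> real" where
  "correlation L f g z = (LINT x:{0..L}|lborel. f x * g (x + z))"

lemma correlation_DERIV:
  assumes f: "continuous_on UNIV f" and g: "bounded_smooth g"
  shows "(correlation L f g has_real_derivative correlation L f (deriv g) z) (at z)"
proof -
  obtain B where B: "\<And>x. \<bar>deriv (deriv g) x\<bar> \<le> B"
    using bounded_smooth_bounded [OF bounded_smooth_deriv [OF bounded_smooth_deriv [OF g]]] by blast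
  have int: "integrable lborel (\<lambda>x. indicator {0..L} x *\<^sub>R (f x * h (x + z)))" if "bounded_smooth h" for h z
    using set_integrable_continuous [OF continuous_on_mult [OF f bounded_smooth_continuous_on_shift [OF that]]]
    by (simp add: set_integrable_def)
  have intf: "integrable lborel (\<lambda>x. B * \<bar>indicator {0..L} x *\<^sub>R f x\<bar>)"
    using set_integrable_continuous [OF f] by (simp add: set_integrable_def)
  show ?thesis
    unfolding correlation_def [abs_def] set_lebesgue_integral_def
  proof (rule DERIV_integral_quadratic)
    fix h x :: real
    have "indicator {0..L} x *\<^sub>R (f x * g (x + (z + h))) - indicator {0..L} x *\<^sub>R (f x * g (x + z))
        - h * (indicator {0..L} x *\<^sub>R (f x * deriv g (x + z)))
       = (indicator {0..L} x *\<^sub>R f x) * (g (x + z + h) - g (x + z) - h * deriv g (x + z))"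
      by (simp add: algebra_simps)
    then have "\<bar>indicator {0..L} x *\<^sub>R (f x * g (x + (z + h))) - indicator {0..L} x *\<^sub>R (f x * g (x + z))
        - h * (indicator {0..L} x *\<^sub>R (f x * deriv g (x + z)))\<bar>
      = \<bar>indicator {0..L} x *\<^sub>R f x\<bar> * \<bar>g (x + z + h) - g (x + z) - h * deriv g (x + z)\<bar>"
      by (simp only: abs_mult)
    also have "\<dots> \<le> \<bar>indicator {0..L} x *\<^sub>R f x\<bar> * (B * h\<^sup>2)"
      by (intro mult_left_mono taylor_quadratic_bound [OF bounded_smooth_DERIV bounded_smooth_DERIV B]
          g bounded_smooth_deriv) simp
    finally show "\<bar>indicator {0..L} x *\<^sub>R (f x * g (x + (z + h))) - indicator {0..L} x *\<^sub>R (f x * g (x + z))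
        - h * (indicator {0..L} x *\<^sub>R (f x * deriv g (x + z)))\<bar> \<le> B * \<bar>indicator {0..L} x *\<^sub>R f x\<bar> * h\<^sup>2"
      by (simp add: mult_ac)
  qed (intro int intf g bounded_smooth_deriv)+
qed

lemma correlation_bounded_smooth:
  assumes f: "continuous_on UNIV f" and g: "bounded_smooth g"
  shows "bounded_smooth (correlation L f g)"
proof -
  have "\<exists>B. \<forall>z. \<bar>correlation L f h z\<bar> \<le> B" if h: "bounded_smooth h" for h
  proof -
    obtain B where B: "\<And>x. \<bar>h x\<bar> \<le> B"
      using bounded_smooth_bounded [OF h] by blast
    have "\<bar>correlation L f h z\<bar> \<le> (LINT x|lborel. B * \<bar>indicator {0..L} x *\<^sub>R f x\<bar>)" for z
    proof -
      have "\<bar>correlation L f h z\<bar> \<le> (LINT x|lborel. \<bar>indicator {0..L} x *\<^sub>R (f x * h (x + z))\<bar>)"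
        unfolding correlation_def set_lebesgue_integral_def by (rule integral_abs_bound)
      also have "\<dots> \<le> (LINT x|lborel. B * \<bar>indicator {0..L} x *\<^sub>R f x\<bar>)"
      proof (rule integral_mono)
        show "integrable lborel (\<lambda>x. \<bar>indicator {0..L} x *\<^sub>R (f x * h (x + z))\<bar>)"
          using set_integrable_continuous [OF continuous_on_mult [OF f bounded_smooth_continuous_on_shift [OF h]]]
          by (intro integrable_abs) (simp add: set_integrable_def)
        show "integrable lborel (\<lambda>x. B * \<bar>indicator {0..L} x *\<^sub>R f x\<bar>)"
          using set_integrable_continuous [OF f] by (simp add: set_integrable_def)
        show "\<bar>indicator {0..L} x *\<^sub>R (f x * h (x + z))\<bar> \<le> B * \<bar>indicator {0..L} x *\<^sub>R f x\<bar>" for x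
          using mult_left_mono [OF B [of "x + z"], of "\<bar>indicator {0..L} x *\<^sub>R f x\<bar>"]
          by (simp add: abs_mult mult_ac)
      qed
      finally show ?thesis .
    qed
    then show ?thesis by blast
  qed
  then show ?thesis
    using bounded_smoothI [of "\<lambda>n. correlation L f ((deriv ^^ n) g)"]
      correlation_DERIV [OF f bounded_smooth_funpow [OF g]] bounded_smooth_funpow [OF g] by simp
qed

section \<open>The fractional Laplacian\<close>

text \<open>On (0, 1] the integrand is \<open>h powr (1 - 2 * s)\<close>, integrable because s < 1;
  beyond 1 it is \<open>h powr (- 1 - 2 * s)\<close>, integrable because s > 0. Reflection gives the
  negative half.\<close>

lemma integrable_kernel:
  assumes s: "0 < s" "s < 1"
  shows "integrable lborel (\<lambda>h::real. min 1 (h\<^sup>2) / \<bar>h\<bar> powr (1 + 2 * s))"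
proof -
  let ?k = "\<lambda>h::real. min 1 (h\<^sup>2) / \<bar>h\<bar> powr (1 + 2 * s)"
  have [measurable]: "?k \<in> borel_measurable borel" by measurable
  have "set_integrable lborel {0..1} (\<lambda>h. h powr (1 - 2 * s))"
  proof -
    have "(\<lambda>h. h powr (1 - 2 * s)) absolutely_integrable_on {0..1}"
      using s by (intro nonnegative_absolutely_integrable_1 integrable_on_powr_from_0) auto
    then show ?thesis
      unfolding set_integrable_def by (subst (asm) integrable_completion) auto
  qed
  moreover have "set_integrable lborel {1..} (\<lambda>h. h powr (- 1 - 2 * s))"
  proof -
    have "(\<lambda>h. h powr (- 1 - 2 * s)) absolutely_integrable_on {1..}"
      using s has_integral_powr_to_inf [of "- 1 - 2 * s" 1]
      by (intro nonnegative_absolutely_integrable_1) (auto intro: has_integral_integrable)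
    then show ?thesis
      unfolding set_integrable_def by (subst (asm) integrable_completion) auto
  qed
  ultimately have "integrable lborel (\<lambda>h. indicator {0..1} h *\<^sub>R h powr (1 - 2 * s)
      + indicator {1..} h *\<^sub>R h powr (- 1 - 2 * s))"
    unfolding set_integrable_def by (rule Bochner_Integration.integrable_add)
  then have half: "integrable lborel (\<lambda>h. indicator {0..} h * ?k h)"
  proof (rule Bochner_Integration.integrable_bound)
    show "AE h in lborel. norm (indicator {0..} h * ?k h) \<le> norm (indicator {0..1} h *\<^sub>R h powr (1 - 2 * s)
      + indicator {1..} h *\<^sub>R h powr (- 1 - 2 * s))"
    proof (rule AE_I2)
      fix h :: real
      consider "h \<le> 0" | "0 < h" "h \<le> 1" | "1 < h" by linarith
      then show "norm (indicator {0..} h * ?k h) \<le> norm (indicator {0..1} h *\<^sub>R h powr (1 - 2 * s)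
        + indicator {1..} h *\<^sub>R h powr (- 1 - 2 * s))"
      proof cases
        case 1 then show ?thesis by (auto simp: indicator_def)
      next
        case 2
        then have "?k h = h\<^sup>2 / h powr (1 + 2 * s)"
          by (simp add: min_absorb2 power_le_one)
        also have "\<dots> = h powr (2 - (1 + 2 * s))"
          using 2 by (simp only: powr_diff) (simp add: powr_numeral)
        finally have "?k h = h powr (2 - (1 + 2 * s))" .
        with 2 show ?thesis by (auto simp: indicator_def)
      next
        case 3
        then have "1 \<le> h\<^sup>2" by (simp add: one_le_power)
        with 3 have "?k h = h powr (- 1 - 2 * s)"
          by (simp add: min_def powr_diff powr_add powr_minus divide_simps)
        with 3 show ?thesis by (auto simp: indicator_def)
      qed
    qed
  qed measurable
  from lborel_integrable_real_affine [OF this, of "-1" 0]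
  have half': "integrable lborel (\<lambda>h. indicator {0..} (- h) * ?k h)" by simp
  have "integrable lborel (\<lambda>h. indicator {0..} h * ?k h + indicator {0..} (- h) * ?k h)"
    by (rule Bochner_Integration.integrable_add [OF half half'])
  also have "(\<lambda>h. indicator {0..} h * ?k h + indicator {0..} (- h) * ?k h) = ?k"
    by (auto simp: fun_eq_iff indicator_def)
  finally show ?thesis .
qed

text \<open>Up to a positive constant, the operator \<open>(-\<Delta>)^s\<close> in
  second-difference form. It converges absolutely also for s at least 1 / 2, where first differences
  would require a principal value.\<close>

definition frac_laplacian :: "real \<Rightarrow> (real \<Rightarrow> real) \<Rightarrow> real \<Rightarrow> real" where
  "frac_laplacian s f z = (LINT h|lborel. second_diff f z h / \<bar>h\<bar> powr (1 + 2 * s))"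

lemma second_diff_DERIV:
  assumes "bounded_smooth f"
  shows "((\<lambda>z. second_diff f z h) has_real_derivative second_diff (deriv f) z h) (at z)"
  unfolding second_diff_def
  by (rule derivative_eq_intros DERIV_chain' [OF _ bounded_smooth_DERIV [OF assms]] refl | simp)+

lemma bounded_smooth_second_diff_bound:
  assumes "bounded_smooth f"
  shows "\<exists>B. \<forall>z h. \<bar>second_diff f z h\<bar> \<le> B * min 1 (h\<^sup>2)"
proof -
  obtain B where B: "\<And>x. \<bar>f x\<bar> \<le> B"
    using bounded_smooth_bounded [OF assms] by blast
  obtain B' where B': "\<And>x. \<bar>deriv (deriv f) x\<bar> \<le> B'"
    using bounded_smooth_bounded [OF bounded_smooth_deriv [OF bounded_smooth_deriv [OF assms]]] by blast
  have "\<bar>second_diff f z h\<bar> \<le> 4 * max B B' * min 1 (h\<^sup>2)" for z h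
    using B B' assms by (intro second_diff_bound [of f "deriv f" "deriv (deriv f)"] bounded_smooth_DERIV
      bounded_smooth_deriv max.coboundedI1 max.coboundedI2) (auto intro: max.coboundedI1 max.coboundedI2)
  then show ?thesis by blast
qed

lemma frac_laplacian_integrable:
  assumes f: "bounded_smooth f" and s: "0 < s" "s < 1"
  shows "integrable lborel (\<lambda>h. second_diff f z h / \<bar>h\<bar> powr (1 + 2 * s))"
proof -
  obtain B where B: "\<And>z h. \<bar>second_diff f z h\<bar> \<le> B * min 1 (h\<^sup>2)"
    using bounded_smooth_second_diff_bound [OF f] by blast
  have [measurable]: "f \<in> borel_measurable borel"
    by (intro borel_measurable_continuous_onI bounded_smooth_continuous_on f)
  show ?thesis
  proof (rule Bochner_Integration.integrable_bound)
    show "integrable lborel (\<lambda>h. B * (min 1 (h\<^sup>2) / \<bar>h\<bar> powr (1 + 2 * s)))"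
      by (intro integrable_mult_right integrable_kernel s)
    show "(\<lambda>h. second_diff f z h / \<bar>h\<bar> powr (1 + 2 * s)) \<in> borel_measurable lborel"
      unfolding second_diff_def by measurable
    show "AE h in lborel. norm (second_diff f z h / \<bar>h\<bar> powr (1 + 2 * s))
        \<le> norm (B * (min 1 (h\<^sup>2) / \<bar>h\<bar> powr (1 + 2 * s)))"
    proof (rule AE_I2)
      fix h :: real
      have "\<bar>second_diff f z h\<bar> \<le> \<bar>B * min 1 (h\<^sup>2)\<bar>"
        using B [of z h] by linarith
      then show "norm (second_diff f z h / \<bar>h\<bar> powr (1 + 2 * s))
        \<le> norm (B * (min 1 (h\<^sup>2) / \<bar>h\<bar> powr (1 + 2 * s)))"
        by (simp add: divide_right_mono abs_mult)
    qed
  qed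
qed

text \<open>The Taylor remainder in z of a second difference is controlled by the second difference
  of f'', which again carries the factor \<open>min 1 (h\<^sup>2)\<close>. The dominating function
  is thus a multiple of the integrable kernel.\<close>

lemma frac_laplacian_DERIV:
  assumes f: "bounded_smooth f" and s: "0 < s" "s < 1"
  shows "(frac_laplacian s f has_real_derivative frac_laplacian s (deriv f) z) (at z)"
proof -
  note f' = bounded_smooth_deriv [OF f] and f'' = bounded_smooth_deriv [OF bounded_smooth_deriv [OF f]]
  obtain B where B: "\<And>z h. \<bar>second_diff (deriv (deriv f)) z h\<bar> \<le> B * min 1 (h\<^sup>2)"
    using bounded_smooth_second_diff_bound [OF f''] by blast
  show ?thesis
    unfolding frac_laplacian_def [abs_def]
  proof (rule DERIV_integral_quadratic)
    show "integrable lborel (\<lambda>h. B * (min 1 (h\<^sup>2) / \<bar>h\<bar> powr (1 + 2 * s)))"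
      by (intro integrable_mult_right integrable_kernel s)
    fix t h :: real
    have "\<bar>second_diff f (z + t) h - second_diff f z h - t * second_diff (deriv f) z h\<bar>
       \<le> B * min 1 (h\<^sup>2) * t\<^sup>2"
      using taylor_quadratic_bound [OF second_diff_DERIV [OF f] second_diff_DERIV [OF f'] B] .
    then have "\<bar>(second_diff f (z + t) h - second_diff f z h - t * second_diff (deriv f) z h) / p\<bar>
       \<le> B * min 1 (h\<^sup>2) * t\<^sup>2 / p" if "p \<ge> 0" for p
      using that by (simp add: divide_right_mono)
    from this [of "\<bar>h\<bar> powr (1 + 2 * s)"]
    show "\<bar>second_diff f (z + t) h / \<bar>h\<bar> powr (1 + 2 * s) - second_diff f z h / \<bar>h\<bar> powr (1 + 2 * s)
        - t * (second_diff (deriv f) z h / \<bar>h\<bar> powr (1 + 2 * s))\<bar>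
      \<le> B * (min 1 (h\<^sup>2) / \<bar>h\<bar> powr (1 + 2 * s)) * t\<^sup>2"
      by (simp add: diff_divide_distrib)
  qed (intro frac_laplacian_integrable f f' s)+
qed

section \<open>The energy as a sum of pair interactions\<close>

lemma bounded_smooth_diff_bound:
  assumes f: "bounded_smooth f"
  shows "\<exists>B. \<forall>x h. \<bar>f x - f (x + h)\<bar> \<le> B * min 1 \<bar>h\<bar>"
proof -
  obtain B where B: "\<And>x. \<bar>f x\<bar> \<le> B"
    using bounded_smooth_bounded [OF f] by blast
  obtain B' where B': "\<And>x. \<bar>deriv f x\<bar> \<le> B'"
    using bounded_smooth_bounded [OF bounded_smooth_deriv [OF f]] by blast
  have "\<bar>f x - f (x + h)\<bar> \<le> max (2 * B) B' * min 1 \<bar>h\<bar>" for x h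
  proof (cases "\<bar>h\<bar> \<le> 1")
    case True
    have "\<bar>f x - f (x + h)\<bar> \<le> B' * \<bar>h\<bar>"
      using field_differentiable_bound [of UNIV f "deriv f" B' x "x + h"] B' bounded_smooth_DERIV [OF f] by simp
    also have "\<dots> \<le> max (2 * B) B' * \<bar>h\<bar>"
      by (intro mult_right_mono) auto
    finally show ?thesis using True by simp
  next
    case False
    then show ?thesis using B [of x] B [of "x + h"] by simp
  qed
  then show ?thesis by blast
qed

lemma correlation_shift:
  assumes W: "bounded_smooth W" and per: "\<And>x. W (x + L) = W x" and L: "L > 0"
  shows "(LINT x:{0..L}|lborel. W (x - a) * W (x - b)) = correlation L W W (a - b)"
proof -
  have "continuous_on UNIV (\<lambda>x. W x * W (x + (a - b)))"
    by (intro continuous_on_mult bounded_smooth_continuous_on_shift bounded_smooth_continuous_on W)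
  moreover have "W (x + L) * W (x + L + (a - b)) = W x * W (x + (a - b))" for x
    using per [of x] per [of "x + (a - b)"] by (simp add: algebra_simps)
  ultimately have "(LINT x:{0..L}|lborel. W (x + - a) * W (x + - a + (a - b)))
      = (LINT x:{0..L}|lborel. W x * W (x + (a - b)))"
    using L by (intro periodic_integral_shift) auto
  then show ?thesis by (simp add: correlation_def)
qed

text \<open>Substituting y = x + h and integrating over x before h removes the singular kernel from
  the inner integral. For fixed h, the square expands into products of translates of W, and each
  pair of particles yields a second difference of the correlation.\<close>

lemma pair_integral:
  fixes X :: "nat \<Rightarrow> real" and n :: nat
  assumes W: "bounded_smooth W" and per: "\<And>x. W (x + L) = W x" and L: "L > 0"
    and s: "0 < s" "s < 1"
  defines "V \<equiv> \<lambda>x. \<Sum>i<n. W (x - X i)"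
  shows "(LINT x:{0..L}|lborel. LINT y|lborel. \<bar>V x - V y\<bar>\<^sup>2 / \<bar>x - y\<bar> powr (1 + 2 * s)) =
    (\<Sum>i<n. \<Sum>j<n. frac_laplacian s (correlation L W W) (X i - X j))"
proof -
  let ?c = "correlation L W W"
  have c: "bounded_smooth ?c"
    by (intro correlation_bounded_smooth bounded_smooth_continuous_on W)
  have contW: "continuous_on UNIV (\<lambda>x. W (x + a))" for a
    by (rule bounded_smooth_continuous_on_shift [OF W])
  have contV: "continuous_on UNIV V"
    using contW [of "- X _"] unfolding V_def by (intro continuous_on_sum) simp
  have [measurable]: "V \<in> borel_measurable borel"
    by (rule borel_measurable_continuous_onI [OF contV])
  obtain B where B: "\<And>x h. \<bar>W x - W (x + h)\<bar> \<le> B * min 1 \<bar>h\<bar>"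
    using bounded_smooth_diff_bound [OF W] by blast
  \<comment> \<open>V is Lipschitz and has bounded differences; squaring gives the factor that makes
    the double integral absolutely convergent, as Fubini requires.\<close>
  have V_bound: "\<bar>V x - V (x + h)\<bar>\<^sup>2 \<le> (real n * B)\<^sup>2 * min 1 (h\<^sup>2)" for x h
  proof -
    have "\<bar>V x - V (x + h)\<bar> = \<bar>\<Sum>i<n. W (x - X i) - W (x - X i + h)\<bar>"
      by (simp add: V_def sum_subtractf algebra_simps)
    also have "\<dots> \<le> (\<Sum>i<n. B * min 1 \<bar>h\<bar>)"
      by (rule order_trans [OF sum_abs sum_mono]) (rule B)
    finally have "\<bar>V x - V (x + h)\<bar>\<^sup>2 \<le> (real n * B * min 1 \<bar>h\<bar>)\<^sup>2"
      by (intro power_mono) auto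
    also have "(min 1 \<bar>h\<bar>)\<^sup>2 = min 1 (h\<^sup>2)"
      by (cases "\<bar>h\<bar> \<le> 1") (auto simp: abs_square_le_1 min_def one_le_power power_mono_iff abs_le_square_iff [of 1, simplified])
    then have "(real n * B * min 1 \<bar>h\<bar>)\<^sup>2 = (real n * B)\<^sup>2 * min 1 (h\<^sup>2)"
      by (simp add: power_mult_distrib)
    finally show ?thesis .
  qed
  define k where "k h = min 1 (h\<^sup>2) / \<bar>h\<bar> powr (1 + 2 * s)" for h :: real
  have k: "integrable lborel k" "\<And>h. k h \<ge> 0"
    using integrable_kernel [OF s] by (auto simp: k_def [abs_def])
  have [measurable]: "k \<in> borel_measurable borel"
    using borel_measurable_integrable [OF k(1)] by simp
  define F where "F x h = indicator {0..L} x * (\<bar>V x - V (x + h)\<bar>\<^sup>2 / \<bar>h\<bar> powr (1 + 2 * s))" for x h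
  have "integrable (lborel \<Otimes>\<^sub>M lborel) (\<lambda>(x, h). indicator {0..L} x * k h)"
  proof (rule lborel_pair.Fubini_integrable)
    have "integrable lborel (\<lambda>x. indicator {0..L} x * (LINT h|lborel. k h))"
      by (intro integrable_mult_left integrable_real_indicator) (auto simp: emeasure_lborel_Icc_eq)
    then show "integrable lborel (\<lambda>x. LINT h|lborel. norm (case (x, h) of (x, h) \<Rightarrow> indicator {0..L} x * k h))"
      using k(2) by (simp add: abs_mult)
    show "AE x in lborel. integrable lborel (\<lambda>h. case (x, h) of (x, h) \<Rightarrow> indicator {0..L} x * k h)"
      using k(1) by simp
  qed measurable
  then have "integrable (lborel \<Otimes>\<^sub>M lborel) (\<lambda>p. (real n * B)\<^sup>2 * (case p of (x, h) \<Rightarrow> indicator {0..L} x * k h))"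
    by (rule integrable_mult_right)
  then have F_int: "integrable (lborel \<Otimes>\<^sub>M lborel) (case_prod F)"
  proof (rule Bochner_Integration.integrable_bound)
    show "case_prod F \<in> borel_measurable (lborel \<Otimes>\<^sub>M lborel)"
      unfolding F_def by measurable
    have "\<bar>F x h\<bar> \<le> \<bar>(real n * B)\<^sup>2 * (indicator {0..L} x * k h)\<bar>" for x h
    proof -
      have "\<bar>F x h\<bar> = indicator {0..L} x * (\<bar>V x - V (x + h)\<bar>\<^sup>2 / \<bar>h\<bar> powr (1 + 2 * s))"
        by (simp add: F_def)
      also have "\<dots> \<le> indicator {0..L} x * ((real n * B)\<^sup>2 * min 1 (h\<^sup>2) / \<bar>h\<bar> powr (1 + 2 * s))"
        by (intro mult_left_mono divide_right_mono V_bound) auto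
      also have "\<dots> \<le> \<bar>(real n * B)\<^sup>2 * (indicator {0..L} x * k h)\<bar>"
        by (rule order_trans [OF _ abs_ge_self]) (simp add: k_def mult_ac)
      finally show ?thesis .
    qed
    then show "AE p in lborel \<Otimes>\<^sub>M lborel. norm (case_prod F p)
        \<le> norm ((real n * B)\<^sup>2 * (case p of (x, h) \<Rightarrow> indicator {0..L} x * k h))"
      by (intro AE_I2) (auto split: prod.split)
  qed
  have "(LINT x:{0..L}|lborel. LINT y|lborel. \<bar>V x - V y\<bar>\<^sup>2 / \<bar>x - y\<bar> powr (1 + 2 * s))
      = (LINT x|lborel. LINT h|lborel. F x h)"
    unfolding set_lebesgue_integral_def
  proof (rule Bochner_Integration.integral_cong [OF refl])
    fix x
    have "(LINT y|lborel. \<bar>V x - V y\<bar>\<^sup>2 / \<bar>x - y\<bar> powr (1 + 2 * s))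
        = (LINT h|lborel. \<bar>V x - V (x + h)\<bar>\<^sup>2 / \<bar>h\<bar> powr (1 + 2 * s))"
      by (subst lborel_integral_real_affine [of 1 _ x]) simp_all
    then show "indicator {0..L} x *\<^sub>R (LINT y|lborel. \<bar>V x - V y\<bar>\<^sup>2 / \<bar>x - y\<bar> powr (1 + 2 * s))
        = (LINT h|lborel. F x h)"
      by (simp add: F_def del: times_divide_eq_right)
  qed
  also have "\<dots> = (LINT h|lborel. LINT x|lborel. F x h)"
    by (rule lborel_pair.Fubini_integral [OF F_int, symmetric])
  also have "\<dots> = (LINT h|lborel. (\<Sum>i<n. \<Sum>j<n. second_diff ?c (X i - X j) h / \<bar>h\<bar> powr (1 + 2 * s)))"
  proof (rule Bochner_Integration.integral_cong [OF refl])
    fix h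
    let ?D = "\<lambda>i x. W (x - X i) - W (x - (X i - h))"
    have WW: "set_integrable lborel {0..L} (\<lambda>x. W (x - a) * W (x - b))" for a b
      using contW [of "- a"] contW [of "- b"] by (intro set_integrable_continuous continuous_on_mult) auto
    have DD: "set_integrable lborel {0..L} (\<lambda>x. ?D i x * ?D j x) \<and>
      (LINT x:{0..L}|lborel. ?D i x * ?D j x) = second_diff ?c (X i - X j) h" for i j
    proof -
      \<comment> \<open>With d = X i - X j the four products have lags d, d + h, d and d - h, which
        is the pattern of \<open>second_diff\<close>.\<close>
      have eq: "?D i x * ?D j x = (W (x - X i) * W (x - X j) - W (x - X i) * W (x - (X j - h)))
         + (W (x - (X i - h)) * W (x - (X j - h)) - W (x - (X i - h)) * W (x - X j))" for x
        by (simp add: algebra_simps)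
      have "(LINT x:{0..L}|lborel. ?D i x * ?D j x) = ((LINT x:{0..L}|lborel. W (x - X i) * W (x - X j))
          - (LINT x:{0..L}|lborel. W (x - X i) * W (x - (X j - h))))
         + ((LINT x:{0..L}|lborel. W (x - (X i - h)) * W (x - (X j - h)))
          - (LINT x:{0..L}|lborel. W (x - (X i - h)) * W (x - X j)))"
        unfolding eq by (simp only: set_integral_add(2) set_integral_diff WW)
      also have "\<dots> = second_diff ?c (X i - X j) h"
        unfolding correlation_shift [OF W per L] second_diff_def by (simp add: algebra_simps)
      finally show ?thesis
        unfolding eq by (intro conjI set_integral_add(1) set_integral_diff(1) WW)
    qed
    have "(LINT x|lborel. F x h) = (LINT x:{0..L}|lborel. (\<Sum>i<n. \<Sum>j<n. ?D i x * ?D j x)) / \<bar>h\<bar> powr (1 + 2 * s)"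
    proof -
      have "\<bar>V x - V (x + h)\<bar>\<^sup>2 = (\<Sum>i<n. \<Sum>j<n. ?D i x * ?D j x)" for x
      proof -
        have "V x - V (x + h) = (\<Sum>i<n. ?D i x)"
          by (simp add: V_def sum_subtractf algebra_simps)
        then show ?thesis
          by (simp add: power2_eq_square sum_product)
      qed
      then show ?thesis
        unfolding F_def set_lebesgue_integral_def by simp
    qed
    also have "(LINT x:{0..L}|lborel. (\<Sum>i<n. \<Sum>j<n. ?D i x * ?D j x)) = (\<Sum>i<n. \<Sum>j<n. second_diff ?c (X i - X j) h)"
      unfolding DD [THEN conjunct2, symmetric] set_lebesgue_integral_def scaleR_sum_right
    proof (subst Bochner_Integration.integral_sum)
      have int: "integrable lborel (\<lambda>x. indicator {0..L} x *\<^sub>R (?D i x * ?D j x))" for i j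
        using DD by (simp only: set_integrable_def)
      show "integrable lborel (\<lambda>x. \<Sum>j<n. indicator {0..L} x *\<^sub>R (?D i x * ?D j x))" for i
        by (intro Bochner_Integration.integrable_sum int)
      show "(\<Sum>i<n. LINT x|lborel. (\<Sum>j<n. indicator {0..L} x *\<^sub>R (?D i x * ?D j x))) =
        (\<Sum>i<n. \<Sum>j<n. LINT x|lborel. indicator {0..L} x *\<^sub>R (?D i x * ?D j x))"
        by (intro sum.cong refl Bochner_Integration.integral_sum int)
    qed
    finally show "(LINT x|lborel. F x h) = (\<Sum>i<n. \<Sum>j<n. second_diff ?c (X i - X j) h / \<bar>h\<bar> powr (1 + 2 * s))"
      by (simp add: sum_divide_distrib)
  qed
  also have "\<dots> = (\<Sum>i<n. \<Sum>j<n. frac_laplacian s ?c (X i - X j))"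
    unfolding frac_laplacian_def using frac_laplacian_integrable [OF c s]
    by (simp add: Bochner_Integration.integral_sum Bochner_Integration.integrable_sum)
  finally show ?thesis .
qed

text \<open>At a maximum z of p' the second difference is the sum of the deficits
  \<open>1 / L - deriv p\<close> at z + h and z - h, both nonnegative. Keeping only the forward
  deficit for h in (0, L] bounds the integral below by its mass times the smallest kernel
  value.\<close>

lemma frac_laplacian_lower_bound:
  assumes p: "bounded_smooth p" and per: "p (z + L) = p z" and L: "L > 0" and s: "0 < s" "s < 1"
    and le: "\<And>x. deriv p x \<le> 1 / L" and eq: "deriv p z = 1 / L"
  shows "L powr - (1 + 2 * s) \<le> frac_laplacian s (deriv p) z"
proof -
  have cont: "continuous_on UNIV (\<lambda>h. 1 / L - deriv p (z + h))"
    using bounded_smooth_continuous_on_shift [OF bounded_smooth_deriv [OF p], of UNIV z]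
    by (intro continuous_intros) (simp add: add.commute)
  \<comment> \<open>Over one period h / L grows by 1 while p returns to its value; this is why the
    deficit has mass 1.\<close>
  have "((\<lambda>h. h / L - p (z + h)) has_real_derivative 1 / L - deriv p (z + h)) (at h)" for h
    using DERIV_diff [OF DERIV_cdivide [OF DERIV_ident, where c = L]
      DERIV_shift [of p "deriv p (h + z)" h z, THEN iffD1, OF bounded_smooth_DERIV [OF p]]]
    by (simp add: add.commute [of z])
  then have int: "(LINT h:{0..L}|lborel. 1 / L - deriv p (z + h)) = 1"
    using set_integral_FTC [OF _ cont, of "\<lambda>h. h / L - p (z + h)" 0 L] L per by simp
  let ?k = "L powr - (1 + 2 * s)"
  have "?k = (LINT h|lborel. indicator {0..L} h *\<^sub>R (1 / L - deriv p (z + h)) * ?k)"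
    using int by (simp add: set_lebesgue_integral_def)
  also have "\<dots> \<le> frac_laplacian s (deriv p) z"
    unfolding frac_laplacian_def
  proof (rule integral_mono)
    show "integrable lborel (\<lambda>h. indicator {0..L} h *\<^sub>R (1 / L - deriv p (z + h)) * ?k)"
      using set_integrable_continuous [OF cont] by (intro integrable_mult_left) (simp add: set_integrable_def)
    show "integrable lborel (\<lambda>h. second_diff (deriv p) z h / \<bar>h\<bar> powr (1 + 2 * s))"
      by (intro frac_laplacian_integrable bounded_smooth_deriv p s)
    fix h
    have nonneg: "0 \<le> 1 / L - deriv p (z + h)" and sd: "1 / L - deriv p (z + h) \<le> second_diff (deriv p) z h"
      using le [of "z + h"] le [of "z - h"] eq by (auto simp: second_diff_def)
    show "indicator {0..L} h *\<^sub>R (1 / L - deriv p (z + h)) * ?k \<le> second_diff (deriv p) z h / \<bar>h\<bar> powr (1 + 2 * s)"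
    proof (cases "h \<in> {0<..L}")
      case True
      have "(1 / L - deriv p (z + h)) * ?k = (1 / L - deriv p (z + h)) / L powr (1 + 2 * s)"
        unfolding powr_minus_divide by simp
      also have "\<dots> \<le> second_diff (deriv p) z h / \<bar>h\<bar> powr (1 + 2 * s)"
        using True nonneg sd s by (intro frac_le powr_mono2) auto
      finally show ?thesis using True by simp
    next
      \<comment> \<open>This case contains h = 0, where the quotient is 0 by the convention for
        division; the deficit vanishes there too, by \<open>eq\<close>.\<close>
      case False
      then have "indicator {0..L} h *\<^sub>R (1 / L - deriv p (z + h)) * ?k = 0"
        using eq by (auto simp: indicator_def)
      moreover have "0 \<le> second_diff (deriv p) z h / \<bar>h\<bar> powr (1 + 2 * s)"
        using nonneg sd by simp
      ultimately show ?thesis by (simp only:)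
    qed
  qed
  finally show ?thesis .
qed

text \<open>Integration by parts moves one derivative to the first factor, with boundary terms
  cancelling by periodicity. As W' has mean zero, passing from W' to 1 / L - W' costs only the
  constant 1 / L. The new factors are periodised bumps when W is the mollified sawtooth, so sign and
  support of 1 / L - c'' can be read off.\<close>

lemma correlation_second_deriv:
  assumes W: "bounded_smooth W" and per: "\<And>x. W (x + L) = W x" and L: "L > 0"
  shows "deriv (deriv (correlation L W W)) z =
    1 / L - (LINT x:{0..L}|lborel. (1 / L - deriv W x) * (1 / L - deriv W (x + z)))"
proof -
  note W' = bounded_smooth_deriv [OF W] and W'' = bounded_smooth_deriv [OF bounded_smooth_deriv [OF W]]
  note cont = bounded_smooth_continuous_on [OF W, of UNIV] bounded_smooth_continuous_on [OF W', of UNIV]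
    bounded_smooth_continuous_on_shift [OF W', of UNIV z] bounded_smooth_continuous_on_shift [OF W'', of UNIV z]
  note per' = periodic_deriv [OF bounded_smooth_DERIV [OF W] per]
  have shift: "((\<lambda>x. f (x + z)) has_real_derivative deriv f (x + z)) (at x)" if "bounded_smooth f" for f x
    using bounded_smooth_DERIV [OF that, of "x + z"] by (simp add: DERIV_shift [symmetric])
  have si: "set_integrable lborel {0..L} f" if "continuous_on UNIV f" for f :: "real \<Rightarrow> real"
    by (rule set_integrable_continuous [OF that])
  have "(LINT x:{0..L}|lborel. deriv W x * deriv W (x + z) + deriv (deriv W) (x + z) * W x) =
     W L * deriv W (L + z) - W 0 * deriv W (0 + z)"
    using L by (intro set_integral_FTC DERIV_mult bounded_smooth_DERIV shift W W' continuous_on_add continuous_on_mult cont) auto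
  also have "\<dots> = 0"
    using per [of 0] per' [of z] by (simp add: add.commute)
  finally have parts: "(LINT x:{0..L}|lborel. W x * deriv (deriv W) (x + z)) =
      - (LINT x:{0..L}|lborel. deriv W x * deriv W (x + z))"
    using set_integral_add(2) [OF si si, of "\<lambda>x. deriv W x * deriv W (x + z)" "\<lambda>x. deriv (deriv W) (x + z) * W x"]
      cont by (simp add: continuous_on_mult mult.commute)
  have "deriv (correlation L W W) = correlation L W (deriv W)"
    by (intro ext DERIV_imp_deriv correlation_DERIV cont W)
  then have "deriv (deriv (correlation L W W)) z = correlation L W (deriv (deriv W)) z"
    using DERIV_imp_deriv [OF correlation_DERIV [OF cont(1) W']] by simp
  also have "\<dots> = - (LINT x:{0..L}|lborel. deriv W x * deriv W (x + z))"
    by (simp add: correlation_def parts)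
  also have "\<dots> = 1 / L - (LINT x:{0..L}|lborel. (1 / L - deriv W x) * (1 / L - deriv W (x + z)))"
  proof -
    have i1: "(LINT x:{0..L}|lborel. deriv W x) = 0"
      using set_integral_FTC [OF bounded_smooth_DERIV [OF W] cont(2), of 0 L] L per [of 0] by simp
    have i2: "(LINT x:{0..L}|lborel. deriv W (x + z)) = 0"
      using set_integral_FTC [OF shift [OF W] cont(3), of 0 L] L per [of z] by (simp add: add.commute)
    have i3: "(LINT x:{0..L}|lborel. 1 / L\<^sup>2) = 1 / L"
      using set_integral_FTC [of "\<lambda>x. x / L\<^sup>2" "\<lambda>_. 1 / L\<^sup>2" 0 L,
        OF DERIV_cdivide [OF DERIV_ident] continuous_on_const less_imp_le [OF L]] L
      by (simp add: power2_eq_square del: set_integral_divide_zero)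
    have eq: "(1 / L - deriv W x) * (1 / L - deriv W (x + z)) =
      1 / L\<^sup>2 + ((- 1 / L) * deriv W x + ((- 1 / L) * deriv W (x + z) + deriv W x * deriv W (x + z)))" for x
      by (simp add: algebra_simps power2_eq_square)
    have "(LINT x:{0..L}|lborel. (1 / L - deriv W x) * (1 / L - deriv W (x + z))) =
      (LINT x:{0..L}|lborel. 1 / L\<^sup>2) + ((- 1 / L) * (LINT x:{0..L}|lborel. deriv W x)
       + ((- 1 / L) * (LINT x:{0..L}|lborel. deriv W (x + z)) + (LINT x:{0..L}|lborel. deriv W x * deriv W (x + z))))"
      unfolding eq set_integral_mult_right [symmetric]
      by (subst set_integral_add(2), (intro si continuous_intros cont)+)+ (rule refl)
    then show ?thesis unfolding i1 i2 i3 by simp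
  qed
  finally show ?thesis .
qed

lemma frac_laplacian_reflect:
  assumes "\<And>x. f (- x) = c * f x"
  shows "frac_laplacian s f (- z) = c * frac_laplacian s f z"
proof -
  have "second_diff f (- z) h = c * second_diff f z h" for h
  proof -
    have "- z + h = - (z - h)" "- z - h = - (z + h)" by simp_all
    then show ?thesis
      by (simp only: second_diff_def assms) (simp add: algebra_simps)
  qed
  then show ?thesis
    unfolding frac_laplacian_def by (simp flip: times_divide_eq_right)
qed

lemma frac_laplacian_periodic:
  assumes "\<And>x. f (x + L) = f x"
  shows "frac_laplacian s f (z + L) = frac_laplacian s f z"
proof -
  have "second_diff f (z + L) h = second_diff f z h" for h
    using assms [of z] assms [of "z + h"] assms [of "z - h"]
    by (simp add: second_diff_def algebra_simps)
  then show ?thesis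
    unfolding frac_laplacian_def by simp
qed

text \<open>This is the interface between analysis and dynamics: all later arguments see the energy
  only through the force g and the lower bound on g' away from the multiples of \<Lambda>.\<close>

lemma energy_pair_interaction:
  assumes \<rho>: "standard_mollifier \<rho>" and \<epsilon>: "0 < \<epsilon>" and \<Lambda>: "\<Lambda> \<ge> 1" and s: "0 < s" "s < 1"
  obtains G g g' where "\<And>X. energy \<rho> s \<epsilon> \<Lambda> X = 1 / 2 * (\<Sum>i<\<Lambda>. \<Sum>j<\<Lambda>. G (X i - X j))"
    and "\<And>z. (G has_real_derivative g z) (at z)"
    and "\<And>z. (g has_real_derivative g' z) (at z)"
    and "\<And>z. g (- z) = - g z"
    and "\<And>z. g (z + real \<Lambda>) = g z"
    and "\<And>z. \<forall>k::int. 2 * \<epsilon> \<le> \<bar>z + real \<Lambda> * of_int k\<bar> \<Longrightarrow> real \<Lambda> powr - (1 + 2 * s) \<le> g' z"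
proof -
  let ?f = "rescaled \<rho> \<epsilon>"
  let ?L = "real \<Lambda>"
  define W where "W = mollified_sawtooth ?f ?L"
  define c where "c = correlation ?L W W"
  have L: "?L > 0" using \<Lambda> by simp
  note f = test_function_rescaled [OF \<rho> \<epsilon>]
  have W: "bounded_smooth W"
    unfolding W_def by (rule mollified_sawtooth_bounded_smooth [OF f])
  have W_per: "W (x + ?L) = W x" for x
    unfolding W_def by (rule mollified_sawtooth_periodic [OF L])
  have c: "bounded_smooth c"
    unfolding c_def by (intro correlation_bounded_smooth bounded_smooth_continuous_on W)
  have c_per: "c (z + ?L) = c z" for z
    using W_per [of "_ + z"] unfolding c_def correlation_def by (simp add: add.assoc [symmetric])
  have c_even: "c (- z) = c z" for z
    using correlation_shift [OF W W_per L, of 0 z] correlation_shift [OF W W_per L, of z 0]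
    by (simp add: c_def mult.commute)
  have c'_per: "deriv c (z + ?L) = deriv c z" for z
    by (rule periodic_deriv [OF bounded_smooth_DERIV [OF c] c_per])
  have c'_odd: "deriv c (- z) = - deriv c z" for z
  proof -
    have "((\<lambda>z. c (- z)) has_real_derivative deriv c (- z) * - 1) (at z)"
      by (rule DERIV_chain2 [OF bounded_smooth_DERIV [OF c]]) (auto intro!: derivative_eq_intros)
    then have "(c has_real_derivative - deriv c (- z)) (at z)"
      by (simp add: c_even)
    from DERIV_imp_deriv [OF this] show ?thesis by simp
  qed
  have f_nonneg: "0 \<le> ?f x" and f_support: "?f x \<noteq> 0 \<Longrightarrow> \<bar>x\<bar> < \<epsilon>" for x
  proof -
    show "0 \<le> ?f x"
      using \<rho> \<epsilon> unfolding standard_mollifier_def rescaled_def by simp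
    assume "?f x \<noteq> 0"
    then have "x / \<epsilon> \<in> {-1<..<1}"
      using \<rho> unfolding standard_mollifier_def rescaled_def by auto
    then show "\<bar>x\<bar> < \<epsilon>"
      using \<epsilon> by (auto simp: field_simps abs_less_iff)
  qed
  have f_mass: "(LINT x|lborel. ?f x) = 1"
    using \<rho> \<epsilon> lborel_integral_real_affine [of "1 / \<epsilon>" \<rho> 0]
    unfolding standard_mollifier_def rescaled_def by simp
  \<comment> \<open>This is the mollifier repeated with period \<Lambda>, hence nonnegative and
    supported within \<epsilon> of the multiples of \<Lambda>.\<close>
  define r where "r x = 1 / ?L - deriv W x" for x
  have r: "r x = (\<Sum>k | ?f (x - ?L * of_int k) \<noteq> 0. ?f (x - ?L * of_int k))" for x
    unfolding r_def W_def mollified_sawtooth_deriv [OF f L] f_mass by simp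
  have r_nonneg: "0 \<le> r x" for x
    unfolding r by (intro sum_nonneg f_nonneg)
  have r_support: "\<exists>k::int. \<bar>x - ?L * of_int k\<bar> < \<epsilon>" if "r x \<noteq> 0" for x
    using that f_support unfolding r by (metis (no_types, lifting) sum.neutral)
  have c'': "deriv (deriv c) z = 1 / ?L - (LINT x:{0..?L}|lborel. r x * r (x + z))" for z
    unfolding c_def r_def by (rule correlation_second_deriv [OF W W_per L])
  show ?thesis
  proof (rule that [of "frac_laplacian s c" "frac_laplacian s (deriv c)" "frac_laplacian s (deriv (deriv c))"])
    show "energy \<rho> s \<epsilon> \<Lambda> X = 1 / 2 * (\<Sum>i<\<Lambda>. \<Sum>j<\<Lambda>. frac_laplacian s c (X i - X j))" for X
      unfolding energy_def mollified_potential_diff [OF \<rho> \<epsilon> \<Lambda>] c_def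
        pair_integral [OF W W_per L s, symmetric] unfolding W_def ..
    show "(frac_laplacian s c has_real_derivative frac_laplacian s (deriv c) z) (at z)" for z
      by (rule frac_laplacian_DERIV [OF c s])
    show "(frac_laplacian s (deriv c) has_real_derivative frac_laplacian s (deriv (deriv c)) z) (at z)" for z
      by (rule frac_laplacian_DERIV [OF bounded_smooth_deriv [OF c] s])
    show "frac_laplacian s (deriv c) (- z) = - frac_laplacian s (deriv c) z" for z
      using frac_laplacian_reflect [of "deriv c" "-1" s z] c'_odd by simp
    show "frac_laplacian s (deriv c) (z + ?L) = frac_laplacian s (deriv c) z" for z
      by (rule frac_laplacian_periodic [of "deriv c" ?L, OF c'_per])
    show "?L powr - (1 + 2 * s) \<le> frac_laplacian s (deriv (deriv c)) z"
      if z: "\<forall>k::int. 2 * \<epsilon> \<le> \<bar>z + ?L * of_int k\<bar>" for z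
    proof (rule frac_laplacian_lower_bound [OF bounded_smooth_deriv [OF c] c'_per L s])
      show "deriv (deriv c) x \<le> 1 / ?L" for x
        unfolding c'' set_lebesgue_integral_def
        by (simp add: integral_nonneg r_nonneg)
      \<comment> \<open>Two bumps of radius \<epsilon> shifted by z overlap only if z is within
        \<open>2 * \<epsilon>\<close> of a multiple of \<Lambda>; this is the origin of the
        threshold.\<close>
      have "r x * r (x + z) = 0" for x
      proof (rule ccontr)
        assume "r x * r (x + z) \<noteq> 0"
        then obtain j k :: int where "\<bar>x - ?L * of_int j\<bar> < \<epsilon>" "\<bar>x + z - ?L * of_int k\<bar> < \<epsilon>"
          using r_support [of x] r_support [of "x + z"] by auto
        moreover have "z + ?L * of_int (j - k) = (x + z - ?L * of_int k) - (x - ?L * of_int j)"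
          by (simp add: algebra_simps)
        ultimately show False
          using spec [OF z, of "j - k"] by linarith
      qed
      then have "(LINT x:{0..?L}|lborel. r x * r (x + z)) = (LINT x:{0..?L}|lborel. 0)"
        by (simp only:)
      then show "deriv (deriv c) z = 1 / ?L"
        unfolding c'' by simp
    qed
  qed
qed

section \<open>Gradient and Hessian\<close>

lemma DERIV_fun_upd:
  "((\<lambda>t. (X(i := t)) a) has_real_derivative of_bool (a = i)) (at t)"
  by (cases "a = i") auto

text \<open>Particle i occurs both as first and as second index; oddness makes the two contributions
  equal and absorbs the factor 1 / 2.\<close>

lemma partial_pair_sum:
  fixes G g :: "real \<Rightarrow> real"
  assumes F: "\<And>X. F X = 1 / 2 * (\<Sum>a<n. \<Sum>b<n. G (X a - X b))"
    and G: "\<And>z. (G has_real_derivative g z) (at z)" and odd: "\<And>z. g (- z) = - g z" and i: "i < n"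
  shows "partial i F X = (\<Sum>j<n. g (X i - X j))"
  unfolding partial_def
proof (rule DERIV_imp_deriv)
  let ?S = "\<Sum>a<n. \<Sum>b<n. g ((X(i := X i)) a - (X(i := X i)) b) * (of_bool (a = i) - of_bool (b = i))"
  have "?S = (\<Sum>a<n. of_bool (a = i) * (\<Sum>b<n. g (X a - X b))) - (\<Sum>a<n. \<Sum>b<n. of_bool (b = i) * g (X a - X b))"
    by (simp add: right_diff_distrib sum_subtractf sum_distrib_left mult.commute)
  also have "(\<Sum>a<n. \<Sum>b<n. of_bool (b = i) * g (X a - X b)) = (\<Sum>a<n. g (X a - X i))"
    using i by (intro sum.cong refl) (simp add: of_bool_def if_distrib [of "\<lambda>c. c * _"] cong: if_cong)
  also have "\<dots> = (\<Sum>a<n. - g (X i - X a))"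
    by (intro sum.cong refl) (simp flip: odd)
  also have "(\<Sum>a<n. of_bool (a = i) * (\<Sum>b<n. g (X a - X b))) = (\<Sum>b<n. g (X i - X b))"
    using i by (simp add: of_bool_def if_distrib [of "\<lambda>c. c * _"] cong: if_cong)
  finally have S: "?S = 2 * (\<Sum>j<n. g (X i - X j))"
    by (simp add: sum_negf)
  have "((\<lambda>t. F (X(i := t))) has_real_derivative 1 / 2 * ?S) (at (X i))"
    unfolding F by (intro DERIV_cmult DERIV_sum DERIV_chain2 [OF G] DERIV_diff DERIV_fun_upd)
  then show "((\<lambda>t. F (X(i := t))) has_real_derivative (\<Sum>j<n. g (X i - X j))) (at (X i))"
    unfolding S by simp
qed

text \<open>Exchanging the names of i and j and averaging turns a weighted antisymmetric sum into
  one over differences. The Hessian, the conservation of the mean, the dissipation and the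
  comparison of windings all rest on it.\<close>

lemma sum_antisymmetric:
  fixes d :: "nat \<Rightarrow> real" and A :: "nat \<Rightarrow> nat \<Rightarrow> real"
  assumes "\<And>i j. A j i = - A i j"
  shows "2 * (\<Sum>i<n. \<Sum>j<n. A i j * d i) = (\<Sum>i<n. \<Sum>j<n. A i j * (d i - d j))"
proof -
  have "(\<Sum>i<n. \<Sum>j<n. A i j * d i) = (\<Sum>i<n. \<Sum>j<n. A j i * d j)"
    by (rule sum.swap)
  also have "\<dots> = (\<Sum>i<n. \<Sum>j<n. - (A i j * d j))"
  proof (intro sum.cong refl)
    show "A j i * d j = - (A i j * d j)" for i j
      using assms [where i = i and j = j] by simp
  qed
  also have "\<dots> = - (\<Sum>i<n. \<Sum>j<n. A i j * d j)"
    by (simp add: sum_negf)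
  finally show ?thesis
    by (simp add: right_diff_distrib sum_subtractf)
qed

text \<open>The cross terms form the square of the sum and vanish. The factor n is what raises the
  pair constant \<open>\<Lambda> powr - (1 + 2 * s)\<close> to the exponent
  \<open>- 2 * s\<close>.\<close>

lemma sum_square_diff:
  fixes d :: "nat \<Rightarrow> real"
  assumes "(\<Sum>i<n. d i) = 0"
  shows "(\<Sum>i<n. \<Sum>j<n. (d i - d j)\<^sup>2) = 2 * real n * (\<Sum>i<n. (d i)\<^sup>2)"
proof -
  have "(\<Sum>i<n. \<Sum>j<n. (d i - d j)\<^sup>2) = (\<Sum>i<n. real n * (d i)\<^sup>2 + (\<Sum>j<n. (d j)\<^sup>2) - 2 * d i * (\<Sum>j<n. d j))"
    by (simp add: power2_diff sum.distrib sum_subtractf sum_distrib_left)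
  then show ?thesis
    using assms by (simp add: sum.distrib sum_distrib_left mult.assoc)
qed

lemma hessian_pair_sum:
  fixes G g g' :: "real \<Rightarrow> real"
  assumes F: "\<And>X. F X = 1 / 2 * (\<Sum>a<n. \<Sum>b<n. G (X a - X b))"
    and G: "\<And>z. (G has_real_derivative g z) (at z)" and g: "\<And>z. (g has_real_derivative g' z) (at z)"
    and odd: "\<And>z. g (- z) = - g z"
  shows "hessian_form n F Y h = 1 / 2 * (\<Sum>i<n. \<Sum>j<n. g' (Y i - Y j) * (h i - h j)\<^sup>2)"
proof -
  \<comment> \<open>Evenness of g' makes \<open>g' (Y j - Y k) * (h j - h k)\<close> antisymmetric
    in j and k.\<close>
  have even: "g' (- z) = g' z" for z
  proof -
    have "((\<lambda>z. - g (- z)) has_real_derivative g' (- z)) (at z)"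
      using DERIV_minus [OF DERIV_chain2 [OF g DERIV_minus [OF DERIV_ident]], of z] by simp
    then show ?thesis
      using g [of z] by (simp add: odd DERIV_unique)
  qed
  have "partial i (partial j F) Y = (\<Sum>k<n. g' (Y j - Y k) * (of_bool (j = i) - of_bool (k = i)))"
    if j: "j < n" for i j
    unfolding partial_def [of i]
  proof (rule DERIV_imp_deriv)
    have "((\<lambda>t. partial j F (Y(i := t))) has_real_derivative
       (\<Sum>k<n. g' ((Y(i := Y i)) j - (Y(i := Y i)) k) * (of_bool (j = i) - of_bool (k = i)))) (at (Y i))"
      unfolding partial_pair_sum [OF F G odd j]
      by (intro DERIV_sum DERIV_chain2 [OF g] DERIV_diff DERIV_fun_upd)
    then show "((\<lambda>t. partial j F (Y(i := t))) has_real_derivative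
       (\<Sum>k<n. g' (Y j - Y k) * (of_bool (j = i) - of_bool (k = i)))) (at (Y i))"
      by simp
  qed
  then have "hessian_form n F Y h =
      (\<Sum>i<n. \<Sum>j<n. \<Sum>k<n. g' (Y j - Y k) * (of_bool (j = i) - of_bool (k = i)) * h i * h j)"
    by (simp add: hessian_form_def sum_distrib_right)
  also have "\<dots> = (\<Sum>j<n. \<Sum>k<n. \<Sum>i<n. g' (Y j - Y k) * (of_bool (j = i) - of_bool (k = i)) * h i * h j)"
    by (subst sum.swap) (intro sum.cong refl sum.swap)
  also have "\<dots> = (\<Sum>j<n. \<Sum>k<n. (g' (Y j - Y k) * (h j - h k)) * h j)"
  proof (intro sum.cong refl)
    fix j k assume "j \<in> {..<n}" "k \<in> {..<n}"
    then have "(\<Sum>i<n. (of_bool (j = i) - of_bool (k = i)) * h i) = h j - h k"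
      by (simp add: left_diff_distrib sum_subtractf of_bool_def if_distrib [of "\<lambda>c. c * _"] cong: if_cong)
    then show "(\<Sum>i<n. g' (Y j - Y k) * (of_bool (j = i) - of_bool (k = i)) * h i * h j) = g' (Y j - Y k) * (h j - h k) * h j"
      by (simp add: mult.assoc sum_distrib_left [symmetric] sum_distrib_right [symmetric] del: of_bool_eq_iff)
        (simp add: mult.assoc [symmetric] sum_distrib_right [symmetric])
  qed
  finally show ?thesis
    using sum_antisymmetric [where A = "\<lambda>j k. g' (Y j - Y k) * (h j - h k)" and n = n and d = h]
      even [of "Y _ - Y _"]
    by (simp add: algebra_simps power2_eq_square)
qed

section \<open>Gradient flows of monotone pair interactions\<close>

text \<open>Raising m by 1 drops the term at m mod n and appends the one at (m + n) mod n, which is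
  the same.\<close>

lemma sum_shift_mod:
  fixes f :: "nat \<Rightarrow> real"
  shows "(\<Sum>j<n. f ((m + j) mod n)) = (\<Sum>j<n. f j)"
proof (induction m)
  case (Suc m)
  have "(\<Sum>j<n. f ((Suc m + j) mod n)) + f (m mod n) = (\<Sum>j<Suc n. f ((m + j) mod n))"
    by (subst sum.lessThan_Suc_shift) simp
  also have "\<dots> = (\<Sum>j<n. f ((m + j) mod n)) + f (m mod n)"
    by simp
  finally show ?case using Suc.IH by simp
qed simp

text \<open>The particles are to be labelled in increasing order at time 0, and r is
  \<open>2 * \<epsilon>\<close>. Monotonicity is assumed only on [r, \<Lambda> - r], where all
  differences lie as long as every gap is at least r; r at most 1 places the lattice differences
  there as well.\<close>

locale pair_flow =
  fixes \<Lambda> :: nat and g :: "real \<Rightarrow> real" and r \<kappa> :: real and x :: "real \<Rightarrow> nat \<Rightarrow> real"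
  assumes \<Lambda>: "1 \<le> \<Lambda>" and r: "0 < r" "r \<le> 1"
    and odd: "\<And>z. g (- z) = - g z" and per: "\<And>z. g (z + real \<Lambda>) = g z"
    and mono: "\<And>a b. r \<le> a \<Longrightarrow> a \<le> b \<Longrightarrow> b \<le> real \<Lambda> - r \<Longrightarrow> \<kappa> * (b - a) \<le> g b - g a"
    and \<kappa>: "0 \<le> \<kappa>"
    and ode: "\<And>t i. 0 \<le> t \<Longrightarrow> i < \<Lambda> \<Longrightarrow>
      ((\<lambda>t. x t i) has_real_derivative - (\<Sum>j<\<Lambda>. g (x t i - x t j))) (at t within {0..})"
begin

text \<open>Labels the whole \<open>\<Lambda>\<close>-periodic configuration, so that the gap between the last particle and the
  first one of the next period needs no separate treatment.\<close>

definition lift :: "real \<Rightarrow> nat \<Rightarrow> real" where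
  "lift t n = x t (n mod \<Lambda>) + real \<Lambda> * real (n div \<Lambda>)"

definition gap :: "real \<Rightarrow> nat \<Rightarrow> real" where
  "gap t n = lift t (Suc n) - lift t n"

lemma per_nat: "g (z + real \<Lambda> * real k) = g z"
proof (induction k)
  case (Suc k)
  then show ?case
    using per [of "z + real \<Lambda> * real k"] by (simp add: algebra_simps)
qed simp

lemma lift_add: "lift t (n + \<Lambda>) = lift t n + real \<Lambda>"
  using \<Lambda> by (simp add: lift_def algebra_simps)

lemma gap_mod: "gap t (n mod \<Lambda>) = gap t n"
proof -
  have "gap t (m + k * \<Lambda>) = gap t m" for m k
    using \<Lambda> by (simp add: gap_def lift_def algebra_simps flip: add_Suc)
  from this [of "n mod \<Lambda>" "n div \<Lambda>"] show ?thesis by simp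
qed

text \<open>Indexing the forces by the offset j from n, instead of by absolute labels, lets the
  equations of two neighbouring particles be compared term by term.\<close>

lemma lift_DERIV:
  assumes "0 \<le> t"
  shows "((\<lambda>t. lift t n) has_real_derivative (\<Sum>j<\<Lambda>. g (lift t (n + j) - lift t n))) (at t within {0..})"
proof -
  let ?m = "n mod \<Lambda>"
  have "((\<lambda>t. lift t n) has_real_derivative - (\<Sum>j<\<Lambda>. g (x t ?m - x t j))) (at t within {0..})"
    unfolding lift_def using DERIV_add [OF ode [OF assms, of ?m] DERIV_const] \<Lambda> by simp
  also have "- (\<Sum>j<\<Lambda>. g (x t ?m - x t j)) = (\<Sum>j<\<Lambda>. g (x t j - x t ?m))"
    using odd [of "x t ?m - x t _"] by (simp add: sum_negf)
  also have "\<dots> = (\<Sum>j<\<Lambda>. g (x t ((n + j) mod \<Lambda>) - x t ?m))"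
    by (rule sum_shift_mod [symmetric])
  also have "\<dots> = (\<Sum>j<\<Lambda>. g (lift t (n + j) - lift t n))"
  proof (intro sum.cong refl)
    fix j
    have "n div \<Lambda> \<le> (n + j) div \<Lambda>" by (simp add: div_le_mono)
    then have "lift t (n + j) - lift t n = x t ((n + j) mod \<Lambda>) - x t ?m + real \<Lambda> * real ((n + j) div \<Lambda> - n div \<Lambda>)"
      by (simp add: lift_def of_nat_diff algebra_simps)
    then show "g (x t ((n + j) mod \<Lambda>) - x t ?m) = g (lift t (n + j) - lift t n)"
      by (simp only: per_nat)
  qed
  finally show ?thesis .
qed

lemma lift_diff_ge:
  assumes "\<And>n. r \<le> gap t n" "m < n"
  shows "r \<le> lift t n - lift t m"
  using assms(2)
proof (induction n)
  case (Suc n)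
  show ?case
  proof (cases "m = n")
    case True
    then show ?thesis using assms(1) [of m] by (simp add: gap_def)
  next
    case False
    then show ?thesis using Suc assms(1) [of n] r by (simp add: gap_def)
  qed
qed simp

text \<open>For equal offset j the two arguments of g differ by
  \<open>gap t (n + j) - gap t n\<close>, which is nonnegative because gap n is the smallest; so
  every term is nonnegative.\<close>

lemma gap_derivative_nonneg:
  assumes gaps: "\<And>n. r \<le> gap t n" and min: "\<And>k. gap t n \<le> gap t k"
  shows "0 \<le> (\<Sum>j<\<Lambda>. g (lift t (Suc n + j) - lift t (Suc n))) - (\<Sum>j<\<Lambda>. g (lift t (n + j) - lift t n))"
  unfolding sum_subtractf [symmetric]
proof (rule sum_nonneg)
  fix j assume j: "j \<in> {..<\<Lambda>}"
  show "0 \<le> g (lift t (Suc n + j) - lift t (Suc n)) - g (lift t (n + j) - lift t n)"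
  proof (cases "j = 0")
    case False
    let ?a = "lift t (n + j) - lift t n" and ?b = "lift t (Suc n + j) - lift t (Suc n)"
    have "?a \<le> ?b"
      using min [of "n + j"] by (simp add: gap_def)
    moreover have "r \<le> ?a"
      using False by (intro lift_diff_ge gaps) simp
    \<comment> \<open>The upper bound comes from the gap to the next periodic copy: j < \<Lambda>
      keeps one gap between particle Suc n + j and the copy of Suc n.\<close>
    moreover have "r \<le> lift t (Suc n + \<Lambda>) - lift t (Suc n + j)"
      using j by (intro lift_diff_ge gaps) simp
    then have "?b \<le> real \<Lambda> - r"
      unfolding lift_add by simp
    ultimately have "\<kappa> * (?b - ?a) \<le> g ?b - g ?a"
      by (intro mono)
    moreover have "0 \<le> \<kappa> * (?b - ?a)"
      using \<kappa> \<open>?a \<le> ?b\<close> by simp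
    ultimately show ?thesis by linarith
  qed simp
qed

lemma gap_DERIV:
  assumes "0 \<le> t"
  shows "((\<lambda>t. gap t n) has_real_derivative (\<Sum>j<\<Lambda>. g (lift t (Suc n + j) - lift t (Suc n)))
    - (\<Sum>j<\<Lambda>. g (lift t (n + j) - lift t n))) (at t within {0..})"
  unfolding gap_def by (intro DERIV_diff lift_DERIV assms)

text \<open>The smallest gap cannot decrease, since the forces on both sides of it are ordered by the
  monotonicity of \<open>g\<close>.  The slack \<open>\<eta> (1 + t)\<close> makes the first contact argument strict.\<close>

lemma gap_ge:
  assumes init: "\<And>n. r < gap 0 n" and T: "0 \<le> T"
  shows "r \<le> gap T n"
proof -
  define m where "m = Min (gap 0 ` {..<\<Lambda>})"
  have m_le: "m \<le> gap 0 k" if "k < \<Lambda>" for k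
    unfolding m_def using that by (intro Min_le) auto
  have "m \<in> gap 0 ` {..<\<Lambda>}"
    unfolding m_def using \<Lambda> by (intro Min_in) (auto simp: lessThan_empty_iff)
  then have m: "r < m" using init by auto
  \<comment> \<open>Chosen so that the sinking threshold \<open>m - \<eta> * (1 + t)\<close> reaches
    r exactly at t = T, which keeps the monotonicity of g available up to then.\<close>
  define \<eta> where "\<eta> = (m - r) / (1 + T)"
  have \<eta>: "0 < \<eta>" and \<eta>_le: "t \<le> T \<Longrightarrow> r \<le> m - \<eta> * (1 + t)" for t
  proof -
    show "0 < \<eta>" using m T by (simp add: \<eta>_def)
    assume "t \<le> T"
    then have "\<eta> * (1 + t) \<le> \<eta> * (1 + T)"
      using \<open>0 < \<eta>\<close> by (intro mult_left_mono) auto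
    also have "\<dots> = m - r" using T by (simp add: \<eta>_def)
    finally show "r \<le> m - \<eta> * (1 + t)" by simp
  qed
  define f where "f k t = gap t k - m + \<eta> * (1 + t)" for k t
  have f_DERIV: "(f k has_real_derivative (\<Sum>j<\<Lambda>. g (lift t (Suc k + j) - lift t (Suc k)))
    - (\<Sum>j<\<Lambda>. g (lift t (k + j) - lift t k)) + \<eta>) (at t within {0..})" if "0 \<le> t" for k t
    unfolding f_def by (rule derivative_eq_intros gap_DERIV that refl | simp)+
  have f_cont: "continuous_on {0..T'} (f k)" for k T'
    by (rule continuous_on_subset [of "{0..}"], rule DERIV_continuous_on [OF f_DERIV]) auto
  define S where "S = (\<Union>k<\<Lambda>. {t \<in> {0..T}. f k t \<le> 0})"
  have "S = {}"
  proof (rule ccontr)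
    assume "S \<noteq> {}"
    have "closed S"
      unfolding S_def by (intro closed_UN finite_lessThan ballI continuous_on_closed_Collect_le f_cont continuous_on_const) auto
    moreover have bdd: "bdd_below S"
      by (rule bdd_belowI [of _ 0]) (auto simp: S_def)
    ultimately have "Inf S \<in> S"
      using \<open>S \<noteq> {}\<close> by (intro closed_contains_Inf)
    define t where "t = Inf S"
    have t_min: "u \<in> S \<Longrightarrow> t \<le> u" for u
      unfolding t_def using bdd by (intro cInf_lower)
    obtain k where k: "k < \<Lambda>" "f k t \<le> 0" and t: "0 \<le> t" "t \<le> T"
      using \<open>Inf S \<in> S\<close> by (auto simp: t_def S_def)
    have f_0: "0 < f i 0" if "i < \<Lambda>" for i
      using m_le [OF that] \<eta> by (simp add: f_def)
    \<comment> \<open>By continuity a negative value at t would force a zero no later than t;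
      minimality of t places this zero at t itself, a contradiction.\<close>
    have f_nonneg: "0 \<le> f i t" if i: "i < \<Lambda>" for i
    proof (rule ccontr)
      assume neg: "\<not> 0 \<le> f i t"
      then obtain u where "0 \<le> u" "u \<le> t" "f i u = 0"
        using IVT2' [of "f i" t 0 0] f_0 [OF i] t f_cont by auto
      moreover from this have "t \<le> u"
        using t i by (intro t_min) (auto simp: S_def intro!: bexI [of _ i])
      ultimately show False using neg by simp
    qed
    have "f k t = 0" using k f_nonneg by force
    then have gap_k: "gap t k = m - \<eta> * (1 + t)" by (simp add: f_def)
    have gap_min: "gap t k \<le> gap t i" for i
      using f_nonneg [of "i mod \<Lambda>"] \<Lambda> gap_k by (simp add: f_def gap_mod)
    have gaps: "r \<le> gap t i" for i
      using \<eta>_le [OF t(2)] gap_k gap_min [of i] by linarith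
    have "0 < t"
      using f_0 [OF k(1)] \<open>f k t = 0\<close> t by (cases "t = 0") auto
    \<comment> \<open>At the first contact the derivative is at least \<eta> > 0, so f k was already
      negative shortly before, against minimality of t.\<close>
    from has_real_derivative_pos_inc_left [OF f_DERIV [OF t(1), of k]] obtain d where
      d: "0 < d" "\<And>h. 0 < h \<Longrightarrow> t - h \<in> {0..} \<Longrightarrow> h < d \<Longrightarrow> f k (t - h) < f k t"
      using gap_derivative_nonneg [OF gaps gap_min] \<eta> by force
    define h where "h = min (d / 2) t"
    have h: "0 < h" "h < d" "h \<le> t"
      using d(1) \<open>0 < t\<close> by (auto simp: h_def)
    then have "f k (t - h) < 0"
      using d(2) [of h] \<open>f k t = 0\<close> by simp
    then have "t - h \<in> S"
      using h t k(1) by (auto simp: S_def intro!: bexI [of _ k])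
    from t_min [OF this] h show False by simp
  qed
  moreover have "T \<in> S" if "f (n mod \<Lambda>) T \<le> 0"
    using that T \<Lambda> by (auto simp: S_def intro!: bexI [of _ "n mod \<Lambda>"])
  ultimately have "0 < f (n mod \<Lambda>) T"
    by force
  then show ?thesis
    using \<eta>_le [of T] by (simp add: f_def gap_mod)
qed

lemma ordered_gaps:
  assumes "\<And>n. r < gap 0 n" "0 \<le> t" "i < j" "j < \<Lambda>"
  shows "r \<le> x t j - x t i" "x t j - x t i \<le> real \<Lambda> - r"
proof -
  have gaps: "r \<le> gap t n" for n
    using gap_ge assms by blast
  show "r \<le> x t j - x t i"
    using lift_diff_ge [OF gaps, of i j] assms by (simp add: lift_def)
  have "r \<le> lift t (i + \<Lambda>) - lift t j"
    using assms by (intro lift_diff_ge gaps) simp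
  then show "x t j - x t i \<le> real \<Lambda> - r"
    unfolding lift_add using assms by (simp add: lift_def)
qed

section \<open>Conservation of the mean and exponential decay\<close>

lemma mono_square:
  assumes "r \<le> a" "a \<le> real \<Lambda> - r" "r \<le> b" "b \<le> real \<Lambda> - r"
  shows "\<kappa> * (a - b)\<^sup>2 \<le> (g a - g b) * (a - b)"
proof (cases "a \<le> b")
  case True
  then have "\<kappa> * (b - a) * (b - a) \<le> (g b - g a) * (b - a)"
    using mono [of a b] assms by (intro mult_right_mono) auto
  then show ?thesis by (simp add: power2_eq_square algebra_simps)
next
  case False
  then have "\<kappa> * (a - b) * (a - b) \<le> (g a - g b) * (a - b)"
    using mono [of b a] assms by (intro mult_right_mono) auto
  then show ?thesis by (simp add: power2_eq_square algebra_simps)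
qed

lemma sum_conserved:
  assumes "0 \<le> t"
  shows "(\<Sum>i<\<Lambda>. x t i) = (\<Sum>i<\<Lambda>. x 0 i)"
proof -
  have "((\<lambda>t. \<Sum>i<\<Lambda>. x t i) has_real_derivative 0) (at t within {0..})" if "0 \<le> t" for t
  proof -
    have "2 * (\<Sum>i<\<Lambda>. \<Sum>j<\<Lambda>. g (x t i - x t j) * 1) = (\<Sum>i<\<Lambda>. \<Sum>j<\<Lambda>. g (x t i - x t j) * (1 - 1))"
    proof (rule sum_antisymmetric)
      show "g (x t j - x t i) = - g (x t i - x t j)" for i j
        using odd [of "x t i - x t j"] by simp
    qed
    then have "(\<Sum>i<\<Lambda>. - (\<Sum>j<\<Lambda>. g (x t i - x t j))) = 0"
      by (simp add: sum_negf)
    moreover have "((\<lambda>t. \<Sum>i<\<Lambda>. x t i) has_real_derivative (\<Sum>i<\<Lambda>. - (\<Sum>j<\<Lambda>. g (x t i - x t j)))) (at t within {0..})"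
      using that by (intro DERIV_sum ode) auto
    ultimately show ?thesis by simp
  qed
  then obtain c where "\<And>t. 0 \<le> t \<Longrightarrow> (\<Sum>i<\<Lambda>. x t i) = c"
    using has_field_derivative_zero_constant [of "{0..}" "\<lambda>t. \<Sum>i<\<Lambda>. x t i"] by auto
  then show ?thesis using assms by simp
qed

text \<open>All lattice points feel the same force, so it vanishes when tested against a
  displacement of mean zero and may be subtracted. The dissipation becomes a sum over pairs of
  differences of g, at \<open>x t i - x t j\<close> and at i - j, and strong monotonicity applies to
  each pair.\<close>

lemma exponential_decay:
  assumes init: "\<And>n. r < gap 0 n" and bary: "(\<Sum>i<\<Lambda>. x 0 i) = (\<Sum>i<\<Lambda>. b + real i)" and t: "0 \<le> t"
  shows "(\<Sum>i<\<Lambda>. (x t i - (b + real i))\<^sup>2) \<le> (\<Sum>i<\<Lambda>. (x 0 i - (b + real i))\<^sup>2) * exp (- (2 * \<kappa> * real \<Lambda>) * t)"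
proof -
  define d where "d t i = x t i - (b + real i)" for t i
  define D where "D t = (\<Sum>i<\<Lambda>. (d t i)\<^sup>2)" for t
  define D' where "D' t = (\<Sum>i<\<Lambda>. 2 * d t i * - (\<Sum>j<\<Lambda>. g (x t i - x t j)))" for t
  have d_sum: "(\<Sum>i<\<Lambda>. d u i) = 0" if "0 \<le> u" for u
    using sum_conserved [OF that] bary by (simp add: d_def sum_subtractf)
  have D_DERIV: "(D has_real_derivative D' u) (at u within {0..})" if "0 \<le> u" for u
    unfolding D_def D'_def
  proof (rule DERIV_sum)
    fix i assume "i \<in> {..<\<Lambda>}"
    then have "((\<lambda>u. d u i) has_real_derivative - (\<Sum>j<\<Lambda>. g (x u i - x u j))) (at u within {0..})"
      unfolding d_def using DERIV_diff [OF ode [OF that, of i] DERIV_const] by simp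
    from DERIV_power [OF this, of 2]
    show "((\<lambda>u. (d u i)\<^sup>2) has_real_derivative 2 * d u i * - (\<Sum>j<\<Lambda>. g (x u i - x u j))) (at u within {0..})"
      by (simp add: mult_ac)
  qed
  have D'_le: "D' u \<le> - (2 * \<kappa> * real \<Lambda>) * D u" if u: "0 \<le> u" for u
  proof -
    define A where "A i j = g (x u i - x u j) - g (real i - real j)" for i j
    have A: "A j i = - A i j" for i j
      using odd [of "x u i - x u j"] odd [of "real i - real j"] by (simp add: A_def)
    \<comment> \<open>Independence of i is all that matters here: translating the lattice by i
      permutes the differences modulo \<Lambda>.\<close>
    have lattice: "(\<Sum>j<\<Lambda>. g (real i - real j)) = - (\<Sum>j<\<Lambda>. g (real j))" if i: "i < \<Lambda>" for i
    proof -
      have "g (real i - real j) = - g (real ((\<Lambda> - i + j) mod \<Lambda>))" for j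
      proof -
        have "real (\<Lambda> - i + j) = real j - real i + real \<Lambda>"
          using i by (simp add: of_nat_diff)
        moreover have "g (real k) = g (real (k mod \<Lambda>))" for k
          using per_nat [of "real (k mod \<Lambda>)" "k div \<Lambda>"]
          by (metis mod_mult_div_eq of_nat_add of_nat_mult)
        ultimately have "g (real ((\<Lambda> - i + j) mod \<Lambda>)) = g (real j - real i)"
          using per by metis
        then show ?thesis using odd [of "real j - real i"] by simp
      qed
      then show ?thesis
        using sum_shift_mod [where f = "\<lambda>k. - g (real k)" and m = "\<Lambda> - i" and n = \<Lambda>] by (simp add: sum_negf)
    qed
    have "(\<Sum>i<\<Lambda>. \<Sum>j<\<Lambda>. A i j * d u i) =
       (\<Sum>i<\<Lambda>. d u i * (\<Sum>j<\<Lambda>. g (x u i - x u j))) - (\<Sum>i<\<Lambda>. d u i * (\<Sum>j<\<Lambda>. g (real i - real j)))"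
      by (simp add: A_def left_diff_distrib right_diff_distrib sum_subtractf sum_distrib_left mult.commute)
    also have "(\<Sum>i<\<Lambda>. d u i * (\<Sum>j<\<Lambda>. g (real i - real j))) = 0"
      using d_sum [OF u] by (simp add: lattice sum_negf flip: sum_distrib_right)
    finally have "D' u = - (2 * (\<Sum>i<\<Lambda>. \<Sum>j<\<Lambda>. A i j * d u i))"
      by (simp add: D'_def sum_distrib_left sum_negf mult.assoc)
    also have "\<dots> = - (\<Sum>i<\<Lambda>. \<Sum>j<\<Lambda>. A i j * (d u i - d u j))"
      by (subst sum_antisymmetric [OF A]) (rule refl)
    also have "\<dots> \<le> - (\<Sum>i<\<Lambda>. \<Sum>j<\<Lambda>. \<kappa> * (d u i - d u j)\<^sup>2)"
    proof -
      have lower: "\<kappa> * (d u j - d u i)\<^sup>2 \<le> A j i * (d u j - d u i)" if ij: "i < j" "j < \<Lambda>" for i j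
      proof -
        have "\<kappa> * ((x u j - x u i) - (real j - real i))\<^sup>2 \<le> A j i * ((x u j - x u i) - (real j - real i))"
          unfolding A_def using ordered_gaps [OF init u ij] ij r by (intro mono_square) auto
        then show ?thesis by (simp add: d_def algebra_simps)
      qed
      have "\<kappa> * (d u i - d u j)\<^sup>2 \<le> A i j * (d u i - d u j)" if "i < \<Lambda>" "j < \<Lambda>" for i j
      proof (cases i j rule: linorder_cases)
        case less
        then show ?thesis
          using lower [of i j] that A [of i j] by (simp add: power2_commute [of "d u i"] algebra_simps)
      qed (use lower [of j i] that in auto)
      then show ?thesis
        unfolding neg_le_iff_le by (intro sum_mono) auto
    qed
    also have "\<dots> = - (2 * \<kappa> * real \<Lambda>) * D u"
      using sum_square_diff [OF d_sum [OF u]] by (simp add: D_def flip: sum_distrib_left)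
    finally show ?thesis .
  qed
  let ?l = "2 * \<kappa> * real \<Lambda>"
  have "D t * exp (?l * t) \<le> D 0 * exp (?l * 0)"
  proof -
    have der: "((\<lambda>u. D u * exp (?l * u)) has_real_derivative (D' u + ?l * D u) * exp (?l * u)) (at u within {0..})"
      if "0 \<le> u" for u
      by (rule derivative_eq_intros D_DERIV that refl | simp add: algebra_simps)+
    show ?thesis
    proof (rule DERIV_nonpos_imp_decreasing_open [where f = "\<lambda>u. D u * exp (?l * u)"])
      show "0 \<le> t" by (rule t)
      show "continuous_on {0..t} (\<lambda>u. D u * exp (?l * u))"
        by (rule continuous_on_subset [of "{0..}"], rule DERIV_continuous_on [OF der]) auto
      fix u assume "0 < u" "u < t"
      then have "at u within {0..} = at u"
        by (intro at_within_interior) (simp add: interior_real_atLeast)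
      moreover have "(D' u + ?l * D u) * exp (?l * u) \<le> 0"
        using D'_le [of u] \<open>0 < u\<close> by (intro mult_nonpos_nonneg) auto
      ultimately show "\<exists>y. ((\<lambda>u. D u * exp (?l * u)) has_real_derivative y) (at u) \<and> y \<le> 0"
        using der [of u] \<open>0 < u\<close> by auto
    qed
  qed
  then show ?thesis
    by (simp add: D_def d_def exp_minus field_simps)
qed

end

section \<open>The distance to a lattice configuration\<close>

lemma per_abs_le: "per_abs \<Lambda> t \<le> \<bar>t + real \<Lambda> * of_int z\<bar>"
  unfolding per_abs_def by (rule cINF_lower) (auto intro: bdd_belowI [of _ 0])

lemma per_abs_attained:
  assumes "\<Lambda> \<ge> 1"
  obtains z :: int where "per_abs \<Lambda> t = \<bar>t + real \<Lambda> * of_int z\<bar>"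
proof -
  \<comment> \<open>The nearest multiple of \<Lambda> to t attains the infimum.\<close>
  let ?z = "- round (t / real \<Lambda>)"
  have "\<bar>t + real \<Lambda> * of_int ?z\<bar> \<le> \<bar>t + real \<Lambda> * of_int z\<bar>" for z :: int
  proof -
    have "real \<Lambda> * \<bar>t / real \<Lambda> - of_int (round (t / real \<Lambda>))\<bar> \<le> real \<Lambda> * \<bar>t / real \<Lambda> - of_int (- z)\<bar>"
      by (intro mult_left_mono round_diff_minimal) simp
    moreover have "real \<Lambda> * \<bar>t / real \<Lambda> - of_int c\<bar> = \<bar>t + real \<Lambda> * of_int (- c)\<bar>" for c
    proof -
      have "real \<Lambda> * \<bar>t / real \<Lambda> - of_int c\<bar> = \<bar>real \<Lambda> * (t / real \<Lambda> - of_int c)\<bar>"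
        by (simp add: abs_mult)
      then show ?thesis using assms by (simp add: right_diff_distrib)
    qed
    ultimately show ?thesis by (metis minus_minus)
  qed
  then have "\<bar>t + real \<Lambda> * of_int ?z\<bar> \<le> per_abs \<Lambda> t"
    unfolding per_abs_def by (intro cINF_greatest) auto
  with per_abs_le [of \<Lambda> t ?z] show ?thesis
    by (intro that [of ?z]) simp
qed

lemma ordered_eq:
  assumes f: "\<And>i j. i < j \<Longrightarrow> j < \<Lambda> \<Longrightarrow> f i < f j"
    and image: "X ` {..<\<Lambda>} = f ` {..<\<Lambda>}" and i: "i < \<Lambda>"
  shows "ordered \<Lambda> X i = f i"
proof -
  have inj_f: "inj_on f {..<\<Lambda>}"
    by (rule linorder_inj_onI) (use f in fastforce)+
  have "card (X ` {..<\<Lambda>}) = card {..<\<Lambda>}"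
    unfolding image using inj_f by (rule card_image)
  then have inj_X: "inj_on X {..<\<Lambda>}"
    by (intro eq_card_imp_inj_on) auto
  have sorted: "sorted (map f [0..<\<Lambda>])"
    unfolding sorted_iff_nth_mono by (auto simp: le_less intro: f)
  have "sort (map X [0..<\<Lambda>]) = map f [0..<\<Lambda>]"
    using inj_f inj_X image sorted
    by (intro sorted_distinct_set_unique) (auto simp: distinct_map atLeast0LessThan)
  then show ?thesis
    using i by (simp add: ordered_def)
qed

lemma sum_sgn_diff:
  "(\<Sum>j<n. sgn (real i - real j)) = (if i < n then 2 * real i + 1 - real n else real n)"
proof (induction n)
  case (Suc n)
  then show ?case by (cases i n rule: linorder_cases) (auto simp: sgn_if)
qed simp

text \<open>Up to a factor, the difference of the two costs is the sum of \<open>T i j\<close> over all pairs.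
  As the winding differences are integers and \<open>a\<close> increases by at most \<open>\<Lambda>\<close>, \<open>T i j\<close> is at least
  \<open>(z i - z j) * B i j\<close>, and these lower bounds cancel in the sum because the rows of \<open>B\<close> sum to \<open>0\<close>.\<close>

lemma cyclic_assignment_cost:
  fixes a :: "nat \<Rightarrow> real" and z :: "nat \<Rightarrow> int"
  assumes a_mono: "\<And>i j. i < j \<Longrightarrow> j < \<Lambda> \<Longrightarrow> a i \<le> a j \<and> a j - a i \<le> real \<Lambda>" and \<Lambda>: "1 \<le> \<Lambda>"
  shows "(\<Sum>i<\<Lambda>. (a i - real i - c - of_int (\<Sum>i<\<Lambda>. z i))\<^sup>2)
    \<le> (\<Sum>i<\<Lambda>. (a i - real i - c - real \<Lambda> * of_int (z i))\<^sup>2)"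
proof -
  define L where "L = real \<Lambda>"
  define Z where "Z = real_of_int (\<Sum>i<\<Lambda>. z i)"
  define f where "f i = a i - real i - c" for i
  define y where "y i = real_of_int (z i)" for i
  \<comment> \<open>The deviation of the individual displacement \<open>L * y i\<close> from the
    average displacement Z.\<close>
  define w where "w i = L * y i - Z" for i
  have L: "0 < L" using \<Lambda> by (simp add: L_def)
  have Z: "Z = (\<Sum>i<\<Lambda>. y i)" by (simp add: Z_def y_def)
  have w_sum: "(\<Sum>i<\<Lambda>. w i) = 0"
    by (simp add: w_def sum_subtractf Z L_def flip: sum_distrib_left)
  define B where "B i j = 2 * (real i - real j) - L * sgn (real i - real j)" for i j
  define T where "T i j = (y i - y j) * (L * (y i - y j) - 2 * (f i - f j))" for i j
  have T_ge: "(y i - y j) * B i j \<le> T i j" if ij: "i < \<Lambda>" "j < \<Lambda>" for i j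
  proof -
    have *: "(y i - y j) * B i j \<le> T i j" if ij: "j < i" "i < \<Lambda>" for i j
    proof -
      define k where "k = z i - z j"
      have k: "y i - y j = of_int k" by (simp add: y_def k_def)
      have d: "0 \<le> a i - a j" "a i - a j \<le> L"
        using a_mono [OF ij] by (auto simp: L_def)
      \<comment> \<open>Integrality enters here: for k at most 0 use
        \<open>0 \<le> a i - a j\<close> and k (k + 1) nonnegative, for k at least 1 use
        \<open>a i - a j \<le> L\<close> and k (k - 1) nonnegative.\<close>
      have "- (of_int k * L) \<le> of_int k * (L * of_int k - 2 * (a i - a j))"
      proof (cases "k \<le> 0")
        case True
        then have "of_int k * (2 * (a i - a j)) \<le> 0"
          using d by (intro mult_nonpos_nonneg) auto
        moreover have "0 \<le> L * (of_int k * (of_int k + 1))"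
        proof (cases "k = 0")
          case False
          then have "of_int k + (1::real) \<le> 0" using True by linarith
          then show ?thesis using True L by (intro mult_nonneg_nonneg mult_nonpos_nonpos) auto
        qed simp
        ultimately show ?thesis by (simp add: algebra_simps)
      next
        case False
        then have "of_int k * (a i - a j) \<le> of_int k * L"
          using d by (intro mult_left_mono) auto
        moreover have "0 \<le> L * (of_int k * (of_int k - 1))"
          using False L by (intro mult_nonneg_nonneg) auto
        ultimately show ?thesis by (simp add: algebra_simps)
      qed
      then show ?thesis
        using ij by (simp add: T_def B_def k f_def algebra_simps)
    qed
    have "T j i = T i j" "(y j - y i) * B j i = (y i - y j) * B i j"
      by (simp_all add: T_def B_def sgn_if algebra_simps)
    then show ?thesis
      using * [of j i] * [of i j] ij by (cases i j rule: linorder_cases) (auto simp: T_def)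
  qed
  have B_sum: "(\<Sum>j<\<Lambda>. B i j) = 0" if i: "i < \<Lambda>" for i
  proof -
    have "(\<Sum>j<\<Lambda>. real j) = L * (L - 1) / 2"
      unfolding L_def by (induction \<Lambda>) (auto simp: field_simps)
    then show ?thesis
      using i sum_sgn_diff [of i \<Lambda>]
      by (simp add: B_def sum_subtractf sum_distrib_left [symmetric] L_def [symmetric])
        (simp add: algebra_simps)
  qed
  have "0 = 2 * (\<Sum>i<\<Lambda>. \<Sum>j<\<Lambda>. B i j * y i)"
    using B_sum by (simp flip: sum_distrib_right)
  also have "\<dots> = (\<Sum>i<\<Lambda>. \<Sum>j<\<Lambda>. B i j * (y i - y j))"
    by (rule sum_antisymmetric) (simp add: B_def sgn_if algebra_simps)
  also have "\<dots> \<le> (\<Sum>i<\<Lambda>. \<Sum>j<\<Lambda>. T i j)"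
    using T_ge by (intro sum_mono) (simp add: mult.commute)
  finally have T_nonneg: "0 \<le> (\<Sum>i<\<Lambda>. \<Sum>j<\<Lambda>. T i j)" .
  have "L * (\<Sum>i<\<Lambda>. \<Sum>j<\<Lambda>. T i j) = (\<Sum>i<\<Lambda>. \<Sum>j<\<Lambda>. (w i - w j) * ((w i - 2 * f i) - (w j - 2 * f j)))"
    by (simp add: T_def w_def sum_distrib_left algebra_simps)
  also have "\<dots> = 2 * (\<Sum>i<\<Lambda>. \<Sum>j<\<Lambda>. (w i - w j) * (w i - 2 * f i))"
    by (rule sum_antisymmetric [symmetric]) simp
  also have "\<dots> = 2 * (\<Sum>i<\<Lambda>. L * w i * (w i - 2 * f i) - (\<Sum>j<\<Lambda>. w j) * (w i - 2 * f i))"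
    by (simp add: left_diff_distrib sum_subtractf sum_distrib_right L_def mult.assoc)
  also have "\<dots> = 2 * L * (\<Sum>i<\<Lambda>. w i * (w i - 2 * f i))"
    by (simp add: w_sum sum_distrib_left mult.assoc)
  \<comment> \<open>Adding a multiple of the zero sum of w recentres f at Z, so that each term
    becomes a difference of two squares.\<close>
  also have "(\<Sum>i<\<Lambda>. w i * (w i - 2 * f i)) = (\<Sum>i<\<Lambda>. w i * (w i - 2 * f i)) + 2 * Z * (\<Sum>i<\<Lambda>. w i)"
    using w_sum by simp
  also have "\<dots> = (\<Sum>i<\<Lambda>. (f i - L * y i)\<^sup>2 - (f i - Z)\<^sup>2)"
    unfolding sum_distrib_left sum.distrib [symmetric]
    by (intro sum.cong refl) (simp add: w_def power2_eq_square algebra_simps)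
  finally have "L * (\<Sum>i<\<Lambda>. \<Sum>j<\<Lambda>. T i j) = 2 * L * (\<Sum>i<\<Lambda>. (f i - L * y i)\<^sup>2 - (f i - Z)\<^sup>2)" .
  then have "0 \<le> (\<Sum>i<\<Lambda>. (f i - L * y i)\<^sup>2 - (f i - Z)\<^sup>2)"
    using T_nonneg L by simp
  then show ?thesis
    by (simp add: sum_subtractf f_def L_def y_def Z_def)
qed

lemma sum_square_mean_minimal:
  fixes e :: "nat \<Rightarrow> real"
  assumes "(\<Sum>i<n. e i) = real n * q"
  shows "(\<Sum>i<n. (e i - q)\<^sup>2) \<le> (\<Sum>i<n. (e i - p)\<^sup>2)"
proof -
  have "(\<Sum>i<n. (e i - p)\<^sup>2) = (\<Sum>i<n. (e i - q)\<^sup>2 + 2 * (q - p) * (e i - q) + (q - p)\<^sup>2)"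
    by (intro sum.cong refl) (simp add: power2_eq_square algebra_simps)
  also have "\<dots> = (\<Sum>i<n. (e i - q)\<^sup>2) + 2 * (q - p) * ((\<Sum>i<n. e i) - real n * q) + real n * (q - p)\<^sup>2"
    by (simp add: sum.distrib sum_subtractf flip: sum_distrib_left)
  finally show ?thesis using assms by simp
qed

text \<open>For a fixed cyclic shift, the best representatives give each particle its own winding.
  \<open>cyclic_assignment_cost\<close> replaces these by one common translation at no greater cost,
  and among common translations the one matching the mean is cheapest.\<close>

lemma conf_dist_lattice_ge:
  assumes \<Lambda>: "1 \<le> \<Lambda>"
    and a: "\<And>i j. i < j \<Longrightarrow> j < \<Lambda> \<Longrightarrow> a i < a j \<and> a j - a i < real \<Lambda>"
    and X: "\<And>i. i < \<Lambda> \<Longrightarrow> ordered \<Lambda> X i = a i" and Y: "\<And>i. i < \<Lambda> \<Longrightarrow> ordered \<Lambda> Y i = \<tau> + real i"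
    and bary: "(\<Sum>i<\<Lambda>. a i) = (\<Sum>i<\<Lambda>. b + real i)"
  shows "sqrt (\<Sum>i<\<Lambda>. (a i - (b + real i))\<^sup>2) \<le> conf_dist \<Lambda> X Y"
proof -
  have "sqrt (\<Sum>i<\<Lambda>. (a i - (b + real i))\<^sup>2)
    \<le> sqrt (\<Sum>i<\<Lambda>. (per_abs \<Lambda> (ordered \<Lambda> X i - ordered \<Lambda> Y ((i + k) mod \<Lambda>)))\<^sup>2)" for k
  proof (rule real_sqrt_le_mono)
    have "\<exists>z::int. per_abs \<Lambda> (ordered \<Lambda> X i - ordered \<Lambda> Y ((i + k) mod \<Lambda>)) =
        \<bar>a i - real i - (\<tau> + real k) - real \<Lambda> * of_int z\<bar>" if i: "i < \<Lambda>" for i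
    proof -
      obtain z :: int where z: "per_abs \<Lambda> (a i - (\<tau> + real ((i + k) mod \<Lambda>))) =
          \<bar>a i - (\<tau> + real ((i + k) mod \<Lambda>)) + real \<Lambda> * of_int z\<bar>"
        using per_abs_attained [OF \<Lambda>] by blast
      \<comment> \<open>The wrap-around of the label i + k is a multiple of \<Lambda> and can be
        counted as part of the winding.\<close>
      have "real ((i + k) mod \<Lambda>) = real i + real k - real \<Lambda> * real ((i + k) div \<Lambda>)"
        by (simp add: minus_mult_div_eq_mod [symmetric] of_nat_diff)
      then have "a i - (\<tau> + real ((i + k) mod \<Lambda>)) + real \<Lambda> * of_int z
         = a i - real i - (\<tau> + real k) - real \<Lambda> * of_int (- z - int ((i + k) div \<Lambda>))"
        by (simp add: algebra_simps)
      then show ?thesis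
        using z X [OF i] Y [of "(i + k) mod \<Lambda>"] \<Lambda> by (metis mod_less_divisor less_le_trans zero_less_one)
    qed
    then obtain z :: "nat \<Rightarrow> int" where z: "\<And>i. i < \<Lambda> \<Longrightarrow> per_abs \<Lambda> (ordered \<Lambda> X i - ordered \<Lambda> Y ((i + k) mod \<Lambda>)) =
        \<bar>a i - real i - (\<tau> + real k) - real \<Lambda> * of_int (z i)\<bar>"
      by metis
    have "(\<Sum>i<\<Lambda>. (a i - real i - b)\<^sup>2) \<le> (\<Sum>i<\<Lambda>. (a i - real i - (\<tau> + real k + of_int (\<Sum>i<\<Lambda>. z i)))\<^sup>2)"
      by (rule sum_square_mean_minimal) (use bary in \<open>simp add: sum_subtractf sum.distrib\<close>)
    also have "\<dots> \<le> (\<Sum>i<\<Lambda>. (a i - real i - (\<tau> + real k) - real \<Lambda> * of_int (z i))\<^sup>2)"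
      using cyclic_assignment_cost [of \<Lambda> a "\<tau> + real k" z] a \<Lambda> by (simp add: less_imp_le algebra_simps)
    also have "\<dots> = (\<Sum>i<\<Lambda>. (per_abs \<Lambda> (ordered \<Lambda> X i - ordered \<Lambda> Y ((i + k) mod \<Lambda>)))\<^sup>2)"
      using z by simp
    finally show "(\<Sum>i<\<Lambda>. (a i - (b + real i))\<^sup>2)
      \<le> (\<Sum>i<\<Lambda>. (per_abs \<Lambda> (ordered \<Lambda> X i - ordered \<Lambda> Y ((i + k) mod \<Lambda>)))\<^sup>2)"
      by (simp add: algebra_simps)
  qed
  then show ?thesis
    unfolding conf_dist_def using \<Lambda> by (subst Min_ge_iff) (auto simp: lessThan_empty_iff)
qed

section \<open>Reduction of a configuration modulo the period\<close>

lemma periodic_extension_increasing: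
  assumes \<Lambda>: "1 \<le> \<Lambda>" and a: "\<And>i j. i < j \<Longrightarrow> j < \<Lambda> \<Longrightarrow> a i < a j \<and> a j - a i < real \<Lambda>"
  shows "a (n mod \<Lambda>) + real \<Lambda> * real (n div \<Lambda>) < a (Suc n mod \<Lambda>) + real \<Lambda> * real (Suc n div \<Lambda>)"
proof (cases "Suc (n mod \<Lambda>) = \<Lambda>")
  case True
  then have "Suc n mod \<Lambda> = 0" "Suc n div \<Lambda> = Suc (n div \<Lambda>)"
    by (simp_all add: mod_Suc div_Suc)
  \<comment> \<open>At the end of a period the comparison is with the next copy of a 0; this is
    where the spread below \<Lambda> enters.\<close>
  moreover have "a (n mod \<Lambda>) - a 0 < real \<Lambda>"
    using a [of 0 "n mod \<Lambda>"] True \<Lambda> by (cases "n mod \<Lambda> = 0") auto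
  ultimately show ?thesis by (simp add: algebra_simps)
next
  case False
  moreover from this have "Suc (n mod \<Lambda>) < \<Lambda>"
    using \<Lambda> mod_less_divisor [of \<Lambda> n] by linarith
  ultimately show ?thesis
    using a [of "n mod \<Lambda>" "Suc (n mod \<Lambda>)"] by (simp add: mod_Suc div_Suc)
qed

text \<open>Reduction selects \<Lambda> consecutive points of the periodic extension, those in a
  window of length \<Lambda> starting at a multiple of \<Lambda>. The sorted order is therefore the
  old order rotated by the index p of the first point in the window.\<close>

lemma reduce_increasing:
  assumes \<Lambda>: "1 \<le> \<Lambda>" and \<pi>: "bij_betw \<pi> {..<\<Lambda>} {..<\<Lambda>}"
    and a: "\<And>i j. i < j \<Longrightarrow> j < \<Lambda> \<Longrightarrow> X (\<pi> i) < X (\<pi> j) \<and> X (\<pi> j) - X (\<pi> i) < real \<Lambda>"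
  shows "reduce \<Lambda> X \<in> R_conf \<Lambda>"
    and "\<exists>p. \<forall>i<\<Lambda>. \<exists>u::int. ordered \<Lambda> (reduce \<Lambda> X) i = X (\<pi> ((p + i) mod \<Lambda>)) + real \<Lambda> * of_int u"
proof -
  define a where "a i = X (\<pi> i)" for i
  define l where "l n = a (n mod \<Lambda>) + real \<Lambda> * real (n div \<Lambda>)" for n
  have l_Suc: "l n < l (Suc n)" for n
    unfolding l_def by (rule periodic_extension_increasing [OF \<Lambda>]) (use a in \<open>auto simp: a_def\<close>)
  have l_mono: "strict_mono l"
    using l_Suc by (simp add: strict_mono_Suc_iff)
  have l_add: "l (n + \<Lambda>) = l n + real \<Lambda>" for n
    using \<Lambda> by (simp add: l_def algebra_simps)
  \<comment> \<open>The first multiple of \<Lambda> strictly above l 0; strictness makes p positive,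
    so that p - 1 is the last point below the window.\<close>
  define Q where "Q = real \<Lambda> * of_int (\<lfloor>a 0 / real \<Lambda>\<rfloor> + 1)"
  have Q: "l 0 < Q" "Q \<le> l \<Lambda>"
  proof -
    have "a 0 / real \<Lambda> < of_int (\<lfloor>a 0 / real \<Lambda>\<rfloor> + 1)" "of_int (\<lfloor>a 0 / real \<Lambda>\<rfloor> + 1) \<le> a 0 / real \<Lambda> + 1"
      by linarith+
    then show "l 0 < Q" "Q \<le> l \<Lambda>"
      using \<Lambda> by (simp_all add: l_def Q_def field_simps)
  qed
  define p where "p = (LEAST n. Q \<le> l n)"
  have p: "Q \<le> l p"
    unfolding p_def using Q(2) by (rule LeastI)
  have p_pos: "0 < p"
    using p Q(1) by (cases p) auto
  then have p': "l (p - 1) < Q"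
    using not_less_Least [of "p - 1" "\<lambda>n. Q \<le> l n"] by (simp add: p_def [symmetric])
  define f where "f i = l (p + i) - Q" for i
  have f_mono: "f i < f j" if "i < j" for i j
    using that l_mono by (simp add: f_def strict_mono_less)
  have f_range: "f i \<in> {0..<real \<Lambda>}" if "i < \<Lambda>" for i
  proof -
    have "l p \<le> l (p + i)" "l (p + i) \<le> l (p - 1 + \<Lambda>)"
      using that l_mono p_pos by (simp_all add: strict_mono_less_eq)
    then show ?thesis
      using p p' by (simp add: f_def l_add)
  qed
  have f_eq: "\<exists>u::int. f i = X (\<pi> ((p + i) mod \<Lambda>)) + real \<Lambda> * of_int u" for i
    by (rule exI [of _ "int ((p + i) div \<Lambda>) - (\<lfloor>a 0 / real \<Lambda>\<rfloor> + 1)"])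
      (simp add: f_def l_def Q_def a_def algebra_simps)
  have f_reduce: "f i = reduce \<Lambda> X (\<pi> ((p + i) mod \<Lambda>))" if i: "i < \<Lambda>" for i
  proof -
    obtain u :: int where u: "f i = X (\<pi> ((p + i) mod \<Lambda>)) + real \<Lambda> * of_int u"
      using f_eq by blast
    have "\<pi> ((p + i) mod \<Lambda>) < \<Lambda>"
      using bij_betwE [OF \<pi>] \<Lambda> by simp
    moreover have "X (\<pi> ((p + i) mod \<Lambda>)) rmod real \<Lambda> = f i"
      using f_range [OF i] u by (intro rmod_unique [of _ _ _ "- u"]) (auto simp: algebra_simps)
    ultimately show ?thesis by (simp add: reduce_def)
  qed
  have f_inj: "inj_on f {..<\<Lambda>}"
    by (rule linorder_inj_onI) (use f_mono in fastforce)+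
  have "f ` {..<\<Lambda>} \<subseteq> reduce \<Lambda> X ` {..<\<Lambda>}"
  proof safe
    fix i assume "i < \<Lambda>"
    moreover have "\<pi> ((p + i) mod \<Lambda>) \<in> {..<\<Lambda>}"
      using bij_betwE [OF \<pi>] \<Lambda> by simp
    ultimately show "f i \<in> reduce \<Lambda> X ` {..<\<Lambda>}"
      using f_reduce by blast
  qed
  \<comment> \<open>Since f takes \<Lambda> distinct values and the reduced configuration at most
    \<Lambda>, the inclusion is an equality and the reduced particles are distinct.\<close>
  moreover have "card (reduce \<Lambda> X ` {..<\<Lambda>}) \<le> card (f ` {..<\<Lambda>})"
    using card_image_le [of "{..<\<Lambda>}" "reduce \<Lambda> X"] card_image [OF f_inj] by simp
  ultimately have image: "f ` {..<\<Lambda>} = reduce \<Lambda> X ` {..<\<Lambda>}"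
    by (intro card_seteq) auto
  have "card (reduce \<Lambda> X ` {..<\<Lambda>}) = card {..<\<Lambda>}"
    unfolding image [symmetric] using f_inj by (rule card_image)
  then have "inj_on (reduce \<Lambda> X) {..<\<Lambda>}"
    by (intro eq_card_imp_inj_on) auto
  moreover have "reduce \<Lambda> X \<in> X_conf \<Lambda>"
    using \<Lambda> by (auto simp: reduce_def X_conf_def rmod_nonneg rmod_less)
  ultimately show "reduce \<Lambda> X \<in> R_conf \<Lambda>"
    by (simp add: R_conf_def)
  have "ordered \<Lambda> (reduce \<Lambda> X) i = f i" if "i < \<Lambda>" for i
    using f_mono image that by (intro ordered_eq) auto
  then show "\<exists>p. \<forall>i<\<Lambda>. \<exists>u::int. ordered \<Lambda> (reduce \<Lambda> X) i = X (\<pi> ((p + i) mod \<Lambda>)) + real \<Lambda> * of_int u"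
    using f_eq by (intro exI [of _ p]) simp
qed

lemma conf_dist_lattice_le:
  assumes \<Lambda>: "1 \<le> \<Lambda>"
    and X: "\<And>i. i < \<Lambda> \<Longrightarrow> \<exists>u::int. ordered \<Lambda> X i = a ((p + i) mod \<Lambda>) + real \<Lambda> * of_int u"
    and Y: "\<And>i. i < \<Lambda> \<Longrightarrow> ordered \<Lambda> Y i = \<tau> + real i"
  shows "conf_dist \<Lambda> X Y \<le> sqrt (\<Sum>i<\<Lambda>. (a i - (\<tau> + of_int m + real i))\<^sup>2)"
proof -
  \<comment> \<open>The shift compensates both the rotation p of the labels caused by the reduction
    and the integer translation m of the lattice.\<close>
  define k where "k = nat ((int p + m) mod int \<Lambda>)"
  have k: "int k = (int p + m) mod int \<Lambda>"
    using \<Lambda> by (simp add: k_def)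
  have "int k < int \<Lambda>"
    unfolding k using \<Lambda> by simp
  then have "k < \<Lambda>" by simp
  then have "conf_dist \<Lambda> X Y
    \<le> sqrt (\<Sum>i<\<Lambda>. (per_abs \<Lambda> (ordered \<Lambda> X i - ordered \<Lambda> Y ((i + k) mod \<Lambda>)))\<^sup>2)"
    unfolding conf_dist_def by (intro Min_le) auto
  also have "\<dots> \<le> sqrt (\<Sum>i<\<Lambda>. (a ((p + i) mod \<Lambda>) - (\<tau> + of_int m + real ((p + i) mod \<Lambda>)))\<^sup>2)"
  proof (intro real_sqrt_le_mono sum_mono)
    fix i assume i: "i \<in> {..<\<Lambda>}"
    let ?j = "(p + i) mod \<Lambda>"
    obtain u :: int where u: "ordered \<Lambda> X i = a ?j + real \<Lambda> * of_int u"
      using X i by blast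
    have "int ((i + k) mod \<Lambda>) mod int \<Lambda> = (int ?j + m) mod int \<Lambda>"
      by (simp add: zmod_int k mod_simps add_ac)
    then obtain v where v: "int ((i + k) mod \<Lambda>) = int ?j + m + int \<Lambda> * v"
      by (metis add.commute diff_add_cancel dvdE mod_eq_dvd_iff)
    have "real ((i + k) mod \<Lambda>) = real ?j + of_int m + real \<Lambda> * of_int v"
      using arg_cong [OF v, of real_of_int] by simp
    moreover have "ordered \<Lambda> Y ((i + k) mod \<Lambda>) = \<tau> + real ((i + k) mod \<Lambda>)"
      using \<Lambda> by (intro Y) simp
    ultimately have "ordered \<Lambda> X i - ordered \<Lambda> Y ((i + k) mod \<Lambda>) + real \<Lambda> * of_int (v - u)
       = a ?j - (\<tau> + of_int m + real ?j)"
      by (simp add: u algebra_simps)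
    then have "per_abs \<Lambda> (ordered \<Lambda> X i - ordered \<Lambda> Y ((i + k) mod \<Lambda>)) \<le> \<bar>a ?j - (\<tau> + of_int m + real ?j)\<bar>"
      by (metis per_abs_le)
    moreover have "0 \<le> per_abs \<Lambda> t" for t
      by (metis per_abs_attained [OF \<Lambda>] abs_ge_zero)
    ultimately show "(per_abs \<Lambda> (ordered \<Lambda> X i - ordered \<Lambda> Y ((i + k) mod \<Lambda>)))\<^sup>2
        \<le> (a ?j - (\<tau> + of_int m + real ?j))\<^sup>2"
      by (metis power2_abs power_mono)
  qed
  also have "(\<Sum>i<\<Lambda>. (a ((p + i) mod \<Lambda>) - (\<tau> + of_int m + real ((p + i) mod \<Lambda>)))\<^sup>2)
     = (\<Sum>i<\<Lambda>. (a i - (\<tau> + of_int m + real i))\<^sup>2)"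
    by (rule sum_shift_mod)
  finally show ?thesis .
qed

section \<open>Lattice configurations with a given barycenter\<close>

text \<open>Scaling by the square root of \<Lambda> turns congruence of barycenters modulo sqrt
  \<Lambda> into congruence of the sums modulo \<Lambda>.\<close>

lemma barycenter_eq_iff:
  assumes \<Lambda>: "1 \<le> \<Lambda>"
  shows "barycenter \<Lambda> Y = barycenter \<Lambda> X \<longleftrightarrow> (\<exists>m::int. (\<Sum>i<\<Lambda>. X i) = (\<Sum>i<\<Lambda>. Y i) + real \<Lambda> * of_int m)"
proof -
  have "a / sqrt (real \<Lambda>) = b / sqrt (real \<Lambda>) + of_int m * sqrt (real \<Lambda>) \<longleftrightarrow> a = b + real \<Lambda> * of_int m" for a b and m :: int
    using \<Lambda> by (simp add: divide_simps mult.assoc) (simp add: mult.commute)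
  then show ?thesis
    using rcong_altdef [of "(\<Sum>i<\<Lambda>. Y i) / sqrt (real \<Lambda>)" "(\<Sum>i<\<Lambda>. X i) / sqrt (real \<Lambda>)" "sqrt (real \<Lambda>)"]
    by (simp add: barycenter_def rcong_def flip: sum_divide_distrib)
qed

lemma sum_lattice: "(\<Sum>k<\<Lambda>. real k + \<tau>) = real \<Lambda> * (\<tau> + (real \<Lambda> - 1) / 2)"
  by (induction \<Lambda>) (auto simp: field_simps)

lemma C_conf_sum:
  assumes "Y \<in> C_conf \<Lambda>"
  obtains \<tau> where "\<tau> \<in> {0..<1}" "Y ` {..<\<Lambda>} = (\<lambda>k. real k + \<tau>) ` {..<\<Lambda>}"
    "(\<Sum>i<\<Lambda>. Y i) = real \<Lambda> * (\<tau> + (real \<Lambda> - 1) / 2)"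
proof -
  from assms obtain \<tau> where \<tau>: "\<tau> \<in> {0..<1}" and image: "Y ` {..<\<Lambda>} = (\<lambda>k. real k + \<tau>) ` {..<\<Lambda>}"
    and inj: "inj_on Y {..<\<Lambda>}"
    by (auto simp: C_conf_def R_conf_def)
  have "(\<Sum>i<\<Lambda>. Y i) = \<Sum> (Y ` {..<\<Lambda>})"
    using inj by (simp add: sum.reindex)
  also have "\<dots> = (\<Sum>k<\<Lambda>. real k + \<tau>)"
    unfolding image by (simp add: sum.reindex inj_on_def)
  finally show ?thesis
    using \<tau> image by (intro that) (auto simp: sum_lattice)
qed

lemma lattice_configuration_exists:
  assumes \<Lambda>: "1 \<le> \<Lambda>"
  shows "\<exists>Y\<in>C_conf \<Lambda>. barycenter \<Lambda> Y = barycenter \<Lambda> X"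
proof -
  \<comment> \<open>The lattice t, t + 1, ... has the mean of X. Only the fractional part of t is
    kept; the integer part changes the sum by a multiple of \<Lambda>.\<close>
  define t where "t = (\<Sum>i<\<Lambda>. X i) / real \<Lambda> - (real \<Lambda> - 1) / 2"
  define Y where "Y = (\<lambda>k\<in>{..<\<Lambda>}. real k + frac t)"
  have frac: "0 \<le> frac t" "frac t < 1" by (auto simp: frac_lt_1)
  have "real k + frac t < real \<Lambda>" if "k < \<Lambda>" for k
    using that frac by linarith
  then have "Y \<in> C_conf \<Lambda>"
    using frac by (auto simp: C_conf_def R_conf_def X_conf_def Y_def inj_on_def intro!: bexI [of _ "frac t"])
  moreover have "(\<Sum>i<\<Lambda>. X i) = (\<Sum>i<\<Lambda>. Y i) + real \<Lambda> * of_int \<lfloor>t\<rfloor>"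
  proof -
    have "(\<Sum>i<\<Lambda>. Y i) = real \<Lambda> * (frac t + (real \<Lambda> - 1) / 2)"
      by (simp add: Y_def sum_lattice)
    moreover have "(\<Sum>i<\<Lambda>. X i) = real \<Lambda> * (t + (real \<Lambda> - 1) / 2)"
      using \<Lambda> by (simp add: t_def)
    ultimately show ?thesis
      by (simp add: frac_def algebra_simps)
  qed
  ultimately show ?thesis
    using barycenter_eq_iff [OF \<Lambda>] by blast
qed

lemma lattice_configuration_unique:
  assumes \<Lambda>: "1 \<le> \<Lambda>" and Y: "Y \<in> C_conf \<Lambda>" and Z: "Z \<in> C_conf \<Lambda>"
    and bary: "barycenter \<Lambda> Y = barycenter \<Lambda> Z"
  shows "\<exists>p. p permutes {..<\<Lambda>} \<and> Y = Z \<circ> p"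
proof -
  obtain \<tau> where \<tau>: "\<tau> \<in> {0..<1}" "Y ` {..<\<Lambda>} = (\<lambda>k. real k + \<tau>) ` {..<\<Lambda>}"
    "(\<Sum>i<\<Lambda>. Y i) = real \<Lambda> * (\<tau> + (real \<Lambda> - 1) / 2)"
    using C_conf_sum [OF Y] .
  obtain \<sigma> where \<sigma>: "\<sigma> \<in> {0..<1}" "Z ` {..<\<Lambda>} = (\<lambda>k. real k + \<sigma>) ` {..<\<Lambda>}"
    "(\<Sum>i<\<Lambda>. Z i) = real \<Lambda> * (\<sigma> + (real \<Lambda> - 1) / 2)"
    using C_conf_sum [OF Z] .
  obtain m :: int where "real \<Lambda> * (\<sigma> + (real \<Lambda> - 1) / 2) = real \<Lambda> * (\<tau> + (real \<Lambda> - 1) / 2) + real \<Lambda> * of_int m"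
    using bary \<tau>(3) \<sigma>(3) unfolding barycenter_eq_iff [OF \<Lambda>] by auto
  then have "real \<Lambda> * (\<sigma> - \<tau> - of_int m) = 0"
    by (simp add: algebra_simps)
  then have m: "\<sigma> - \<tau> = of_int m"
    using \<Lambda> by simp
  \<comment> \<open>Both offsets lie in [0, 1), so their integer difference must be 0.\<close>
  then have "\<bar>real_of_int m\<bar> < 1"
    using \<tau>(1) \<sigma>(1) by (auto simp: abs_less_iff)
  then have "m = 0" by linarith
  then have "\<sigma> = \<tau>" using m by simp
  then have image: "Y ` {..<\<Lambda>} = Z ` {..<\<Lambda>}"
    using \<tau>(2) \<sigma>(2) by simp
  have inj: "inj_on Y {..<\<Lambda>}" "inj_on Z {..<\<Lambda>}" and ext: "\<And>i. \<not> i < \<Lambda> \<Longrightarrow> Y i = undefined \<and> Z i = undefined"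
    using Y Z by (auto simp: C_conf_def R_conf_def X_conf_def PiE_def extensional_def)
  define p where "p i = (if i < \<Lambda> then inv_into {..<\<Lambda>} Z (Y i) else i)" for i
  have "bij_betw (inv_into {..<\<Lambda>} Z \<circ> Y) {..<\<Lambda>} {..<\<Lambda>}"
    using inj image by (intro bij_betw_trans [of Y _ "Z ` {..<\<Lambda>}"] bij_betw_inv_into) (auto simp: bij_betw_def)
  then have "bij_betw p {..<\<Lambda>} {..<\<Lambda>}"
    by (rule bij_betw_cong [THEN iffD1, rotated]) (simp add: p_def)
  then have "p permutes {..<\<Lambda>}"
    by (rule bij_imp_permutes) (simp add: p_def)
  moreover have "Y = Z \<circ> p"
  proof
    fix i
    show "Y i = (Z \<circ> p) i"
    proof (cases "i < \<Lambda>")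
      case True
      then have "Y i \<in> Z ` {..<\<Lambda>}" using image by auto
      then show ?thesis using True by (simp add: p_def f_inv_into_f)
    qed (simp add: p_def ext)
  qed
  ultimately show ?thesis by blast
qed

section \<open>Convergence of the gradient flow\<close>

lemma min_dist_le:
  assumes "i < \<Lambda>" "j < \<Lambda>" "i \<noteq> j"
  shows "min_dist \<Lambda> X \<le> per_abs \<Lambda> (X i - X j)"
proof -
  let ?S = "{per_abs \<Lambda> (X i - X j) | i j. i < \<Lambda> \<and> j < \<Lambda> \<and> i \<noteq> j}"
  have "?S \<subseteq> (\<lambda>(i, j). per_abs \<Lambda> (X i - X j)) ` ({..<\<Lambda>} \<times> {..<\<Lambda>})"
    by auto
  then have "finite ?S"
    by (rule finite_subset) simp
  then have "Min ?S \<le> per_abs \<Lambda> (X i - X j)"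
    using assms by (intro Min_le) auto
  moreover have "\<Lambda> \<noteq> 1" using assms by auto
  ultimately show ?thesis by (simp add: min_dist_def)
qed

lemma powr_pair_constant: "1 \<le> \<Lambda> \<Longrightarrow> real \<Lambda> powr - (1 + 2 * s) * real \<Lambda> = real \<Lambda> powr (- 2 * s)"
  using powr_mult_base [of "real \<Lambda>" "- (1 + 2 * s)"] by (simp add: mult.commute)

text \<open>The diagonal terms vanish through (h i - h i), so the lower bound on g' is only called
  upon for distinct particles, whose separation \<open>4 * \<epsilon>\<close> exceeds the threshold
  \<open>2 * \<epsilon>\<close>.\<close>

lemma energy_hessian_lower_bound:
  assumes \<rho>: "standard_mollifier \<rho>" and s: "0 < s" "s < 1"
  shows "hessian_lower_bound \<rho> s 1"
  unfolding hessian_lower_bound_def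
proof (intro allI impI ballI)
  fix \<Lambda> :: nat and \<epsilon> :: real and Y h :: "nat \<Rightarrow> real"
  assume \<Lambda>: "1 \<le> \<Lambda>" and \<epsilon>: "0 < \<epsilon>" and dist: "4 * \<epsilon> \<le> min_dist \<Lambda> Y" and h: "(\<Sum>i<\<Lambda>. h i) = 0"
  let ?\<kappa> = "real \<Lambda> powr - (1 + 2 * s)"
  obtain G g g' where energy: "\<And>X. energy \<rho> s \<epsilon> \<Lambda> X = 1 / 2 * (\<Sum>i<\<Lambda>. \<Sum>j<\<Lambda>. G (X i - X j))"
    and G: "\<And>z. (G has_real_derivative g z) (at z)"
    and g: "\<And>z. (g has_real_derivative g' z) (at z)"
    and odd: "\<And>z. g (- z) = - g z" and per: "\<And>z. g (z + real \<Lambda>) = g z"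
    and g': "\<And>z. \<forall>k::int. 2 * \<epsilon> \<le> \<bar>z + real \<Lambda> * of_int k\<bar> \<Longrightarrow> ?\<kappa> \<le> g' z"
    by (rule energy_pair_interaction [OF \<rho> \<epsilon> \<Lambda> s]) (rule that)
  have "?\<kappa> * (h i - h j)\<^sup>2 \<le> g' (Y i - Y j) * (h i - h j)\<^sup>2" if "i < \<Lambda>" "j < \<Lambda>" for i j
  proof (cases "i = j")
    case False
    have "2 * \<epsilon> \<le> \<bar>Y i - Y j + real \<Lambda> * of_int k\<bar>" for k
      using min_dist_le [OF that False, of Y] per_abs_le [of \<Lambda> "Y i - Y j" k] dist \<epsilon> by linarith
    then show ?thesis
      by (intro mult_right_mono g' allI) auto
  qed simp
  then have "(\<Sum>i<\<Lambda>. \<Sum>j<\<Lambda>. ?\<kappa> * (h i - h j)\<^sup>2) \<le> (\<Sum>i<\<Lambda>. \<Sum>j<\<Lambda>. g' (Y i - Y j) * (h i - h j)\<^sup>2)"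
    by (intro sum_mono) auto
  moreover have "(\<Sum>i<\<Lambda>. \<Sum>j<\<Lambda>. ?\<kappa> * (h i - h j)\<^sup>2) = 2 * (?\<kappa> * real \<Lambda>) * (\<Sum>i<\<Lambda>. (h i)\<^sup>2)"
    using sum_square_diff [OF h] by (simp flip: sum_distrib_left)
  ultimately show "1 * real \<Lambda> powr (- 2 * s) * (\<Sum>i<\<Lambda>. (h i)\<^sup>2) \<le> hessian_form \<Lambda> (energy \<rho> s \<epsilon> \<Lambda>) Y h"
    unfolding hessian_pair_sum [OF energy G g odd] powr_pair_constant [OF \<Lambda>] by simp
qed

lemma sorting_permutation:
  fixes X :: "nat \<Rightarrow> real"
  assumes "inj_on X {..<n}"
  obtains \<pi> where "bij_betw \<pi> {..<n} {..<n}" "\<And>i j. i < j \<Longrightarrow> j < n \<Longrightarrow> X (\<pi> i) < X (\<pi> j)"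
proof -
  define xs where "xs = sort_key X [0..<n]"
  have xs: "length xs = n" "distinct xs" "set xs = {..<n}" "sorted (map X xs)"
    by (auto simp: xs_def)
  have bij: "bij_betw ((!) xs) {..<n} {..<n}"
    using bij_betw_nth [OF xs(2)] xs(1,3) by blast
  have "X (xs ! i) < X (xs ! j)" if ij: "i < j" "j < n" for i j
  proof -
    have "X (xs ! i) \<le> X (xs ! j)"
      using sorted_nth_mono [OF xs(4), of i j] ij xs(1) by simp
    moreover have "xs ! i \<noteq> xs ! j" "xs ! i < n" "xs ! j < n"
      using ij xs nth_mem [of _ xs] by (auto simp: nth_eq_iff_index_eq)
    then have "X (xs ! i) \<noteq> X (xs ! j)"
      using assms by (auto simp: inj_on_def)
    ultimately show ?thesis by simp
  qed
  with bij show ?thesis by (rule that)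
qed

text \<open>The interval [r, \<Lambda> - r] stays at distance at least r from every multiple of
  \<Lambda>, so the mean value theorem meets g' only where its bound holds.\<close>

lemma strongly_monotone_force:
  fixes g g' :: "real \<Rightarrow> real"
  assumes g: "\<And>z. (g has_real_derivative g' z) (at z)"
    and g': "\<And>z. \<forall>k::int. r \<le> \<bar>z + real \<Lambda> * of_int k\<bar> \<Longrightarrow> \<kappa> \<le> g' z"
    and ab: "r \<le> a" "a \<le> b" "b \<le> real \<Lambda> - r"
  shows "\<kappa> * (b - a) \<le> g b - g a"
proof (cases "a = b")
  case False
  then obtain z where z: "a < z" "z < b" "g b - g a = (b - a) * g' z"
    using MVT2 [of a b g g'] g ab(2) by auto
  have "r \<le> \<bar>z + real \<Lambda> * of_int k\<bar>" for k :: int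
  proof (cases "0 \<le> k")
    case True
    then have "0 \<le> real \<Lambda> * of_int k" by simp
    then show ?thesis using z ab by linarith
  next
    case False
    then have "real \<Lambda> * of_int k \<le> real \<Lambda> * - 1"
      by (intro mult_left_mono) auto
    then show ?thesis using z ab by linarith
  qed
  then have "\<kappa> * (b - a) \<le> g' z * (b - a)"
    using ab(2) by (intro mult_right_mono g' allI) auto
  then show ?thesis using z by (simp add: mult.commute)
qed simp

lemma gradient_flow_convergence:
  assumes s: "0 < s" "s < 1" and \<Lambda>: "1 \<le> \<Lambda>" and X0: "X0 \<in> R_conf \<Lambda>"
    and Y: "Y \<in> C_conf \<Lambda>" and bary: "barycenter \<Lambda> Y = barycenter \<Lambda> X0"
  shows "\<exists>\<epsilon>bar>0. \<forall>\<rho>. standard_mollifier \<rho> \<longrightarrow> (\<forall>\<epsilon>. 0 < \<epsilon> \<and> \<epsilon> < \<epsilon>bar \<longrightarrow>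
    (\<forall>X. gradient_flow \<rho> s \<epsilon> \<Lambda> X0 X \<longrightarrow> (\<forall>t\<ge>0. reduce \<Lambda> (X t) \<in> R_conf \<Lambda> \<and>
      conf_dist \<Lambda> (reduce \<Lambda> (X t)) Y \<le> conf_dist \<Lambda> X0 Y * exp (- 1 * real \<Lambda> powr (- 2 * s) * t))))"
proof -
  have X0_range: "\<And>i. i < \<Lambda> \<Longrightarrow> 0 \<le> X0 i \<and> X0 i < real \<Lambda>" and X0_inj: "inj_on X0 {..<\<Lambda>}"
    using X0 by (auto simp: R_conf_def X_conf_def PiE_def Pi_def)
  obtain \<pi> where \<pi>: "bij_betw \<pi> {..<\<Lambda>} {..<\<Lambda>}"
    and \<pi>_mono: "\<And>i j. i < j \<Longrightarrow> j < \<Lambda> \<Longrightarrow> X0 (\<pi> i) < X0 (\<pi> j)"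
    using sorting_permutation [OF X0_inj] by metis
  have \<pi>_less: "i < \<Lambda> \<Longrightarrow> \<pi> i < \<Lambda>" for i
    using bij_betwE [OF \<pi>] by simp
  define a where "a i = X0 (\<pi> i)" for i
  have a: "a i < a j \<and> a j - a i < real \<Lambda>" if "i < j" "j < \<Lambda>" for i j
    using that \<pi>_mono [of i j] X0_range [OF \<pi>_less, of i] X0_range [OF \<pi>_less, of j] by (simp add: a_def)
  have "X0 ` {..<\<Lambda>} = (\<lambda>i. X0 (\<pi> i)) ` {..<\<Lambda>}"
    using bij_betw_imp_surj_on [OF \<pi>] by (metis image_image)
  then have ordered_X0: "ordered \<Lambda> X0 i = a i" if "i < \<Lambda>" for i
    using a that by (intro ordered_eq) (auto simp: a_def)

  obtain \<tau> where Y_image: "Y ` {..<\<Lambda>} = (\<lambda>k. real k + \<tau>) ` {..<\<Lambda>}"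
    and Y_sum: "(\<Sum>i<\<Lambda>. Y i) = real \<Lambda> * (\<tau> + (real \<Lambda> - 1) / 2)"
    using C_conf_sum [OF Y] by metis
  have ordered_Y: "ordered \<Lambda> Y i = \<tau> + real i" if "i < \<Lambda>" for i
    using that Y_image by (intro ordered_eq) (auto simp: add.commute)
  obtain m :: int where m: "(\<Sum>i<\<Lambda>. X0 i) = (\<Sum>i<\<Lambda>. Y i) + real \<Lambda> * of_int m"
    using bary barycenter_eq_iff [OF \<Lambda>] by blast
  \<comment> \<open>The offset \<tau> is known only up to an integer; m selects the lattice on the
    line with the same sum as the initial positions.\<close>
  define b where "b = \<tau> + of_int m"
  have a_sum: "(\<Sum>i<\<Lambda>. a i) = (\<Sum>i<\<Lambda>. b + real i)"
  proof -
    have "(\<Sum>i<\<Lambda>. a i) = (\<Sum>i<\<Lambda>. X0 i)"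
      unfolding a_def by (rule sum.reindex_bij_betw [OF \<pi>])
    then show ?thesis
      using sum_lattice [of b \<Lambda>] by (simp add: m Y_sum b_def add.commute algebra_simps)
  qed

  define l where "l n = a (n mod \<Lambda>) + real \<Lambda> * real (n div \<Lambda>)" for n
  \<comment> \<open>Half the smallest initial gap, the one across the period included. The entry 1
    ensures that \<open>2 * \<epsilon>\<close> does not exceed the lattice spacing.\<close>
  define \<epsilon>bar where "\<epsilon>bar = Min (insert 1 ((\<lambda>n. l (Suc n) - l n) ` {..<\<Lambda>})) / 2"
  have l_Suc: "l n < l (Suc n)" for n
    unfolding l_def using \<Lambda> a by (rule periodic_extension_increasing)
  have "0 < \<epsilon>bar"
    unfolding \<epsilon>bar_def using l_Suc by simp
  have \<epsilon>bar_1: "2 * \<epsilon>bar \<le> 1" and \<epsilon>bar_gap: "n < \<Lambda> \<Longrightarrow> 2 * \<epsilon>bar \<le> l (Suc n) - l n" for n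
    unfolding \<epsilon>bar_def by simp_all

  have "reduce \<Lambda> (X t) \<in> R_conf \<Lambda> \<and>
      conf_dist \<Lambda> (reduce \<Lambda> (X t)) Y \<le> conf_dist \<Lambda> X0 Y * exp (- 1 * real \<Lambda> powr (- 2 * s) * t)"
    if \<rho>: "standard_mollifier \<rho>" and \<epsilon>: "0 < \<epsilon>" "\<epsilon> < \<epsilon>bar"
      and flow: "gradient_flow \<rho> s \<epsilon> \<Lambda> X0 X" and t: "0 \<le> t" for \<rho> \<epsilon> X t
  proof -
    define \<kappa> where "\<kappa> = real \<Lambda> powr - (1 + 2 * s)"
    obtain G g g' where energy: "\<And>X. energy \<rho> s \<epsilon> \<Lambda> X = 1 / 2 * (\<Sum>i<\<Lambda>. \<Sum>j<\<Lambda>. G (X i - X j))"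
      and G: "\<And>z. (G has_real_derivative g z) (at z)"
      and g: "\<And>z. (g has_real_derivative g' z) (at z)"
      and odd: "\<And>z. g (- z) = - g z" and per: "\<And>z. g (z + real \<Lambda>) = g z"
      and g': "\<And>z. \<forall>k::int. 2 * \<epsilon> \<le> \<bar>z + real \<Lambda> * of_int k\<bar> \<Longrightarrow> \<kappa> \<le> g' z"
      by (rule energy_pair_interaction [OF \<rho> \<epsilon>(1) \<Lambda> s, folded \<kappa>_def]) (rule that)
    \<comment> \<open>The particles are relabelled once, by their order at time 0; since the gaps
      persist, this labelling stays increasing.\<close>
    define x where "x t i = X t (\<pi> i)" for t i
    interpret pair_flow \<Lambda> g "2 * \<epsilon>" \<kappa> x
    proof
      show "((\<lambda>t. x t i) has_real_derivative - (\<Sum>j<\<Lambda>. g (x t i - x t j))) (at t within {0..})"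
        if t: "0 \<le> t" and i: "i < \<Lambda>" for t i
      proof -
        have "((\<lambda>t. X t (\<pi> i)) has_real_derivative - partial (\<pi> i) (energy \<rho> s \<epsilon> \<Lambda>) (X t)) (at t within {0..})"
          using flow t \<pi>_less [OF i] by (simp add: gradient_flow_def)
        also have "partial (\<pi> i) (energy \<rho> s \<epsilon> \<Lambda>) (X t) = (\<Sum>j<\<Lambda>. g (X t (\<pi> i) - X t j))"
          by (rule partial_pair_sum [OF energy G odd \<pi>_less [OF i]])
        also have "\<dots> = (\<Sum>j<\<Lambda>. g (X t (\<pi> i) - X t (\<pi> j)))"
          by (rule sum.reindex_bij_betw [OF \<pi>, symmetric])
        finally show ?thesis by (simp add: x_def)
      qed
      show "\<kappa> * (b - a) \<le> g b - g a" if "2 * \<epsilon> \<le> a" "a \<le> b" "b \<le> real \<Lambda> - 2 * \<epsilon>" for a b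
        by (rule strongly_monotone_force [OF g g' that])
    qed (use \<Lambda> \<epsilon> \<epsilon>bar_1 odd per in \<open>auto simp: \<kappa>_def\<close>)
    have x_0: "x 0 i = a i" if "i < \<Lambda>" for i
      using flow \<pi>_less [OF that] by (simp add: gradient_flow_def x_def a_def)
    have init: "2 * \<epsilon> < gap 0 n" for n
    proof -
      have "lift 0 n = l n" for n
        using \<Lambda> x_0 by (simp add: lift_def l_def)
      then show ?thesis
        using \<epsilon>bar_gap [of "n mod \<Lambda>"] \<epsilon> \<Lambda> gap_mod [of 0 n] by (simp add: gap_def)
    qed
    have x_mono: "X t (\<pi> i) < X t (\<pi> j) \<and> X t (\<pi> j) - X t (\<pi> i) < real \<Lambda>" if "i < j" "j < \<Lambda>" for i j
      using ordered_gaps [OF init t that] \<epsilon> by (simp add: x_def)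
    note red = reduce_increasing [of \<Lambda> \<pi> "X t", OF \<Lambda> \<pi> x_mono]
    obtain p where p: "\<And>i. i < \<Lambda> \<Longrightarrow> \<exists>u::int. ordered \<Lambda> (reduce \<Lambda> (X t)) i = x t ((p + i) mod \<Lambda>) + real \<Lambda> * of_int u"
      using red(2) unfolding x_def by blast
    have "conf_dist \<Lambda> (reduce \<Lambda> (X t)) Y \<le> sqrt (\<Sum>i<\<Lambda>. (x t i - (b + real i))\<^sup>2)"
      unfolding b_def by (rule conf_dist_lattice_le [OF \<Lambda> p ordered_Y])
    also have "\<dots> \<le> sqrt ((\<Sum>i<\<Lambda>. (x 0 i - (b + real i))\<^sup>2) * exp (- (2 * \<kappa> * real \<Lambda>) * t))"
      using x_0 a_sum by (intro real_sqrt_le_mono exponential_decay init t) simp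
    \<comment> \<open>The decay was proved for the squared displacement; the square root halves its
      rate to \<open>\<kappa> * \<Lambda> = \<Lambda> powr (- 2 * s)\<close>.\<close>
    also have "exp (- (2 * \<kappa> * real \<Lambda>) * t) = (exp (- 1 * real \<Lambda> powr (- 2 * s) * t))\<^sup>2"
      unfolding powr_pair_constant [OF \<Lambda>, symmetric] \<kappa>_def by (simp add: exp_double [symmetric] mult_ac)
    also have "sqrt ((\<Sum>i<\<Lambda>. (x 0 i - (b + real i))\<^sup>2) * (exp (- 1 * real \<Lambda> powr (- 2 * s) * t))\<^sup>2)
      = sqrt (\<Sum>i<\<Lambda>. (a i - (b + real i))\<^sup>2) * exp (- 1 * real \<Lambda> powr (- 2 * s) * t)"
      using x_0 by (simp add: real_sqrt_mult)
    also have "\<dots> \<le> conf_dist \<Lambda> X0 Y * exp (- 1 * real \<Lambda> powr (- 2 * s) * t)"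
      by (intro mult_right_mono conf_dist_lattice_ge [OF \<Lambda> a ordered_X0 ordered_Y a_sum]) auto
    finally show ?thesis using red(1) by simp
  qed
  then show ?thesis using \<open>0 < \<epsilon>bar\<close> by blast
qed

theorem proposition4p4:
  fixes s :: real
  assumes "1 / 2 \<le> s" and "s < 1"
  shows "\<exists>\<gamma>>0.
    (\<forall>\<rho>. standard_mollifier \<rho> \<longrightarrow> hessian_lower_bound \<rho> s \<gamma>) \<and>
    (\<forall>\<Lambda>\<ge>1. \<forall>X0\<in>R_conf \<Lambda>.
      \<exists>Xinf\<in>C_conf \<Lambda>. barycenter \<Lambda> Xinf = barycenter \<Lambda> X0 \<and>
        (\<forall>Y\<in>C_conf \<Lambda>. barycenter \<Lambda> Y = barycenter \<Lambda> X0 \<longrightarrow>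
          (\<exists>p. p permutes {..<\<Lambda>} \<and> Y = Xinf \<circ> p)) \<and>
        (\<exists>\<epsilon>bar>0. \<forall>\<rho>. standard_mollifier \<rho> \<longrightarrow> (\<forall>\<epsilon>. 0 < \<epsilon> \<and> \<epsilon> < \<epsilon>bar \<longrightarrow>
          (\<forall>X. gradient_flow \<rho> s \<epsilon> \<Lambda> X0 X \<longrightarrow>
            (\<forall>t\<ge>0. reduce \<Lambda> (X t) \<in> R_conf \<Lambda> \<and>
              conf_dist \<Lambda> (reduce \<Lambda> (X t)) Xinf
                \<le> conf_dist \<Lambda> X0 Xinf * exp (- \<gamma> * real \<Lambda> powr (- 2 * s) * t))))))"
proof (intro exI [of _ 1] conjI allI impI ballI)
  have s: "0 < s" "s < 1" using assms by auto
  show "hessian_lower_bound \<rho> s 1" if "standard_mollifier \<rho>" for \<rho>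
    using that s by (rule energy_hessian_lower_bound)
  fix \<Lambda> :: nat and X0 assume \<Lambda>: "1 \<le> \<Lambda>" and X0: "X0 \<in> R_conf \<Lambda>"
  obtain Xinf where Xinf: "Xinf \<in> C_conf \<Lambda>" "barycenter \<Lambda> Xinf = barycenter \<Lambda> X0"
    using lattice_configuration_exists [OF \<Lambda>] by blast
  show "\<exists>Xinf\<in>C_conf \<Lambda>. barycenter \<Lambda> Xinf = barycenter \<Lambda> X0 \<and>
        (\<forall>Y\<in>C_conf \<Lambda>. barycenter \<Lambda> Y = barycenter \<Lambda> X0 \<longrightarrow>
          (\<exists>p. p permutes {..<\<Lambda>} \<and> Y = Xinf \<circ> p)) \<and>
        (\<exists>\<epsilon>bar>0. \<forall>\<rho>. standard_mollifier \<rho> \<longrightarrow> (\<forall>\<epsilon>. 0 < \<epsilon> \<and> \<epsilon> < \<epsilon>bar \<longrightarrow>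
          (\<forall>X. gradient_flow \<rho> s \<epsilon> \<Lambda> X0 X \<longrightarrow>
            (\<forall>t\<ge>0. reduce \<Lambda> (X t) \<in> R_conf \<Lambda> \<and>
              conf_dist \<Lambda> (reduce \<Lambda> (X t)) Xinf
                \<le> conf_dist \<Lambda> X0 Xinf * exp (- 1 * real \<Lambda> powr (- 2 * s) * t)))))"
    using lattice_configuration_unique [OF \<Lambda> _ Xinf(1)]
      gradient_flow_convergence [OF s \<Lambda> X0 Xinf]
    by (intro bexI [of _ Xinf] conjI ballI impI) (auto simp: Xinf)
qed simp

end
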